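(* Let $V$ be an irreducible finite-dimensional $\mathcal{H}$-module, where $\mathcal{H}=\mathcal{H}(k)$ is the rational Cherednik algebra attached to a reduced root system $R$ with Weyl group $W$ and a $W$-invariant multiplicity function $k:R\to\mathbb{C}$. Then there exists an irreducible character $\chi$ of $W$ such that $V\simeq L(\chi)$ as $\mathcal{H}$-modules, where $L(\chi)$ is the unique simple quotient of the Verma module $M(\chi)$.
   Context: Let $\mathfrak{a}_{\mathbb{R}}$ be a real vector space of dimension $\ell\ge 1$, $R\subset\mathfrak{a}_{\mathbb{R}}^*$ a reduced root system, $W$ its Weyl group, $\mathfrak{a}=\mathbb{C}\otimes_{\mathbb{R}}\mathfrak{a}_{\mathbb{R}}$. For $\alpha\in R$ let $r_\alpha$ be the reflection and $\alpha^\vee\in\mathfrak{a}$ the coroot. Fix $k:R\to\mathbb{C}$, $\alpha\mapsto k_\alpha$, with $k_{w(\alpha)}=k_\alpha$ for all $w\in W$. Let $\mathcal{P}=S(\mathfrak{a}^* )$ be the symmetric algebra, with its natural $W$-action. For $y\in\mathfrak{a}$, with $\partial_y$ the associated derivation of $\mathcal{P}$ and $R^+$ a system of positive roots, the Dunkl operator $T_y=T_y(k)\in\mathrm{End}_{\mathbb{C}}(\mathcal{P})$ is $$T_y=\partial_y+\sum_{\alpha\in R^+}k_\alpha\frac{\langle\alpha,y\rangle}{\alpha}(1-r_\alpha).$$ The rational Cherednik algebra $\mathcal{H}=\mathcal{H}(k)$ is the subalgebra of $\mathrm{End}_{\mathbb{C}}(\mathcal{P})$ generated by all $w\in W$, all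 multiplications by $x\in\mathfrak{a}^*$ and all $T_y$, $y\in\mathfrak{a}$. The map $y\mapsto T_y$ extends to an algebra isomorphism $T$ from $S(\mathfrak{a})$ onto $\mathcal{S}=\mathbb{C}[T_y:y\in\mathfrak{a}]$; put $\mathcal{S}_+=\bigoplus_{n\ge1}T(S^n(\mathfrak{a}))$. Multiplication gives $\mathcal{H}=\mathcal{P}\otimes\mathbb{C}W\otimes\mathcal{S}$ as vector spaces, and $\mathcal{S}\otimes\mathbb{C}W$ denotes the subalgebra generated by $\mathcal{S}$ and $W$. For an irreducible character $\chi$ of $W$ let $V_\chi$ be an irreducible $W$-module of character $\chi$, made into an $\mathcal{S}\otimes\mathbb{C}W$-module by $\mathcal{S}_+V_\chi=0$. The Verma module is $M(\chi)=\mathcal{H}\otimes_{\mathcal{S}\otimes\mathbb{C}W}V_\chi$. It has a unique maximal submodule, hence a unique simple quotient, denoted $L(\chi)=L(\chi,k)$. Dimensions are over $\mathbb{C}$. *)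

theory Defs
  imports
    "HOL-Analysis.Derivative"
    "HOL-Algebra.Generated_Rings"
    "HOL-Algebra.Free_Abelian_Groups"
    "Jordan_Normal_Form.Matrix"
begin

section \<open>Root systems in the dual of a real vector space\<close>

text \<open>
  The real vector space is the type \<open>'a\<close> of class \<open>euclidean_space\<close>; of this structure only the
  finite-dimensional nonzero real vector space is used, never the inner product. Elements of the
  dual space are the functions \<open>'a \<Rightarrow> real\<close> satisfying \<^const>\<open>linear\<close>.
\<close>

definition is_coroot :: "('a::euclidean_space \<Rightarrow> real) set \<Rightarrow> ('a \<Rightarrow> real) \<Rightarrow> 'a \<Rightarrow> bool" where
  "is_coroot R \<alpha> v \<longleftrightarrow> \<alpha> v = 2 \<and> (\<lambda>\<beta>. (\<lambda>p. \<beta> p - \<beta> v * \<alpha> p)) ` R = R"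

text \<open>For a finite spanning set \<open>R\<close> of nonzero functionals there is at most one coroot of a root.\<close>

definition coroot :: "('a::euclidean_space \<Rightarrow> real) set \<Rightarrow> ('a \<Rightarrow> real) \<Rightarrow> 'a" where
  "coroot R \<alpha> = (THE v. is_coroot R \<alpha> v)"

definition root_system :: "('a::euclidean_space \<Rightarrow> real) set \<Rightarrow> bool" where
  "root_system R \<longleftrightarrow>
     finite R \<and> (\<forall>\<alpha>\<in>R. linear \<alpha>) \<and> (\<lambda>_. 0) \<notin> R \<and>
     (\<forall>x::'a \<Rightarrow> real. linear x \<longrightarrow> (\<exists>c. x = (\<lambda>p. \<Sum>\<alpha>\<in>R. c \<alpha> * \<alpha> p))) \<and>
     (\<forall>\<alpha>\<in>R. \<exists>v. is_coroot R \<alpha> v) \<and>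
     (\<forall>\<alpha>\<in>R. \<forall>\<beta>\<in>R. \<beta> (coroot R \<alpha>) \<in> \<int>)"

definition reduced_root_system :: "('a::euclidean_space \<Rightarrow> real) set \<Rightarrow> bool" where
  "reduced_root_system R \<longleftrightarrow>
     root_system R \<and> (\<forall>\<alpha>\<in>R. \<forall>c::real. (\<lambda>p. c * \<alpha> p) \<in> R \<longrightarrow> c = 1 \<or> c = -1)"

definition positive_system ::
  "('a::euclidean_space \<Rightarrow> real) set \<Rightarrow> ('a \<Rightarrow> real) set \<Rightarrow> bool" where
  "positive_system R Rp \<longleftrightarrow> (\<exists>v. (\<forall>\<alpha>\<in>R. \<alpha> v \<noteq> 0) \<and> Rp = {\<alpha> \<in> R. \<alpha> v > 0})"

definition root_reflection ::
  "('a::euclidean_space \<Rightarrow> real) set \<Rightarrow> ('a \<Rightarrow> real) \<Rightarrow> 'a \<Rightarrow> 'a" where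
  "root_reflection R \<alpha> p = p - \<alpha> p *\<^sub>R coroot R \<alpha>"

text \<open>The generators are involutions, so closure under inverses is automatic.\<close>

inductive_set weyl_group :: "('a::euclidean_space \<Rightarrow> real) set \<Rightarrow> ('a \<Rightarrow> 'a) set"
  for R where
    weyl_id: "id \<in> weyl_group R"
  | weyl_step: "\<alpha> \<in> R \<Longrightarrow> w \<in> weyl_group R \<Longrightarrow> root_reflection R \<alpha> \<circ> w \<in> weyl_group R"

text \<open>Here \<open>\<alpha> \<circ> inv_into UNIV w\<close> is the image of the root \<open>\<alpha>\<close> under the contragredient action of \<open>w\<close>.\<close>

definition weyl_invariant ::
  "('a::euclidean_space \<Rightarrow> real) set \<Rightarrow> (('a \<Rightarrow> real) \<Rightarrow> complex) \<Rightarrow> bool" where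
  "weyl_invariant R k \<longleftrightarrow> (\<forall>w\<in>weyl_group R. \<forall>\<alpha>\<in>R. k (\<alpha> \<circ> inv_into UNIV w) = k \<alpha>)"


section \<open>The symmetric algebra and its endomorphisms\<close>

text \<open>
  The complexified dual space consists of the real-linear functions \<open>'a \<Rightarrow> complex\<close>. Its symmetric
  algebra is realised as the algebra of complex-valued polynomial functions on the real space
  (a polynomial is determined by its values on real points).
\<close>

inductive_set polyfun :: "('a::euclidean_space \<Rightarrow> complex) set" where
    polyfun_const: "(\<lambda>_. c) \<in> polyfun"
  | polyfun_linear: "linear x \<Longrightarrow> x \<in> polyfun"
  | polyfun_add: "f \<in> polyfun \<Longrightarrow> g \<in> polyfun \<Longrightarrow> (\<lambda>p. f p + g p) \<in> polyfun"
  | polyfun_mult: "f \<in> polyfun \<Longrightarrow> g \<in> polyfun \<Longrightarrow> (\<lambda>p. f p * g p) \<in> polyfun"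

type_synonym 'a operator = "('a \<Rightarrow> complex) \<Rightarrow> ('a \<Rightarrow> complex)"

definition end_ring :: "('a::euclidean_space) operator ring" where
  "end_ring = \<lparr>
     carrier = {F \<in> polyfun \<rightarrow>\<^sub>E polyfun.
        (\<forall>f\<in>polyfun. \<forall>g\<in>polyfun. F (\<lambda>p. f p + g p) = (\<lambda>p. F f p + F g p)) \<and>
        (\<forall>c. \<forall>f\<in>polyfun. F (\<lambda>p. c * f p) = (\<lambda>p. c * F f p))},
     monoid.mult = compose polyfun,
     monoid.one = (\<lambda>f\<in>polyfun. f),
     ring.zero = (\<lambda>f\<in>polyfun. \<lambda>p. 0),
     ring.add = (\<lambda>F G. \<lambda>f\<in>polyfun. \<lambda>p. F f p + G f p)\<rparr>"

definition scalar_op :: "complex \<Rightarrow> ('a::euclidean_space) operator" where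
  "scalar_op c = (\<lambda>f\<in>polyfun. \<lambda>p. c * f p)"

definition mult_op :: "('a::euclidean_space \<Rightarrow> complex) \<Rightarrow> 'a operator" where
  "mult_op x = (\<lambda>f\<in>polyfun. \<lambda>p. x p * f p)"

definition weyl_op :: "('a::euclidean_space \<Rightarrow> 'a) \<Rightarrow> 'a operator" where
  "weyl_op w = (\<lambda>f\<in>polyfun. f \<circ> inv_into UNIV w)"


section \<open>Dunkl operators and the rational Cherednik algebra\<close>

text \<open>
  A pair \<open>y = (u, v)\<close> stands for the element \<open>u + \<i> v\<close> of the complexification of the real space.
\<close>

definition pairing :: "('a::euclidean_space \<Rightarrow> real) \<Rightarrow> 'a \<times> 'a \<Rightarrow> complex" where
  "pairing \<alpha> y = Complex (\<alpha> (fst y)) (\<alpha> (snd y))"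

definition deriv_along :: "'a::euclidean_space \<times> 'a \<Rightarrow> ('a \<Rightarrow> complex) \<Rightarrow> 'a \<Rightarrow> complex" where
  "deriv_along y f p =
     vector_derivative (\<lambda>t. f (p + t *\<^sub>R fst y)) (at 0) +
     \<i> * vector_derivative (\<lambda>t. f (p + t *\<^sub>R snd y)) (at 0)"

text \<open>The quotient of \<open>f - r\<^sub>\<alpha> f\<close> by \<open>\<alpha>\<close> in the polynomial algebra.\<close>

definition divided_difference ::
  "('a::euclidean_space \<Rightarrow> real) set \<Rightarrow> ('a \<Rightarrow> real) \<Rightarrow> ('a \<Rightarrow> complex) \<Rightarrow> 'a \<Rightarrow> complex" where
  "divided_difference R \<alpha> f =
     (THE g. g \<in> polyfun \<and>
        (\<forall>p. complex_of_real (\<alpha> p) * g p = f p - weyl_op (root_reflection R \<alpha>) f p))"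

definition dunkl ::
  "('a::euclidean_space \<Rightarrow> real) set \<Rightarrow> ('a \<Rightarrow> real) set \<Rightarrow> (('a \<Rightarrow> real) \<Rightarrow> complex) \<Rightarrow>
   'a \<times> 'a \<Rightarrow> 'a operator" where
  "dunkl R Rp k y = (\<lambda>f\<in>polyfun. \<lambda>p.
     deriv_along y f p + (\<Sum>\<alpha>\<in>Rp. k \<alpha> * pairing \<alpha> y * divided_difference R \<alpha> f p))"

definition cherednik_algebra ::
  "('a::euclidean_space \<Rightarrow> real) set \<Rightarrow> ('a \<Rightarrow> real) set \<Rightarrow> (('a \<Rightarrow> real) \<Rightarrow> complex) \<Rightarrow>
   'a operator ring" where
  "cherednik_algebra R Rp k = end_ring\<lparr>carrier := generate_ring end_ring
     (range scalar_op \<union> weyl_op ` weyl_group R \<union> mult_op ` {x. linear x} \<union> range (dunkl R Rp k))\<rparr>"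

definition dunkl_algebra ::
  "('a::euclidean_space \<Rightarrow> real) set \<Rightarrow> ('a \<Rightarrow> real) set \<Rightarrow> (('a \<Rightarrow> real) \<Rightarrow> complex) \<Rightarrow>
   'a operator ring" where
  "dunkl_algebra R Rp k = end_ring\<lparr>carrier := generate_ring end_ring
     (range scalar_op \<union> range (dunkl R Rp k))\<rparr>"

definition dunkl_weyl_algebra ::
  "('a::euclidean_space \<Rightarrow> real) set \<Rightarrow> ('a \<Rightarrow> real) set \<Rightarrow> (('a \<Rightarrow> real) \<Rightarrow> complex) \<Rightarrow>
   'a operator ring" where
  "dunkl_weyl_algebra R Rp k = end_ring\<lparr>carrier := generate_ring end_ring
     (carrier (dunkl_algebra R Rp k) \<union> weyl_op ` weyl_group R)\<rparr>"

text \<open>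
  The sum over \<open>n \<ge> 1\<close> of the images of the \<open>n\<close>-th symmetric powers, that is, the complex span of
  the nonempty products of Dunkl operators.
\<close>

inductive_set dunkl_plus ::
  "('a::euclidean_space \<Rightarrow> real) set \<Rightarrow> ('a \<Rightarrow> real) set \<Rightarrow> (('a \<Rightarrow> real) \<Rightarrow> complex) \<Rightarrow>
   'a operator set"
  for R Rp k where
    plus_zero: "\<zero>\<^bsub>end_ring\<^esub> \<in> dunkl_plus R Rp k"
  | plus_word: "ys \<noteq> [] \<Longrightarrow>
      foldr (\<lambda>y F. dunkl R Rp k y \<otimes>\<^bsub>end_ring\<^esub> F) ys \<one>\<^bsub>end_ring\<^esub> \<in> dunkl_plus R Rp k"
  | plus_add: "F \<in> dunkl_plus R Rp k \<Longrightarrow> G \<in> dunkl_plus R Rp k \<Longrightarrow>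
      F \<oplus>\<^bsub>end_ring\<^esub> G \<in> dunkl_plus R Rp k"
  | plus_scalar: "F \<in> dunkl_plus R Rp k \<Longrightarrow> scalar_op c \<otimes>\<^bsub>end_ring\<^esub> F \<in> dunkl_plus R Rp k"


section \<open>Left modules over noncommutative rings\<close>

text \<open>The library locale \<open>module\<close> requires a commutative ring; its record and \<open>submodule\<close> do not.\<close>

locale left_module = A?: ring A + M?: abelian_group M
  for A :: "('r, 's) ring_scheme" and M :: "('r, 'm, 't) module_scheme" +
  assumes smult_closed: "\<lbrakk>a \<in> carrier A; x \<in> carrier M\<rbrakk> \<Longrightarrow> a \<odot>\<^bsub>M\<^esub> x \<in> carrier M"
    and smult_l_distr: "\<lbrakk>a \<in> carrier A; b \<in> carrier A; x \<in> carrier M\<rbrakk> \<Longrightarrow>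
      (a \<oplus>\<^bsub>A\<^esub> b) \<odot>\<^bsub>M\<^esub> x = a \<odot>\<^bsub>M\<^esub> x \<oplus>\<^bsub>M\<^esub> b \<odot>\<^bsub>M\<^esub> x"
    and smult_r_distr: "\<lbrakk>a \<in> carrier A; x \<in> carrier M; y \<in> carrier M\<rbrakk> \<Longrightarrow>
      a \<odot>\<^bsub>M\<^esub> (x \<oplus>\<^bsub>M\<^esub> y) = a \<odot>\<^bsub>M\<^esub> x \<oplus>\<^bsub>M\<^esub> a \<odot>\<^bsub>M\<^esub> y"
    and smult_assoc: "\<lbrakk>a \<in> carrier A; b \<in> carrier A; x \<in> carrier M\<rbrakk> \<Longrightarrow>
      (a \<otimes>\<^bsub>A\<^esub> b) \<odot>\<^bsub>M\<^esub> x = a \<odot>\<^bsub>M\<^esub> (b \<odot>\<^bsub>M\<^esub> x)"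
    and smult_one: "x \<in> carrier M \<Longrightarrow> \<one>\<^bsub>A\<^esub> \<odot>\<^bsub>M\<^esub> x = x"

definition irreducible_module :: "'r ring \<Rightarrow> ('r, 'm) module \<Rightarrow> bool" where
  "irreducible_module A M \<longleftrightarrow>
     left_module A M \<and> carrier M \<noteq> {\<zero>\<^bsub>M\<^esub>} \<and>
     (\<forall>N. submodule N A M \<longrightarrow> N = {\<zero>\<^bsub>M\<^esub>} \<or> N = carrier M)"

definition maximal_submodule :: "'r ring \<Rightarrow> ('r, 'm) module \<Rightarrow> 'm set \<Rightarrow> bool" where
  "maximal_submodule A M N \<longleftrightarrow>
     submodule N A M \<and> N \<noteq> carrier M \<and>
     (\<forall>N'. submodule N' A M \<longrightarrow> N \<subseteq> N' \<longrightarrow> N' \<noteq> carrier M \<longrightarrow> N' = N)"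

definition module_isomorphic :: "'r ring \<Rightarrow> ('r, 'm) module \<Rightarrow> ('r, 'n) module \<Rightarrow> bool" where
  "module_isomorphic A M N \<longleftrightarrow>
     (\<exists>f. bij_betw f (carrier M) (carrier N) \<and>
        (\<forall>x\<in>carrier M. \<forall>y\<in>carrier M. f (x \<oplus>\<^bsub>M\<^esub> y) = f x \<oplus>\<^bsub>N\<^esub> f y) \<and>
        (\<forall>a\<in>carrier A. \<forall>x\<in>carrier M. f (a \<odot>\<^bsub>M\<^esub> x) = a \<odot>\<^bsub>N\<^esub> f x))"

text \<open>Modules over algebras of operators are complex vector spaces via the scalar operators.\<close>

definition finite_dim_module :: "('a::euclidean_space operator, 'm) module \<Rightarrow> bool" where
  "finite_dim_module M \<longleftrightarrow>
     (\<exists>B. finite B \<and> B \<subseteq> carrier M \<and>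
        (\<forall>v\<in>carrier M. \<exists>c. v = (\<Oplus>\<^bsub>M\<^esub>b\<in>B. scalar_op (c b) \<odot>\<^bsub>M\<^esub> b)))"

definition quotient_module :: "('r, 'm) module \<Rightarrow> 'm set \<Rightarrow> ('r, 'm set) module" where
  "quotient_module M N = \<lparr>
     carrier = a_rcosets\<^bsub>M\<^esub> N,
     monoid.mult = undefined,
     monoid.one = undefined,
     ring.zero = N,
     ring.add = set_add M,
     smult = (\<lambda>a X. \<Union>x\<in>X. N +>\<^bsub>M\<^esub> (a \<odot>\<^bsub>M\<^esub> x))\<rparr>"

text \<open>
  The tensor product \<open>A \<otimes>\<^bsub>B\<^esub> U\<close> for a subring \<open>B\<close> of \<open>A\<close>, as the free abelian group on
  pairs modulo the subgroup generated by the usual biadditivity and balancing relations, with \<open>A\<close>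
  acting on the left factor. The free object itself satisfies \<^const>\<open>left_module\<close> only after
  passing to the quotient.
\<close>

definition free_pairs :: "'r ring \<Rightarrow> ('r, 'u) module \<Rightarrow> ('r, ('r \<times> 'u) \<Rightarrow>\<^sub>0 int) module" where
  "free_pairs A U = \<lparr>
     carrier = carrier (free_Abelian_group (carrier A \<times> carrier U)),
     monoid.mult = undefined,
     monoid.one = undefined,
     ring.zero = 0,
     ring.add = (+),
     smult = (\<lambda>a. frag_extend (\<lambda>(h, u). frag_of (a \<otimes>\<^bsub>A\<^esub> h, u)))\<rparr>"

definition tensor_relations ::
  "'r ring \<Rightarrow> 'r ring \<Rightarrow> ('r, 'u) module \<Rightarrow> (('r \<times> 'u) \<Rightarrow>\<^sub>0 int) set" where
  "tensor_relations A B U =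
     {frag_of (h \<oplus>\<^bsub>A\<^esub> h', u) - frag_of (h, u) - frag_of (h', u) | h h' u.
        h \<in> carrier A \<and> h' \<in> carrier A \<and> u \<in> carrier U} \<union>
     {frag_of (h, u \<oplus>\<^bsub>U\<^esub> u') - frag_of (h, u) - frag_of (h, u') | h u u'.
        h \<in> carrier A \<and> u \<in> carrier U \<and> u' \<in> carrier U} \<union>
     {frag_of (h \<otimes>\<^bsub>A\<^esub> b, u) - frag_of (h, b \<odot>\<^bsub>U\<^esub> u) | h b u.
        h \<in> carrier A \<and> b \<in> carrier B \<and> u \<in> carrier U}"

definition induced_module ::
  "'r ring \<Rightarrow> 'r ring \<Rightarrow> ('r, 'u) module \<Rightarrow> ('r, (('r \<times> 'u) \<Rightarrow>\<^sub>0 int) set) module" where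
  "induced_module A B U = quotient_module (free_pairs A U)
     (generate (add_monoid (free_pairs A U)) (tensor_relations A B U))"


section \<open>Irreducible characters of the Weyl group\<close>

definition weyl_rep ::
  "('a::euclidean_space \<Rightarrow> real) set \<Rightarrow> nat \<Rightarrow> (('a \<Rightarrow> 'a) \<Rightarrow> complex mat) \<Rightarrow> bool" where
  "weyl_rep R n \<rho> \<longleftrightarrow>
     (\<forall>w\<in>weyl_group R. \<rho> w \<in> carrier_mat n n) \<and>
     \<rho> id = 1\<^sub>m n \<and>
     (\<forall>w\<in>weyl_group R. \<forall>w'\<in>weyl_group R. \<rho> (w \<circ> w') = \<rho> w * \<rho> w')"

definition irreducible_weyl_rep ::
  "('a::euclidean_space \<Rightarrow> real) set \<Rightarrow> nat \<Rightarrow> (('a \<Rightarrow> 'a) \<Rightarrow> complex mat) \<Rightarrow> bool" where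
  "irreducible_weyl_rep R n \<rho> \<longleftrightarrow>
     weyl_rep R n \<rho> \<and> n > 0 \<and>
     (\<forall>U. U \<subseteq> carrier_vec n \<and> 0\<^sub>v n \<in> U \<and>
        (\<forall>u\<in>U. \<forall>v\<in>U. u + v \<in> U) \<and> (\<forall>c. \<forall>u\<in>U. c \<cdot>\<^sub>v u \<in> U) \<and>
        (\<forall>w\<in>weyl_group R. \<forall>u\<in>U. \<rho> w *\<^sub>v u \<in> U)
        \<longrightarrow> U = {0\<^sub>v n} \<or> U = carrier_vec n)"

definition weyl_character ::
  "('a::euclidean_space \<Rightarrow> real) set \<Rightarrow> nat \<Rightarrow> (('a \<Rightarrow> 'a) \<Rightarrow> complex mat) \<Rightarrow>
   ('a \<Rightarrow> 'a) \<Rightarrow> complex" where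
  "weyl_character R n \<rho> = (\<lambda>w\<in>weyl_group R. \<Sum>i<n. \<rho> w $$ (i, i))"

definition irreducible_characters ::
  "('a::euclidean_space \<Rightarrow> real) set \<Rightarrow> (('a \<Rightarrow> 'a) \<Rightarrow> complex) set" where
  "irreducible_characters R = {weyl_character R n \<rho> | n \<rho>. irreducible_weyl_rep R n \<rho>}"

text \<open>A chosen irreducible representation of a given character, as a pair of degree and map.\<close>

definition rep_of_character ::
  "('a::euclidean_space \<Rightarrow> real) set \<Rightarrow> (('a \<Rightarrow> 'a) \<Rightarrow> complex) \<Rightarrow>
   nat \<times> (('a \<Rightarrow> 'a) \<Rightarrow> complex mat)" where
  "rep_of_character R ch =
     (SOME (n, \<rho>). irreducible_weyl_rep R n \<rho> \<and> weyl_character R n \<rho> = ch)"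


section \<open>Verma modules and their simple quotients\<close>

text \<open>
  The algebra homomorphism extending \<open>\<rho>\<close> from the Weyl group to the subalgebra it generates together
  with the Dunkl operators, and vanishing on \<^const>\<open>dunkl_plus\<close>.
\<close>

definition extended_rep ::
  "('a::euclidean_space \<Rightarrow> real) set \<Rightarrow> ('a \<Rightarrow> real) set \<Rightarrow> (('a \<Rightarrow> real) \<Rightarrow> complex) \<Rightarrow>
   nat \<Rightarrow> (('a \<Rightarrow> 'a) \<Rightarrow> complex mat) \<Rightarrow> 'a operator \<Rightarrow> complex mat" where
  "extended_rep R Rp k n \<rho> = (THE \<phi>.
     \<phi> \<in> extensional (carrier (dunkl_weyl_algebra R Rp k)) \<and>
     \<phi> \<in> Ring.ring_hom (dunkl_weyl_algebra R Rp k) (ring_mat TYPE(complex) n ()) \<and>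
     (\<forall>c. \<phi> (scalar_op c) = c \<cdot>\<^sub>m 1\<^sub>m n) \<and>
     (\<forall>w\<in>weyl_group R. \<phi> (weyl_op w) = \<rho> w) \<and>
     (\<forall>s\<in>dunkl_plus R Rp k. \<phi> s = 0\<^sub>m n n))"

definition inflated_module ::
  "('a::euclidean_space \<Rightarrow> real) set \<Rightarrow> ('a \<Rightarrow> real) set \<Rightarrow> (('a \<Rightarrow> real) \<Rightarrow> complex) \<Rightarrow>
   nat \<Rightarrow> (('a \<Rightarrow> 'a) \<Rightarrow> complex mat) \<Rightarrow> ('a operator, complex vec) module" where
  "inflated_module R Rp k n \<rho> = \<lparr>
     carrier = carrier_vec n,
     monoid.mult = undefined,
     monoid.one = undefined,
     ring.zero = 0\<^sub>v n,
     ring.add = (+),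
     smult = (\<lambda>b v. extended_rep R Rp k n \<rho> b *\<^sub>v v)\<rparr>"

definition verma_module ::
  "('a::euclidean_space \<Rightarrow> real) set \<Rightarrow> ('a \<Rightarrow> real) set \<Rightarrow> (('a \<Rightarrow> real) \<Rightarrow> complex) \<Rightarrow>
   (('a \<Rightarrow> 'a) \<Rightarrow> complex) \<Rightarrow>
   ('a operator, (('a operator \<times> complex vec) \<Rightarrow>\<^sub>0 int) set) module" where
  "verma_module R Rp k ch =
     induced_module (cherednik_algebra R Rp k) (dunkl_weyl_algebra R Rp k)
       (case rep_of_character R ch of (n, \<rho>) \<Rightarrow> inflated_module R Rp k n \<rho>)"

definition simple_quotient ::
  "('a::euclidean_space \<Rightarrow> real) set \<Rightarrow> ('a \<Rightarrow> real) set \<Rightarrow> (('a \<Rightarrow> real) \<Rightarrow> complex) \<Rightarrow>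
   (('a \<Rightarrow> 'a) \<Rightarrow> complex) \<Rightarrow>
   ('a operator, (('a operator \<times> complex vec) \<Rightarrow>\<^sub>0 int) set set) module" where
  "simple_quotient R Rp k ch =
     quotient_module (verma_module R Rp k ch)
       (THE N. maximal_submodule (cherednik_algebra R Rp k) (verma_module R Rp k ch) N)"

end

(* The Euler field E = sum_i x_i T_i - sum_a k_a (1 - r_a) lies in the Cherednik algebra, commutes
   with W, and satisfies [E, x] = x and [E, T_y] = - T_y. On a finite-dimensional simple module V
   choose an eigenvalue mu of E such that mu - 1 is not one: the mu-eigenspace is W-stable and is
   killed by all T_y, so it contains an irreducible W-submodule on which the subalgebra generated by
   W and the T_y acts through W. This gives a surjection from a Verma module M onto V.
   By [T_y, x] in CW, the module M is spanned by products of x's applied to its generating space, so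
   E acts with eigenvalues mu, mu + 1, ...; a submodule contains the lowest component of each of its
   elements, and therefore every proper submodule lies in the kernel of the surjection. *)

theory Submission
  imports Defs "Jordan_Normal_Form.Spectral_Radius"
begin

section \<open>Polynomial functions and their directional derivatives\<close>

text \<open>The definitions by \<open>THE\<close> and \<open>SOME\<close> shape the proof.
  \<open>extended_rep\<close> denotes something only once its homomorphism exists, and this is read
  off from V: the subalgebra generated by the T_y and W preserves the chosen lowest weight space,
  and its matrices there form the homomorphism. \<open>rep_of_character\<close> picks some
  representation with the given character, so averaging and Schur's lemma must show that equal
  irreducible characters give isomorphic representations. The eigenvalue mu passes from V to M
  because on vectors killed by all T_y the Euler field acts as minus the reflection sum, whose
  action on 1 \<otimes> u is fixed by its action on u. The last inference of the overview rests on
  the following. If a submodule N is not inside the kernel K, its image is V, so some a in N has the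
  same image as a nonzero lowest weight vector v. Then a - v lies in K, and so does its lowest
  component; the map being injective in degree 0, that component is 0. Hence v is the lowest
  component of a, lies in N and generates M.\<close>

lemma polyfun_cmult: "f \<in> polyfun \<Longrightarrow> (\<lambda>p. c * f p) \<in> polyfun"
  by (rule polyfun_mult[OF polyfun_const])

lemma polyfun_diff: "f \<in> polyfun \<Longrightarrow> g \<in> polyfun \<Longrightarrow> (\<lambda>p. f p - g p) \<in> polyfun"
  using polyfun_add[of f "\<lambda>p. (-1) * g p"] polyfun_cmult[of g "-1"] by simp

lemma polyfun_sum: "(\<And>i. i \<in> I \<Longrightarrow> f i \<in> polyfun) \<Longrightarrow> (\<lambda>p. \<Sum>i\<in>I. f i p) \<in> polyfun"
  by (induction I rule: infinite_finite_induct) (auto intro: polyfun_const polyfun_add)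

lemma polyfun_compose_linear:
  assumes "linear w" "f \<in> polyfun" shows "f \<circ> w \<in> polyfun"
  using assms(2)
proof induction
  case (polyfun_linear x)
  then show ?case using assms(1) by (intro polyfun.polyfun_linear linear_compose)
qed (auto simp: o_def intro: polyfun_const polyfun_add polyfun_mult)

lemma linear_complex_of_real: "linear \<alpha> \<Longrightarrow> linear (\<lambda>p. complex_of_real (\<alpha> p))"
  by (intro linearI) (simp_all add: linear_add linear_scale scaleR_conv_of_real)

section \<open>Directional derivatives\<close>

definition dir_deriv :: "'a::euclidean_space \<Rightarrow> ('a \<Rightarrow> complex) \<Rightarrow> 'a \<Rightarrow> complex" where
  "dir_deriv v f p = vector_derivative (\<lambda>t. f (p + t *\<^sub>R v)) (at 0)"

lemma linear_line_derivative:
  fixes x :: "'a::euclidean_space \<Rightarrow> complex"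
  assumes "linear x" shows "((\<lambda>t. x (p + t *\<^sub>R v)) has_vector_derivative x v) (at t)"
proof -
  have "(\<lambda>t. x (p + t *\<^sub>R v)) = (\<lambda>t. x p + t *\<^sub>R x v)"
    using assms by (simp add: linear_add linear_scale)
  then show ?thesis by (auto intro!: derivative_eq_intros simp: has_vector_derivative_def)
qed

lemma polyfun_line_differentiable:
  "f \<in> polyfun \<Longrightarrow> (\<lambda>t. f (p + t *\<^sub>R v)) differentiable at t"
proof (induction rule: polyfun.induct)
  case (polyfun_linear x)
  then show ?case using linear_line_derivative by (metis differentiableI_vector)
qed auto

lemma dir_deriv_works:
  "f \<in> polyfun \<Longrightarrow> ((\<lambda>t. f (p + t *\<^sub>R v)) has_vector_derivative dir_deriv v f p) (at 0)"
  unfolding dir_deriv_def using polyfun_line_differentiable vector_derivative_works by blast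

lemma dir_deriv_const: "dir_deriv v (\<lambda>_. c) p = 0"
  by (simp add: dir_deriv_def)

lemma dir_deriv_linear: "linear x \<Longrightarrow> dir_deriv v x p = x v"
  unfolding dir_deriv_def by (rule vector_derivative_at[OF linear_line_derivative])

lemma dir_deriv_add: "f \<in> polyfun \<Longrightarrow> g \<in> polyfun \<Longrightarrow>
    dir_deriv v (\<lambda>p. f p + g p) p = dir_deriv v f p + dir_deriv v g p"
  unfolding dir_deriv_def[of v "\<lambda>p. f p + g p"]
  by (rule vector_derivative_at[OF has_vector_derivative_add[OF dir_deriv_works dir_deriv_works]])

lemma dir_deriv_mult:
  assumes "f \<in> polyfun" "g \<in> polyfun"
  shows "dir_deriv v (\<lambda>p. f p * g p) p = f p * dir_deriv v g p + dir_deriv v f p * g p"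
  unfolding dir_deriv_def[of v "\<lambda>p. f p * g p"]
  using vector_derivative_at[OF has_vector_derivative_mult[OF dir_deriv_works[OF assms(1)]
        dir_deriv_works[OF assms(2)], of p v p v]] by simp

lemma dir_deriv_cmult: "f \<in> polyfun \<Longrightarrow> dir_deriv v (\<lambda>p. c * f p) p = c * dir_deriv v f p"
  by (simp add: dir_deriv_mult polyfun_const dir_deriv_const)

lemma polyfun_dir_deriv: "f \<in> polyfun \<Longrightarrow> dir_deriv v f \<in> polyfun"
proof (induction rule: polyfun.induct)
  case (polyfun_const c)
  then show ?case using polyfun.polyfun_const[of 0] by (simp add: dir_deriv_const[abs_def] )
next
  case (polyfun_linear x)
  then have "dir_deriv v x = (\<lambda>_. x v)" by (auto simp: dir_deriv_linear)
  then show ?case by (simp add: polyfun.polyfun_const)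
next
  case (polyfun_add f g)
  then have "dir_deriv v (\<lambda>p. f p + g p) = (\<lambda>p. dir_deriv v f p + dir_deriv v g p)"
    by (auto simp: dir_deriv_add)
  with polyfun_add show ?case by (auto intro: polyfun.polyfun_add)
next
  case (polyfun_mult f g)
  then have "dir_deriv v (\<lambda>p. f p * g p) = (\<lambda>p. f p * dir_deriv v g p + dir_deriv v f p * g p)"
    by (auto simp: dir_deriv_mult)
  with polyfun_mult show ?case by (auto intro: polyfun.polyfun_add polyfun.polyfun_mult)
qed

text \<open>\<open>dir_deriv\<close> is a one-variable derivative along a line and does not compare
  different directions by itself; linearity in the direction is therefore built up along the
  generation of \<open>polyfun\<close>, with the Leibniz rule for products.\<close>

lemma linear_dir_deriv: "f \<in> polyfun \<Longrightarrow> linear (\<lambda>v. dir_deriv v f p)"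
proof (induction rule: polyfun.induct)
  case (polyfun_linear x)
  then show ?case by (simp add: dir_deriv_linear)
next
  case (polyfun_add f g)
  then show ?case by (simp add: dir_deriv_add linear_compose_add)
next
  case (polyfun_mult f g)
  note lin = linear_add[OF polyfun_mult.IH(1)] linear_add[OF polyfun_mult.IH(2)]
    linear_scale[OF polyfun_mult.IH(1)] linear_scale[OF polyfun_mult.IH(2)]
  show ?case
    by (rule linearI) (simp_all add: dir_deriv_mult polyfun_mult.hyps lin algebra_simps)
qed (simp add: dir_deriv_const module_hom_zero)

lemma dir_deriv_compose_linear:
  "linear w \<Longrightarrow> dir_deriv v (f \<circ> w) p = dir_deriv (w v) f (w p)"
  by (simp add: dir_deriv_def linear_add linear_scale)

lemma deriv_along_dir_deriv: "deriv_along y f p = dir_deriv (fst y) f p + \<i> * dir_deriv (snd y) f p"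
  by (simp add: deriv_along_def dir_deriv_def)

lemma polyfun_deriv_along: "f \<in> polyfun \<Longrightarrow> (\<lambda>p. deriv_along y f p) \<in> polyfun"
  unfolding deriv_along_dir_deriv by (intro polyfun_add polyfun_cmult polyfun_dir_deriv)

text \<open>The Euler field \<Sum> x_i d/dx_i without coordinates: at \<open>p\<close> it
  differentiates in the direction \<open>p\<close>. In this form compatibility with linear
  substitutions is immediate; \<open>euler_eq_sum_Basis\<close> recovers the sum over
  coordinates.\<close>

definition euler :: "('a::euclidean_space \<Rightarrow> complex) \<Rightarrow> 'a \<Rightarrow> complex" where
  "euler f p = dir_deriv p f p"

lemma euler_add: "f \<in> polyfun \<Longrightarrow> g \<in> polyfun \<Longrightarrow> euler (\<lambda>p. f p + g p) = (\<lambda>p. euler f p + euler g p)"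
  by (simp add: euler_def dir_deriv_add fun_eq_iff)

lemma euler_cmult: "f \<in> polyfun \<Longrightarrow> euler (\<lambda>p. c * f p) = (\<lambda>p. c * euler f p)"
  by (simp add: euler_def dir_deriv_cmult fun_eq_iff)

lemma euler_linear_mult: "linear x \<Longrightarrow> f \<in> polyfun \<Longrightarrow>
    euler (\<lambda>p. x p * f p) = (\<lambda>p. x p * f p + x p * euler f p)"
  by (simp add: euler_def dir_deriv_mult polyfun_linear dir_deriv_linear fun_eq_iff)

lemma euler_compose_linear: "linear w \<Longrightarrow> euler (f \<circ> w) = euler f \<circ> w"
  by (simp add: euler_def dir_deriv_compose_linear fun_eq_iff)

lemma polyfun_euler: "f \<in> polyfun \<Longrightarrow> euler f \<in> polyfun"
proof (induction rule: polyfun.induct)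
  case (polyfun_const c)
  then show ?case using polyfun.polyfun_const[of 0] by (simp add: euler_def[abs_def] dir_deriv_const)
next
  case (polyfun_linear x)
  then show ?case using polyfun.polyfun_linear by (simp add: euler_def[abs_def] dir_deriv_linear)
next
  case (polyfun_add f g)
  then show ?case by (simp add: euler_add polyfun.polyfun_add)
next
  case (polyfun_mult f g)
  then have "euler (\<lambda>p. f p * g p) = (\<lambda>p. f p * euler g p + euler f p * g p)"
    by (auto simp: dir_deriv_mult euler_def)
  with polyfun_mult show ?case by (auto intro: polyfun.polyfun_add polyfun.polyfun_mult)
qed

lemma euler_eq_sum_Basis:
  assumes "f \<in> polyfun"
  shows "euler f p = (\<Sum>b\<in>Basis. of_real (p \<bullet> b) * dir_deriv b f p)"
proof -
  have "dir_deriv p f p = dir_deriv (\<Sum>b\<in>Basis. (p \<bullet> b) *\<^sub>R b) f p"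
    by (simp add: euclidean_representation)
  also have "\<dots> = (\<Sum>b\<in>Basis. (p \<bullet> b) *\<^sub>R dir_deriv b f p)"
    by (simp only: linear_sum[OF linear_dir_deriv[OF assms]] linear_scale[OF linear_dir_deriv[OF assms]])
  finally show ?thesis by (simp add: euler_def scaleR_conv_of_real)
qed


section \<open>Coroots and the Weyl group\<close>

text \<open>The roots span the dual space, so each coordinate functional is a combination of roots;
  points on which all roots agree then agree in every coordinate.\<close>

lemma root_span_separates:
  fixes R :: "('a::euclidean_space \<Rightarrow> real) set"
  assumes "root_system R" "\<And>\<beta>. \<beta> \<in> R \<Longrightarrow> \<beta> u = \<beta> v" shows "u = v"
proof (rule euclidean_eqI)
  fix b :: 'a
  have "linear (\<lambda>p. p \<bullet> b)" by (intro linearI) (auto simp: inner_add_left)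
  then obtain c where "(\<lambda>p. p \<bullet> b) = (\<lambda>p. \<Sum>\<alpha>\<in>R. c \<alpha> * \<alpha> p)"
    using assms(1) unfolding root_system_def by blast
  then have "p \<bullet> b = (\<Sum>\<alpha>\<in>R. c \<alpha> * \<alpha> p)" for p by (rule fun_cong)
  moreover have "(\<Sum>\<alpha>\<in>R. c \<alpha> * \<alpha> u) = (\<Sum>\<alpha>\<in>R. c \<alpha> * \<alpha> v)"
    using assms(2) by (intro sum.cong) auto
  ultimately show "u \<bullet> b = v \<bullet> b" by simp
qed

text \<open>The product of two candidate reflections is a transvection of the finite set \<open>R\<close>, hence trivial.\<close>

lemma is_coroot_unique:
  fixes R :: "('a::euclidean_space \<Rightarrow> real) set"
  assumes "root_system R" "\<alpha> \<in> R" "is_coroot R \<alpha> u" "is_coroot R \<alpha> v" shows "u = v"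
proof (rule root_span_separates[OF assms(1)])
  fix \<beta> assume \<beta>: "\<beta> \<in> R"
  define d where "d = (\<lambda>\<gamma>::'a\<Rightarrow>real. \<gamma> v - \<gamma> u)"
  have da: "d \<alpha> = 0" using assms(3,4) by (simp add: d_def is_coroot_def)
  have refl: "(\<lambda>p. \<gamma> p - \<gamma> w * \<alpha> p) \<in> R" if "\<gamma> \<in> R" "is_coroot R \<alpha> w" for \<gamma> w
    using that unfolding is_coroot_def by blast
  \<comment> \<open>Reflecting with \<open>v\<close> and then with \<open>u\<close> moves \<gamma>
    by a multiple of \<alpha>; since \<alpha> takes the value 2 on \<open>u\<close>, the coefficient
    is the difference of the two values, \<open>d \<gamma>\<close>.\<close>
  have step: "(\<lambda>p. \<gamma> p + d \<gamma> * \<alpha> p) \<in> R" if "\<gamma> \<in> R" for \<gamma>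
  proof -
    have "(\<lambda>p. (\<gamma> p - \<gamma> v * \<alpha> p) - (\<gamma> u - \<gamma> v * \<alpha> u) * \<alpha> p) \<in> R"
      using refl[OF refl[OF that assms(4)] assms(3)] by simp
    moreover have "\<alpha> u = 2" using assms(3) by (simp add: is_coroot_def)
    ultimately show ?thesis by (simp add: d_def algebra_simps)
  qed
  have iter: "(\<lambda>p. \<beta> p + real n * d \<beta> * \<alpha> p) \<in> R" for n
  proof (induction n)
    case 0 then show ?case using \<beta> by simp
  next
    case (Suc n)
    have "d (\<lambda>p. \<beta> p + real n * d \<beta> * \<alpha> p) = d \<beta> + real n * d \<beta> * d \<alpha>"
      by (simp add: d_def algebra_simps)
    with step[OF Suc] da show ?case by (simp add: algebra_simps)
  qed
  show "\<beta> u = \<beta> v"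
  proof (rule ccontr)
    assume "\<beta> u \<noteq> \<beta> v"
    then have d0: "d \<beta> \<noteq> 0" by (simp add: d_def)
    have "\<alpha> \<noteq> (\<lambda>_. 0)" using assms(1,2) by (auto simp: root_system_def)
    then obtain q where q: "\<alpha> q \<noteq> 0" by auto
    \<comment> \<open>With \<open>d \<beta>\<close> nonzero the translates of \<beta> are pairwise
      distinct, so the finite set \<open>R\<close> would have infinitely many elements.\<close>
    have "inj (\<lambda>n. (\<lambda>p. \<beta> p + real n * d \<beta> * \<alpha> p))"
    proof (rule injI)
      fix m n assume "(\<lambda>p. \<beta> p + real m * d \<beta> * \<alpha> p) = (\<lambda>p. \<beta> p + real n * d \<beta> * \<alpha> p)"
      from fun_cong[OF this, of q] show "m = n" using d0 q by simp
    qed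
    moreover have "range (\<lambda>n. (\<lambda>p. \<beta> p + real n * d \<beta> * \<alpha> p)) \<subseteq> R" using iter by auto
    moreover have "finite R" using assms(1) by (simp add: root_system_def)
    ultimately show False using finite_imageD finite_subset infinite_UNIV_nat by metis
  qed
qed

lemma coroot_is_coroot:
  assumes "root_system R" "\<alpha> \<in> R" shows "is_coroot R \<alpha> (coroot R \<alpha>)"
proof -
  have "\<exists>v. is_coroot R \<alpha> v" using assms by (auto simp: root_system_def)
  then show ?thesis unfolding coroot_def
    using is_coroot_unique[OF assms] by (metis theI)
qed

lemma root_linear: "root_system R \<Longrightarrow> \<alpha> \<in> R \<Longrightarrow> linear \<alpha>"
  by (simp add: root_system_def)

lemma root_coroot: "root_system R \<Longrightarrow> \<alpha> \<in> R \<Longrightarrow> \<alpha> (coroot R \<alpha>) = 2"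
  using coroot_is_coroot by (auto simp: is_coroot_def)

lemma linear_root_reflection:
  assumes "root_system R" "\<alpha> \<in> R" shows "linear (root_reflection R \<alpha>)"
  using root_linear[OF assms]
  by (intro linearI) (simp_all add: root_reflection_def linear_add linear_scale algebra_simps)

lemma root_reflection_involution:
  assumes "root_system R" "\<alpha> \<in> R" shows "root_reflection R \<alpha> (root_reflection R \<alpha> p) = p"
  using root_linear[OF assms] root_coroot[OF assms]
  by (simp add: root_reflection_def linear_diff linear_scale algebra_simps)

lemma inv_root_reflection:
  assumes "root_system R" "\<alpha> \<in> R" shows "inv_into UNIV (root_reflection R \<alpha>) = root_reflection R \<alpha>"
  using root_reflection_involution[OF assms] by (intro inv_equality)

section \<open>The Weyl group: inverses, action on the roots, finiteness\<close>

lemma weyl_linear: "root_system R \<Longrightarrow> w \<in> weyl_group R \<Longrightarrow> linear w"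
  by (rotate_tac, induction rule: weyl_group.induct)
     (auto intro: linear_compose linear_root_reflection simp: module_hom_ident id_def)

lemma weyl_comp:
  assumes "w \<in> weyl_group R" "w' \<in> weyl_group R" shows "w \<circ> w' \<in> weyl_group R"
  using assms by (induction rule: weyl_group.induct) (auto simp: o_assoc[symmetric] intro: weyl_step)

lemma weyl_reflection: "\<alpha> \<in> R \<Longrightarrow> root_reflection R \<alpha> \<in> weyl_group R"
  using weyl_step[OF _ weyl_id] by fastforce

text \<open>Elements grow by reflections on the left, so their inverses grow on the right. Having
  the inverse inside the group makes \<open>inv_into UNIV w\<close>, which occurs in
  \<open>weyl_op\<close>, a group element again.\<close>

lemma weyl_inverse:
  assumes "root_system R" "w \<in> weyl_group R"
  shows "\<exists>w'\<in>weyl_group R. w' \<circ> w = id \<and> w \<circ> w' = id"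
  using assms(2)
proof induction
  case weyl_id
  then show ?case using weyl_group.weyl_id by (metis comp_id)
next
  case (weyl_step \<alpha> w)
  then obtain w' where w': "w' \<in> weyl_group R" "w' \<circ> w = id" "w \<circ> w' = id" by blast
  have rr: "root_reflection R \<alpha> \<circ> root_reflection R \<alpha> = id"
    using root_reflection_involution[OF assms(1) weyl_step(1)] by auto
  show ?case
  proof (intro bexI conjI)
    show "w' \<circ> root_reflection R \<alpha> \<in> weyl_group R"
      using w'(1) weyl_reflection weyl_step(1) by (intro weyl_comp) auto
    have "w' \<circ> root_reflection R \<alpha> \<circ> (root_reflection R \<alpha> \<circ> w) = w' \<circ> (root_reflection R \<alpha> \<circ> root_reflection R \<alpha>) \<circ> w"
      by (simp add: o_assoc)
    then show "w' \<circ> root_reflection R \<alpha> \<circ> (root_reflection R \<alpha> \<circ> w) = id" using rr w' by simp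
    have "root_reflection R \<alpha> \<circ> w \<circ> (w' \<circ> root_reflection R \<alpha>) = root_reflection R \<alpha> \<circ> (w \<circ> w') \<circ> root_reflection R \<alpha>"
      by (simp add: o_assoc)
    then show "root_reflection R \<alpha> \<circ> w \<circ> (w' \<circ> root_reflection R \<alpha>) = id" using rr w' by simp
  qed
qed

lemma weyl_bij: "root_system R \<Longrightarrow> w \<in> weyl_group R \<Longrightarrow> bij w"
  using weyl_inverse o_bij by metis

lemma weyl_inv: "root_system R \<Longrightarrow> w \<in> weyl_group R \<Longrightarrow> inv_into UNIV w \<in> weyl_group R"
  using weyl_inverse inv_unique_comp by metis

text \<open>The dual action is by precomposition, so the induction keeps \<beta> arbitrary: the
  leftmost reflection acts on \<beta> first, stays in \<open>R\<close> by the coroot property, and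
  the hypothesis applies to the reflected root.\<close>

lemma weyl_permutes_roots:
  assumes "root_system R" "w \<in> weyl_group R" "\<beta> \<in> R" shows "\<beta> \<circ> w \<in> R"
  using assms(2,3)
proof (induction arbitrary: \<beta>)
  case (weyl_step \<alpha> w)
  have "\<beta> \<circ> root_reflection R \<alpha> = (\<lambda>p. \<beta> p - \<beta> (coroot R \<alpha>) * \<alpha> p)"
    using root_linear[OF assms(1) weyl_step(4)]
    by (auto simp: root_reflection_def linear_diff linear_scale)
  also have "\<dots> \<in> R"
    using coroot_is_coroot[OF assms(1) weyl_step(1)] weyl_step(4) unfolding is_coroot_def by blast
  finally have "(\<beta> \<circ> root_reflection R \<alpha>) \<circ> w \<in> R" by (rule weyl_step.IH)
  then show ?case by (simp only: o_assoc)
qed simp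

text \<open>The action on the finite set \<open>R\<close> is faithful because the roots separate
  points; restricting it to \<open>R\<close> embeds the group into a finite set of maps.\<close>

lemma finite_weyl_group:
  fixes R :: "('a::euclidean_space \<Rightarrow> real) set"
  assumes "root_system R" shows "finite (weyl_group R)"
proof (rule finite_imageD)
  show "inj_on (\<lambda>w. \<lambda>\<beta>\<in>R. \<beta> \<circ> w) (weyl_group R)"
  proof (rule inj_onI)
    fix w w' :: "'a \<Rightarrow> 'a" assume eq: "(\<lambda>\<beta>\<in>R. \<beta> \<circ> w) = (\<lambda>\<beta>\<in>R. \<beta> \<circ> w')"
    show "w = w'"
    proof
      fix p
      show "w p = w' p"
      proof (rule root_span_separates[OF assms])
        fix \<beta> assume "\<beta> \<in> R"
        then have "\<beta> \<circ> w = \<beta> \<circ> w'" using fun_cong[OF eq, of \<beta>] by simp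
        then show "\<beta> (w p) = \<beta> (w' p)" by (metis comp_apply)
      qed
    qed
  qed
  have "(\<lambda>w. \<lambda>\<beta>\<in>R. \<beta> \<circ> w) ` weyl_group R \<subseteq> R \<rightarrow>\<^sub>E R"
    using weyl_permutes_roots[OF assms] by auto
  moreover have "finite (R \<rightarrow>\<^sub>E R)" using assms by (intro finite_PiE) (auto simp: root_system_def)
  ultimately show "finite ((\<lambda>w. \<lambda>\<beta>\<in>R. \<beta> \<circ> w) ` weyl_group R)" by (rule finite_subset)
qed


section \<open>Operators on polynomial functions\<close>

lemma end_carrier:
  "F \<in> carrier end_ring \<longleftrightarrow> F \<in> polyfun \<rightarrow>\<^sub>E polyfun \<and>
     (\<forall>f\<in>polyfun. \<forall>g\<in>polyfun. F (\<lambda>p. f p + g p) = (\<lambda>p. F f p + F g p)) \<and>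
     (\<forall>c. \<forall>f\<in>polyfun. F (\<lambda>p. c * f p) = (\<lambda>p. c * F f p))"
  by (simp add: end_ring_def)

lemma end_carrierD:
  assumes "F \<in> carrier end_ring"
  shows "f \<in> polyfun \<Longrightarrow> F f \<in> polyfun"
    "f \<in> polyfun \<Longrightarrow> g \<in> polyfun \<Longrightarrow> F (\<lambda>p. f p + g p) = (\<lambda>p. F f p + F g p)"
    "f \<in> polyfun \<Longrightarrow> F (\<lambda>p. c * f p) = (\<lambda>p. c * F f p)"
    "F \<in> extensional polyfun"
  using assms by (auto simp: end_carrier PiE_def)

lemma end_restrict:
  assumes "\<And>f. f \<in> polyfun \<Longrightarrow> F f \<in> polyfun"
    and "\<And>f g. f \<in> polyfun \<Longrightarrow> g \<in> polyfun \<Longrightarrow> F (\<lambda>p. f p + g p) = (\<lambda>p. F f p + F g p)"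
    and "\<And>c f. f \<in> polyfun \<Longrightarrow> F (\<lambda>p. c * f p) = (\<lambda>p. c * F f p)"
  shows "(\<lambda>f\<in>polyfun. F f) \<in> carrier end_ring"
proof -
  have "(\<lambda>f\<in>polyfun. F f) \<in> polyfun \<rightarrow>\<^sub>E polyfun" using assms(1) by auto
  then show ?thesis unfolding end_carrier by (simp add: assms polyfun_add polyfun_cmult)
qed

lemma end_eqI:
  assumes "F \<in> carrier end_ring" "G \<in> carrier end_ring" "\<And>f. f \<in> polyfun \<Longrightarrow> F f = G f"
  shows "F = G"
  using assms by (intro extensionalityI[of F polyfun G]) (auto dest: end_carrierD)

lemma end_apply [simp]:
  assumes "f \<in> polyfun"
  shows "(F \<otimes>\<^bsub>end_ring\<^esub> G) f = F (G f)" "(F \<oplus>\<^bsub>end_ring\<^esub> G) f = (\<lambda>p. F f p + G f p)"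
    "\<one>\<^bsub>end_ring\<^esub> f = f" "\<zero>\<^bsub>end_ring\<^esub> f = (\<lambda>p. 0)"
  using assms by (auto simp: end_ring_def compose_def)

lemma end_closed:
  shows "F \<in> carrier end_ring \<Longrightarrow> G \<in> carrier end_ring \<Longrightarrow> F \<otimes>\<^bsub>end_ring\<^esub> G \<in> carrier end_ring"
    and "F \<in> carrier end_ring \<Longrightarrow> G \<in> carrier end_ring \<Longrightarrow> F \<oplus>\<^bsub>end_ring\<^esub> G \<in> carrier end_ring"
    and "\<one>\<^bsub>end_ring\<^esub> \<in> carrier end_ring" and "\<zero>\<^bsub>end_ring\<^esub> \<in> carrier end_ring"
proof -
  note D = end_carrierD
  show "F \<otimes>\<^bsub>end_ring\<^esub> G \<in> carrier end_ring" if "F \<in> carrier end_ring" "G \<in> carrier end_ring"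
  proof -
    have "(\<lambda>f\<in>polyfun. F (G f)) \<in> carrier end_ring"
      using that by (intro end_restrict) (simp_all add: D)
    then show ?thesis unfolding end_ring_def compose_def by simp
  qed
  show "F \<oplus>\<^bsub>end_ring\<^esub> G \<in> carrier end_ring" if "F \<in> carrier end_ring" "G \<in> carrier end_ring"
  proof -
    have "(\<lambda>f\<in>polyfun. \<lambda>p. F f p + G f p) \<in> carrier end_ring"
      using that by (intro end_restrict) (simp_all add: D polyfun_add algebra_simps)
    then show ?thesis by (simp add: end_ring_def)
  qed
  have "(\<lambda>f\<in>polyfun. f) \<in> carrier end_ring" by (intro end_restrict) simp_all
  then show "\<one>\<^bsub>end_ring\<^esub> \<in> carrier end_ring" by (simp only: end_ring_def monoid.simps)
  have "(\<lambda>f\<in>polyfun. \<lambda>p. 0) \<in> carrier end_ring" by (intro end_restrict) (simp_all add: polyfun_const)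
  then show "\<zero>\<^bsub>end_ring\<^esub> \<in> carrier end_ring" by (simp only: end_ring_def ring.simps)
qed

lemma ring_end_ring: "ring (end_ring :: 'a::euclidean_space operator ring)"
proof (rule ringI)
  show "abelian_group (end_ring :: 'a operator ring)"
  proof (rule abelian_groupI)
    fix F :: "'a operator" assume F: "F \<in> carrier end_ring"
    have "(\<lambda>f\<in>polyfun. \<lambda>p. (-1) * F f p) \<in> carrier end_ring"
      using F by (intro end_restrict polyfun_cmult) (simp_all add: end_carrierD algebra_simps)
    moreover from this have "(\<lambda>f\<in>polyfun. \<lambda>p. (-1) * F f p) \<oplus>\<^bsub>end_ring\<^esub> F = \<zero>\<^bsub>end_ring\<^esub>"
      using F by (intro end_eqI end_closed) simp_all
    ultimately show "\<exists>G\<in>carrier end_ring. G \<oplus>\<^bsub>end_ring\<^esub> F = \<zero>\<^bsub>end_ring\<^esub>" by blast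
  qed (auto intro!: end_eqI end_closed simp: end_carrierD add_ac)
  show "monoid (end_ring :: 'a operator ring)"
    by (rule monoidI) (auto intro!: end_eqI end_closed simp: end_carrierD)
qed (auto intro!: end_eqI end_closed simp: end_carrierD)

text \<open>The record gives no formula for negatives, so the value is recovered from the ring law
  that \<open>F\<close> and its negative sum to zero.\<close>

lemma end_minus_apply:
  assumes "F \<in> carrier end_ring" "f \<in> polyfun" shows "(\<ominus>\<^bsub>end_ring\<^esub> F) f = (\<lambda>p. - F f p)"
proof -
  interpret E: ring "end_ring :: 'a operator ring" by (rule ring_end_ring)
  have "(F \<oplus>\<^bsub>end_ring\<^esub> (\<ominus>\<^bsub>end_ring\<^esub> F)) f = \<zero>\<^bsub>end_ring\<^esub> f" using assms(1) by (simp add: E.r_neg)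
  then have "F f p + (\<ominus>\<^bsub>end_ring\<^esub> F) f p = 0" for p using assms(2) by (simp add: fun_eq_iff)
  then show ?thesis by (auto simp: eq_neg_iff_add_eq_0 add.commute)
qed

lemma scalar_op_closed: "scalar_op c \<in> carrier end_ring"
  unfolding scalar_op_def by (rule end_restrict) (simp_all add: polyfun_cmult algebra_simps)

lemma mult_op_closed: "linear x \<Longrightarrow> mult_op x \<in> carrier end_ring"
  unfolding mult_op_def by (rule end_restrict) (simp_all add: polyfun_mult polyfun_linear algebra_simps)

lemma weyl_op_closed: "linear (inv_into UNIV w) \<Longrightarrow> weyl_op w \<in> carrier end_ring"
  unfolding weyl_op_def
  by (rule end_restrict) (simp_all add: polyfun_compose_linear comp_def[abs_def] del: comp_apply, simp add: polyfun_compose_linear[unfolded comp_def])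

lemma op_apply [simp]:
  assumes "f \<in> polyfun"
  shows "scalar_op c f = (\<lambda>p. c * f p)" "mult_op x f = (\<lambda>p. x p * f p)"
    "weyl_op w f = f \<circ> inv_into UNIV w"
  using assms by (simp_all add: scalar_op_def mult_op_def weyl_op_def)

definition euler_op :: "('a::euclidean_space) operator" where
  "euler_op = (\<lambda>f\<in>polyfun. euler f)"

lemma euler_op_apply [simp]: "f \<in> polyfun \<Longrightarrow> euler_op f = euler f"
  by (simp add: euler_op_def)

lemma euler_op_closed: "euler_op \<in> carrier end_ring"
  unfolding euler_op_def by (rule end_restrict) (simp_all add: polyfun_euler euler_add euler_cmult)

text \<open>Finite sums of operators are written pointwise. Only closure under zero and addition is
  asked of \<open>K\<close>, so that besides subrings the annihilator of a vector qualifies, as in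
  \<open>dunkl_sum_kills\<close>.\<close>

lemma op_sum_closed:
  assumes "\<zero>\<^bsub>end_ring\<^esub> \<in> K" "\<And>F G. F \<in> K \<Longrightarrow> G \<in> K \<Longrightarrow> F \<oplus>\<^bsub>end_ring\<^esub> G \<in> K"
    and "finite I" "\<And>i. i \<in> I \<Longrightarrow> F i \<in> K"
  shows "(\<lambda>f\<in>polyfun. \<lambda>p. \<Sum>i\<in>I. F i f p) \<in> K"
  using assms(3,4)
proof induction
  case empty
  have "(\<lambda>f\<in>polyfun. \<lambda>p. \<Sum>i\<in>{}. F i f p) = \<zero>\<^bsub>end_ring\<^esub>" by (simp add: end_ring_def)
  then show ?case using assms(1) by simp
next
  case (insert i I)
  have "(\<lambda>f\<in>polyfun. \<lambda>p. \<Sum>j\<in>insert i I. F j f p) = F i \<oplus>\<^bsub>end_ring\<^esub> (\<lambda>f\<in>polyfun. \<lambda>p. \<Sum>j\<in>I. F j f p)"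
    using insert.hyps by (auto simp: end_ring_def fun_eq_iff)
  moreover have "F i \<in> K" using insert.prems by simp
  moreover have "(\<lambda>f\<in>polyfun. \<lambda>p. \<Sum>j\<in>I. F j f p) \<in> K"
    by (rule insert.IH) (use insert.prems in simp)
  ultimately show ?case using assms(2) by metis
qed

lemma op_sum_in_subring:
  assumes "subring K end_ring" "finite I" "\<And>i. i \<in> I \<Longrightarrow> F i \<in> K"
  shows "(\<lambda>f\<in>polyfun. \<lambda>p. \<Sum>i\<in>I. F i f p) \<in> K"
  using assms(2,3) by (intro op_sum_closed subringE(2,7)[OF assms(1)])


section \<open>Dunkl operators\<close>

locale dunkl_setup =
  fixes R Rp :: "('a::euclidean_space \<Rightarrow> real) set" and k :: "('a \<Rightarrow> real) \<Rightarrow> complex"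
  assumes root_system: "root_system R" and Rp_subset: "Rp \<subseteq> R"
begin

section \<open>Divided differences along a root\<close>

lemma finite_Rp: "finite Rp"
  using root_system Rp_subset finite_subset by (auto simp: root_system_def)

text \<open>A linear form changes under the reflection by a multiple of \<alpha>, and products
  follow the twisted Leibniz rule \<open>fg - rf rg = (f - rf) g + rf (g - rg)\<close>.\<close>

lemma divided_difference_exists:
  assumes "\<alpha> \<in> R" "f \<in> polyfun"
  shows "\<exists>g\<in>polyfun. \<forall>p. complex_of_real (\<alpha> p) * g p = f p - f (root_reflection R \<alpha> p)"
  using assms(2)
proof induction
  case (polyfun_const c)
  show ?case by (intro bexI[of _ "\<lambda>_. 0"]) (auto intro: polyfun.polyfun_const)
next
  case (polyfun_linear x)
  then show ?case
    by (intro bexI[of _ "\<lambda>_. x (coroot R \<alpha>)"])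
       (auto intro: polyfun.polyfun_const simp: root_reflection_def linear_diff linear_scale scaleR_conv_of_real)
next
  case (polyfun_add f g)
  then obtain f' g' where "f' \<in> polyfun" "\<forall>p. complex_of_real (\<alpha> p) * f' p = f p - f (root_reflection R \<alpha> p)"
    "g' \<in> polyfun" "\<forall>p. complex_of_real (\<alpha> p) * g' p = g p - g (root_reflection R \<alpha> p)" by blast
  then show ?case
    by (intro bexI[of _ "\<lambda>p. f' p + g' p"]) (auto intro: polyfun.polyfun_add simp: algebra_simps)
next
  case (polyfun_mult f g)
  then obtain f' g' where *: "f' \<in> polyfun" "\<And>p. complex_of_real (\<alpha> p) * f' p = f p - f (root_reflection R \<alpha> p)"
    "g' \<in> polyfun" "\<And>p. complex_of_real (\<alpha> p) * g' p = g p - g (root_reflection R \<alpha> p)" by blast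
  have r: "(\<lambda>p. f (root_reflection R \<alpha> p)) \<in> polyfun"
    using polyfun_compose_linear[OF linear_root_reflection[OF root_system assms(1)] polyfun_mult(1)]
    by (simp add: comp_def)
  have "complex_of_real (\<alpha> p) * (f' p * g p + f (root_reflection R \<alpha> p) * g' p) =
      f p * g p - f (root_reflection R \<alpha> p) * g (root_reflection R \<alpha> p)" for p
  proof -
    have "complex_of_real (\<alpha> p) * (f' p * g p + f (root_reflection R \<alpha> p) * g' p) =
      (complex_of_real (\<alpha> p) * f' p) * g p + f (root_reflection R \<alpha> p) * (complex_of_real (\<alpha> p) * g' p)"
      by (simp add: algebra_simps)
    then show ?thesis unfolding * by (simp add: algebra_simps)
  qed
  then show ?case using * r polyfun_mult(2)
    by (intro bexI[of _ "\<lambda>p. f' p * g p + f (root_reflection R \<alpha> p) * g' p"])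
       (auto intro!: polyfun.polyfun_add polyfun.polyfun_mult)
qed

text \<open>Off the hyperplane of \<open>\<alpha>\<close> one may cancel; polynomial functions are continuous along lines.\<close>

lemma root_mult_cancel:
  assumes "\<alpha> \<in> R" "f \<in> polyfun" "g \<in> polyfun"
    and eq: "\<And>p. complex_of_real (\<alpha> p) * f p = complex_of_real (\<alpha> p) * g p"
  shows "f = g"
proof
  fix p
  show "f p = g p"
  proof (cases "\<alpha> p = 0")
    case False
    then show ?thesis using eq[of p] by simp
  next
    case True
    \<comment> \<open>Along the coroot \<alpha> grows with slope 2, so the line through a point of
      the hyperplane leaves it at once.\<close>
    define v where "v = coroot R \<alpha>"
    have \<alpha>v: "\<alpha> (p + t *\<^sub>R v) = 2 * t" for t
      using root_linear[OF root_system assms(1)] root_coroot[OF root_system assms(1)] True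
      by (simp add: v_def linear_add linear_scale)
    have cont: "isCont (\<lambda>t. f (p + t *\<^sub>R v) - g (p + t *\<^sub>R v)) 0"
      using polyfun_line_differentiable[OF polyfun_diff[OF assms(2,3)], of p v 0]
      by (rule differentiable_imp_continuous_within)
    have "f (p + t *\<^sub>R v) - g (p + t *\<^sub>R v) = 0" if "t \<noteq> 0" for t
      using eq[of "p + t *\<^sub>R v"] that by (simp add: \<alpha>v)
    then have "((\<lambda>t. f (p + t *\<^sub>R v) - g (p + t *\<^sub>R v)) \<longlongrightarrow> 0) (at 0)"
      by (intro tendsto_eventually) (simp add: eventually_at_filter)
    with cont have "f (p + 0 *\<^sub>R v) - g (p + 0 *\<^sub>R v) = 0"
      unfolding isCont_def using LIM_unique by blast
    then show ?thesis by simp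
  qed
qed

lemma weyl_op_reflection: "\<alpha> \<in> R \<Longrightarrow> f \<in> polyfun \<Longrightarrow>
    weyl_op (root_reflection R \<alpha>) f = (\<lambda>p. f (root_reflection R \<alpha> p))"
  by (simp add: inv_root_reflection[OF root_system] comp_def)

text \<open>Makes the description in \<open>divided_difference\<close> usable: any polynomial
  solution of the defining equation is its value, and the calculation rules below are obtained by
  exhibiting one.\<close>

lemma divided_difference_unique:
  assumes "\<alpha> \<in> R" "f \<in> polyfun" "g \<in> polyfun"
    "\<And>p. complex_of_real (\<alpha> p) * g p = f p - f (root_reflection R \<alpha> p)"
  shows "divided_difference R \<alpha> f = g"
  unfolding divided_difference_def weyl_op_reflection[OF assms(1,2)]
  using assms by (intro the_equality root_mult_cancel[OF assms(1)]) auto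

lemma divided_difference:
  assumes "\<alpha> \<in> R" "f \<in> polyfun"
  shows "divided_difference R \<alpha> f \<in> polyfun"
    "complex_of_real (\<alpha> p) * divided_difference R \<alpha> f p = f p - f (root_reflection R \<alpha> p)"
proof -
  obtain g where "g \<in> polyfun" "\<And>p. complex_of_real (\<alpha> p) * g p = f p - f (root_reflection R \<alpha> p)"
    using divided_difference_exists[OF assms] by blast
  moreover from this have "divided_difference R \<alpha> f = g"
    using assms by (intro divided_difference_unique) auto
  ultimately show "divided_difference R \<alpha> f \<in> polyfun"
    "complex_of_real (\<alpha> p) * divided_difference R \<alpha> f p = f p - f (root_reflection R \<alpha> p)" by auto
qed

lemma divided_difference_add:
  assumes "\<alpha> \<in> R" "f \<in> polyfun" "g \<in> polyfun"
  shows "divided_difference R \<alpha> (\<lambda>p. f p + g p) = (\<lambda>p. divided_difference R \<alpha> f p + divided_difference R \<alpha> g p)"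
  using assms divided_difference[OF assms(1)]
  by (intro divided_difference_unique polyfun_add) (auto simp: distrib_left)

lemma divided_difference_cmult:
  assumes "\<alpha> \<in> R" "f \<in> polyfun"
  shows "divided_difference R \<alpha> (\<lambda>p. c * f p) = (\<lambda>p. c * divided_difference R \<alpha> f p)"
  using assms divided_difference[OF assms(1)]
  by (intro divided_difference_unique polyfun_cmult) (auto simp: mult.left_commute right_diff_distrib)

text \<open>The twisted Leibniz rule for a linear factor: \<open>x\<close> minus its reflection is
  \<alpha> times the constant \<open>x (coroot R \<alpha>)\<close>. The extra term carries the
  reflection that appears in the commutator of a Dunkl operator with \<open>x\<close>.\<close>

lemma divided_difference_linear_mult:
  assumes "\<alpha> \<in> R" "f \<in> polyfun" "linear x"
  shows "divided_difference R \<alpha> (\<lambda>p. x p * f p) =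
    (\<lambda>p. x p * divided_difference R \<alpha> f p + x (coroot R \<alpha>) * f (root_reflection R \<alpha> p))"
proof (rule divided_difference_unique)
  show "(\<lambda>p. x p * divided_difference R \<alpha> f p + x (coroot R \<alpha>) * f (root_reflection R \<alpha> p)) \<in> polyfun"
    using polyfun_mult[OF polyfun_linear[OF assms(3)] divided_difference(1)[OF assms(1,2)]]
      polyfun_cmult[OF polyfun_compose_linear[OF linear_root_reflection[OF root_system assms(1)] assms(2)]]
    by (intro polyfun_add) (simp_all add: comp_def)
  fix p
  have "x (root_reflection R \<alpha> p) = x p - complex_of_real (\<alpha> p) * x (coroot R \<alpha>)"
    using assms(3) by (simp add: root_reflection_def linear_diff linear_scale scaleR_conv_of_real)
  moreover have "complex_of_real (\<alpha> p) * (x p * divided_difference R \<alpha> f p + x (coroot R \<alpha>) * f (root_reflection R \<alpha> p))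
    = x p * (complex_of_real (\<alpha> p) * divided_difference R \<alpha> f p)
      + complex_of_real (\<alpha> p) * x (coroot R \<alpha>) * f (root_reflection R \<alpha> p)"
    by (simp add: algebra_simps)
  ultimately show "complex_of_real (\<alpha> p) * (x p * divided_difference R \<alpha> f p + x (coroot R \<alpha>) * f (root_reflection R \<alpha> p)) =
    x p * f p - x (root_reflection R \<alpha> p) * f (root_reflection R \<alpha> p)"
    by (simp only: divided_difference(2)[OF assms(1,2)]) (simp add: algebra_simps)
qed (use assms in \<open>auto intro: polyfun_mult polyfun_linear\<close>)

section \<open>Dunkl operators and their commutators\<close>

abbreviation "T \<equiv> dunkl R Rp k"

lemma dunkl_apply: "f \<in> polyfun \<Longrightarrow>
    T y f = (\<lambda>p. deriv_along y f p + (\<Sum>\<alpha>\<in>Rp. k \<alpha> * pairing \<alpha> y * divided_difference R \<alpha> f p))"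
  by (simp add: dunkl_def)

lemma dunkl_closed: "T y \<in> carrier end_ring"
  unfolding dunkl_def
proof (rule end_restrict)
  fix f :: "'a \<Rightarrow> complex" assume f: "f \<in> polyfun"
  then show "(\<lambda>p. deriv_along y f p + (\<Sum>\<alpha>\<in>Rp. k \<alpha> * pairing \<alpha> y * divided_difference R \<alpha> f p)) \<in> polyfun"
    using Rp_subset divided_difference
    by (intro polyfun_add polyfun_deriv_along polyfun_sum polyfun_cmult) auto
  fix g :: "'a \<Rightarrow> complex" assume g: "g \<in> polyfun"
  have "(\<Sum>\<alpha>\<in>Rp. k \<alpha> * pairing \<alpha> y * divided_difference R \<alpha> (\<lambda>p. f p + g p) p) =
     (\<Sum>\<alpha>\<in>Rp. k \<alpha> * pairing \<alpha> y * divided_difference R \<alpha> f p) +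
     (\<Sum>\<alpha>\<in>Rp. k \<alpha> * pairing \<alpha> y * divided_difference R \<alpha> g p)" for p
    unfolding sum.distrib[symmetric] using Rp_subset f g
    by (intro sum.cong) (auto simp: divided_difference_add algebra_simps)
  then show "(\<lambda>p. deriv_along y (\<lambda>p. f p + g p) p + (\<Sum>\<alpha>\<in>Rp. k \<alpha> * pairing \<alpha> y * divided_difference R \<alpha> (\<lambda>p. f p + g p) p)) =
     (\<lambda>p. deriv_along y f p + (\<Sum>\<alpha>\<in>Rp. k \<alpha> * pairing \<alpha> y * divided_difference R \<alpha> f p) +
       (deriv_along y g p + (\<Sum>\<alpha>\<in>Rp. k \<alpha> * pairing \<alpha> y * divided_difference R \<alpha> g p)))"
    using f g by (simp add: deriv_along_dir_deriv dir_deriv_add algebra_simps)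
next
  fix c and f :: "'a \<Rightarrow> complex" assume f: "f \<in> polyfun"
  have "(\<Sum>\<alpha>\<in>Rp. k \<alpha> * pairing \<alpha> y * divided_difference R \<alpha> (\<lambda>p. c * f p) p) =
     c * (\<Sum>\<alpha>\<in>Rp. k \<alpha> * pairing \<alpha> y * divided_difference R \<alpha> f p)" for p
    unfolding sum_distrib_left using Rp_subset f
    by (intro sum.cong) (auto simp: divided_difference_cmult algebra_simps)
  then show "(\<lambda>p. deriv_along y (\<lambda>p. c * f p) p + (\<Sum>\<alpha>\<in>Rp. k \<alpha> * pairing \<alpha> y * divided_difference R \<alpha> (\<lambda>p. c * f p) p)) =
     (\<lambda>p. c * (deriv_along y f p + (\<Sum>\<alpha>\<in>Rp. k \<alpha> * pairing \<alpha> y * divided_difference R \<alpha> f p)))"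
    using f by (simp add: deriv_along_dir_deriv dir_deriv_cmult algebra_simps)
qed

text \<open>The complex linear extension of \<open>x\<close>, evaluated at a + i b for
  \<open>y = (a, b)\<close>.\<close>

definition pair_linear :: "('a \<Rightarrow> complex) \<Rightarrow> 'a \<times> 'a \<Rightarrow> complex" where
  "pair_linear x y = x (fst y) + \<i> * x (snd y)"

text \<open>The commutator of \<open>T y\<close> with multiplication by \<open>x\<close>, written
  through scalars and reflections so that membership in the group algebra can be read off from its
  form.\<close>

definition bracket_op :: "'a \<times> 'a \<Rightarrow> ('a \<Rightarrow> complex) \<Rightarrow> 'a operator" where
  "bracket_op y x = scalar_op (pair_linear x y) \<oplus>\<^bsub>end_ring\<^esub>
     (\<lambda>f\<in>polyfun. \<lambda>p. \<Sum>\<alpha>\<in>Rp. (scalar_op (k \<alpha> * pairing \<alpha> y * x (coroot R \<alpha>)) \<otimes>\<^bsub>end_ring\<^esub>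
        weyl_op (root_reflection R \<alpha>)) f p)"

lemma polyfun_reflection: "\<alpha> \<in> R \<Longrightarrow> f \<in> polyfun \<Longrightarrow> (\<lambda>p. f (root_reflection R \<alpha> p)) \<in> polyfun"
  using polyfun_compose_linear[OF linear_root_reflection[OF root_system]] by (simp add: comp_def)

lemma bracket_op_apply: "f \<in> polyfun \<Longrightarrow> bracket_op y x f =
    (\<lambda>p. pair_linear x y * f p + (\<Sum>\<alpha>\<in>Rp. k \<alpha> * pairing \<alpha> y * x (coroot R \<alpha>) * f (root_reflection R \<alpha> p)))"
  using Rp_subset
  by (auto simp: bracket_op_def weyl_op_reflection polyfun_reflection fun_eq_iff subset_eq
      simp del: op_apply(3) intro!: sum.cong)

lemma dunkl_linear_mult:
  assumes "linear x" "f \<in> polyfun"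
  shows "T y (\<lambda>p. x p * f p) = (\<lambda>p. x p * T y f p + bracket_op y x f p)"
proof
  fix p
  have "(\<Sum>\<alpha>\<in>Rp. k \<alpha> * pairing \<alpha> y * divided_difference R \<alpha> (\<lambda>p. x p * f p) p) =
    x p * (\<Sum>\<alpha>\<in>Rp. k \<alpha> * pairing \<alpha> y * divided_difference R \<alpha> f p) +
    (\<Sum>\<alpha>\<in>Rp. k \<alpha> * pairing \<alpha> y * x (coroot R \<alpha>) * f (root_reflection R \<alpha> p))"
    unfolding sum_distrib_left sum.distrib[symmetric] using Rp_subset assms
    by (intro sum.cong refl, subst divided_difference_linear_mult) (auto simp: distrib_left)
  moreover have "deriv_along y (\<lambda>p. x p * f p) p = x p * deriv_along y f p + pair_linear x y * f p"
    using assms by (simp add: deriv_along_dir_deriv dir_deriv_mult polyfun_linear dir_deriv_linear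
        pair_linear_def algebra_simps)
  ultimately show "T y (\<lambda>p. x p * f p) p = x p * T y f p + bracket_op y x f p"
    using assms by (simp add: dunkl_apply bracket_op_apply polyfun_mult polyfun_linear algebra_simps)
qed

lemma bracket_op_closed: "bracket_op y x \<in> carrier end_ring"
proof -
  interpret E: ring "end_ring :: 'a operator ring" by (rule ring_end_ring)
  have "(\<lambda>f\<in>polyfun. \<lambda>p. \<Sum>\<alpha>\<in>Rp. (scalar_op (k \<alpha> * pairing \<alpha> y * x (coroot R \<alpha>)) \<otimes>\<^bsub>end_ring\<^esub>
      weyl_op (root_reflection R \<alpha>)) f p) \<in> carrier end_ring"
  proof (rule op_sum_in_subring[OF E.carrier_is_subring finite_Rp])
    fix \<alpha> assume "\<alpha> \<in> Rp"
    then have "\<alpha> \<in> R" using Rp_subset by auto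
    then show "scalar_op (k \<alpha> * pairing \<alpha> y * x (coroot R \<alpha>)) \<otimes>\<^bsub>end_ring\<^esub> weyl_op (root_reflection R \<alpha>)
        \<in> carrier end_ring"
      by (intro end_closed scalar_op_closed weyl_op_closed)
         (simp add: inv_root_reflection[OF root_system] linear_root_reflection[OF root_system])
  qed
  then show ?thesis unfolding bracket_op_def by (intro end_closed scalar_op_closed)
qed

text \<open>The bracket only involves scalars and linear substitutions, both of which commute with
  the Euler field. The inner induction carries polynomiality along, since additivity of
  \<open>euler\<close> requires it.\<close>

lemma euler_bracket_op:
  assumes "f \<in> polyfun" shows "euler (bracket_op y x f) = bracket_op y x (euler f)"
proof -
  have sum: "(\<lambda>p. \<Sum>\<alpha>\<in>I. c \<alpha> * f (root_reflection R \<alpha> p)) \<in> polyfun \<and>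
     euler (\<lambda>p. \<Sum>\<alpha>\<in>I. c \<alpha> * f (root_reflection R \<alpha> p)) = (\<lambda>p. \<Sum>\<alpha>\<in>I. c \<alpha> * euler f (root_reflection R \<alpha> p))"
    if "finite I" "I \<subseteq> R" for I and c :: "('a \<Rightarrow> real) \<Rightarrow> complex"
    using that
  proof induction
    case empty
    have "euler (\<lambda>p. 0) = (\<lambda>p. 0)" by (simp add: euler_def[abs_def] dir_deriv_const)
    then show ?case by (simp add: polyfun_const)
  next
    case (insert \<alpha> I)
    have "euler (\<lambda>p. f (root_reflection R \<alpha> p)) = (\<lambda>p. euler f (root_reflection R \<alpha> p))"
      using euler_compose_linear[OF linear_root_reflection[OF root_system], of \<alpha> f] insert.prems by (simp add: comp_def)
    with insert assms show ?case
      by (simp add: euler_add euler_cmult polyfun_add polyfun_cmult polyfun_reflection)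
  qed
  show ?thesis
    using assms sum[OF finite_Rp Rp_subset]
    by (simp add: bracket_op_apply polyfun_euler euler_add euler_cmult polyfun_cmult)
qed

text \<open>This expresses that \<open>T y\<close> lowers the degree by one. Instead of splitting
  into homogeneous parts, the functions satisfying the identity are shown to contain 1 and to be
  stable under sums, scalars and multiplication by linear forms, hence by all polynomials.\<close>

lemma euler_dunkl:
  assumes "f \<in> polyfun"
  shows "euler (T y f) = (\<lambda>p. T y (euler f) p - T y f p)"
proof -
  define Z where "Z = {f \<in> polyfun. \<forall>p. euler (T y f) p = T y (euler f) p - T y f p}"
  note Tc = end_carrierD[OF dunkl_closed]
  have add: "(\<lambda>p. f p + g p) \<in> Z" if "f \<in> Z" "g \<in> Z" for f g
    using that by (simp add: Z_def polyfun_add Tc euler_add polyfun_euler)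
  have cmult: "(\<lambda>p. c * f p) \<in> Z" if "f \<in> Z" for c f
    using that by (simp add: Z_def polyfun_cmult Tc euler_cmult polyfun_euler right_diff_distrib)
  \<comment> \<open>The +1 from \<open>x\<close> and the -1 from \<open>T y\<close> cancel, so that
    both sides become \<open>T y\<close> applied to the product of \<open>x\<close> with
    \<open>euler f\<close>.\<close>
  have lin: "(\<lambda>p. x p * f p) \<in> Z" if x: "linear x" and f: "f \<in> Z" for x f
  proof -
    have fp: "f \<in> polyfun" and fe: "euler (T y f) = (\<lambda>p. T y (euler f) p - T y f p)"
      using f by (auto simp: Z_def)
    note bc = end_carrierD(1)[OF bracket_op_closed]
    have "euler (T y (\<lambda>p. x p * f p)) p = T y (euler (\<lambda>p. x p * f p)) p - T y (\<lambda>p. x p * f p) p" for p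
      using x fp
      by (simp add: dunkl_linear_mult euler_add euler_linear_mult Tc bc polyfun_mult polyfun_linear
          fe euler_bracket_op polyfun_euler) (simp add: algebra_simps)
    then show ?thesis using x fp by (simp add: Z_def polyfun_mult polyfun_linear)
  qed
  have mult: "\<forall>f\<in>Z. (\<lambda>p. g p * f p) \<in> Z" if "g \<in> polyfun" for g
    using that
  proof induction
    case (polyfun_add g h)
    then show ?case using add by (simp add: distrib_right)
  next
    case (polyfun_mult g h)
    then show ?case by (simp add: mult.assoc)
  qed (simp_all add: cmult lin)
  have "(\<lambda>_. 1) \<in> Z"
  proof -
    have e: "euler (\<lambda>_. c) = (\<lambda>_. 0)" for c :: complex by (simp add: euler_def[abs_def] dir_deriv_const)
    have "divided_difference R \<alpha> (\<lambda>_. c) = (\<lambda>_. 0)" if "\<alpha> \<in> R" for \<alpha> and c :: complex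
      using that by (intro divided_difference_unique) (simp_all add: polyfun_const)
    then have "T y (\<lambda>_. c) = (\<lambda>_. 0)" for c :: complex
      using Rp_subset by (simp add: dunkl_apply polyfun_const deriv_along_dir_deriv dir_deriv_const subset_eq)
    then show ?thesis by (simp add: Z_def polyfun_const e)
  qed
  then have "(\<lambda>p. f p * 1) \<in> Z" by (rule bspec[OF mult[OF assms]])
  then show ?thesis by (auto simp: Z_def)
qed

end


section \<open>Relations in the rational Cherednik algebra\<close>

lemma scalar_op_one: "scalar_op 1 = \<one>\<^bsub>end_ring\<^esub>"
  by (intro end_eqI scalar_op_closed end_closed) simp

lemma scalar_op_add: "scalar_op (c + d) = scalar_op c \<oplus>\<^bsub>end_ring\<^esub> scalar_op d"
  by (intro end_eqI scalar_op_closed end_closed) (auto simp: distrib_right)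

lemma scalar_op_mult: "scalar_op (c * d) = scalar_op c \<otimes>\<^bsub>end_ring\<^esub> scalar_op d"
  by (intro end_eqI scalar_op_closed end_closed) (auto simp: polyfun_cmult mult.assoc)

lemma scalar_op_commute:
  "F \<in> carrier end_ring \<Longrightarrow> scalar_op c \<otimes>\<^bsub>end_ring\<^esub> F = F \<otimes>\<^bsub>end_ring\<^esub> scalar_op c"
  by (intro end_eqI scalar_op_closed end_closed) (auto simp: end_carrierD)

lemma weyl_op_id: "weyl_op id = \<one>\<^bsub>end_ring\<^esub>"
  by (simp add: weyl_op_def end_ring_def)

context dunkl_setup
begin

section \<open>The Cherednik algebra and its subalgebras inside \<open>end_ring\<close>\<close>

abbreviation "W \<equiv> weyl_group R"
abbreviation "H \<equiv> cherednik_algebra R Rp k"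
abbreviation "B \<equiv> dunkl_weyl_algebra R Rp k"

definition "generators = range scalar_op \<union> weyl_op ` W \<union> mult_op ` {x. linear x} \<union> range T"
text \<open>The image of the group algebra CW in the endomorphisms of the polynomials.\<close>

definition "group_algebra = generate_ring end_ring (range scalar_op \<union> weyl_op ` W)"

sublocale E: ring "end_ring :: 'a operator ring" by (rule ring_end_ring)

lemma weyl_op_W_closed: "w \<in> W \<Longrightarrow> weyl_op w \<in> carrier end_ring"
  by (intro weyl_op_closed weyl_linear[OF root_system] weyl_inv[OF root_system])

lemma generators_closed: "generators \<subseteq> carrier end_ring"
  unfolding generators_def
  using scalar_op_closed weyl_op_W_closed mult_op_closed dunkl_closed by auto

lemma H_eq: "H = end_ring\<lparr>carrier := generate_ring end_ring generators\<rparr>"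
  by (simp add: cherednik_algebra_def generators_def)

lemma H_carrier: "carrier H = generate_ring end_ring generators"
  by (simp add: H_eq)

lemma H_simps [simp]: "(\<otimes>\<^bsub>H\<^esub>) = (\<otimes>\<^bsub>end_ring\<^esub>)" "(\<oplus>\<^bsub>H\<^esub>) = (\<oplus>\<^bsub>end_ring\<^esub>)"
    "\<one>\<^bsub>H\<^esub> = \<one>\<^bsub>end_ring\<^esub>" "\<zero>\<^bsub>H\<^esub> = \<zero>\<^bsub>end_ring\<^esub>"
  by (simp_all add: cherednik_algebra_def)

lemma subring_H: "subring (carrier H) end_ring"
  unfolding H_carrier by (rule E.generate_ring_is_subring[OF generators_closed])

lemma H_subset: "carrier H \<subseteq> carrier end_ring"
  by (rule subringE(1)[OF subring_H])

lemma ring_H: "ring H"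
  unfolding H_eq by (rule E.generate_ring_is_ring[OF generators_closed])

lemma generator_in_H: "a \<in> generators \<Longrightarrow> a \<in> carrier H"
  unfolding H_carrier by (rule generate_ring.incl)

lemma generators_in_H:
  "scalar_op c \<in> carrier H" "w \<in> W \<Longrightarrow> weyl_op w \<in> carrier H"
  "linear x \<Longrightarrow> mult_op x \<in> carrier H" "T y \<in> carrier H"
  by (auto intro!: generator_in_H simp: generators_def)

lemma subset_H_generate: "G \<subseteq> carrier H \<Longrightarrow> generate_ring end_ring G \<subseteq> carrier H"
  using E.generate_ring_min_subring1[OF _ subring_H] H_subset by blast

lemma group_algebra_subring: "subring group_algebra end_ring"
  unfolding group_algebra_def using scalar_op_closed weyl_op_W_closed
  by (intro E.generate_ring_is_subring) auto

lemma group_algebra_subset_H: "group_algebra \<subseteq> carrier H"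
  unfolding group_algebra_def using generators_in_H by (intro subset_H_generate) auto

lemma dunkl_algebra_carrier:
  "carrier (dunkl_algebra R Rp k) = generate_ring end_ring (range scalar_op \<union> range T)"
  by (simp add: dunkl_algebra_def)

lemma dunkl_algebra_subset_H: "carrier (dunkl_algebra R Rp k) \<subseteq> carrier H"
  unfolding dunkl_algebra_carrier using generators_in_H by (intro subset_H_generate) auto

definition "B_generators = carrier (dunkl_algebra R Rp k) \<union> weyl_op ` W"

lemma B_eq: "B = end_ring\<lparr>carrier := generate_ring end_ring B_generators\<rparr>"
  by (simp add: dunkl_weyl_algebra_def B_generators_def)

lemma B_carrier: "carrier B = generate_ring end_ring B_generators"
  by (simp add: B_eq)

lemma B_simps [simp]: "(\<otimes>\<^bsub>B\<^esub>) = (\<otimes>\<^bsub>end_ring\<^esub>)" "(\<oplus>\<^bsub>B\<^esub>) = (\<oplus>\<^bsub>end_ring\<^esub>)"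
    "\<one>\<^bsub>B\<^esub> = \<one>\<^bsub>end_ring\<^esub>" "\<zero>\<^bsub>B\<^esub> = \<zero>\<^bsub>end_ring\<^esub>"
  by (simp_all add: dunkl_weyl_algebra_def)

lemma B_subset_H: "carrier B \<subseteq> carrier H"
  unfolding B_carrier B_generators_def
  using generators_in_H dunkl_algebra_subset_H by (intro subset_H_generate) auto

lemma subring_B: "subring (carrier B) end_ring"
  unfolding B_carrier using generators_in_H dunkl_algebra_subset_H H_subset
  by (intro E.generate_ring_is_subring) (auto simp: B_generators_def)

lemma generators_in_B:
  "scalar_op c \<in> carrier B" "w \<in> W \<Longrightarrow> weyl_op w \<in> carrier B" "T y \<in> carrier B"
proof -
  show "scalar_op c \<in> carrier B" "T y \<in> carrier B"
    unfolding B_carrier B_generators_def dunkl_algebra_carrier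
    by (rule generate_ring.incl, rule UnI1, rule generate_ring.incl, simp)+
  show "w \<in> W \<Longrightarrow> weyl_op w \<in> carrier B"
    unfolding B_carrier B_generators_def by (rule generate_ring.incl) simp
qed

lemma group_algebra_subset_B: "group_algebra \<subseteq> carrier B"
  unfolding group_algebra_def using generators_in_B subringE(1)[OF subring_B]
  by (intro E.generate_ring_min_subring1[OF _ subring_B]) auto

lemma E_minus_scalar:
  fixes F :: "'a operator"
  shows "F \<in> carrier end_ring \<Longrightarrow> \<ominus>\<^bsub>end_ring\<^esub> F = scalar_op (-1) \<otimes>\<^bsub>end_ring\<^esub> F"
  by (intro end_eqI end_closed scalar_op_closed E.a_inv_closed) (auto simp: end_minus_apply end_carrierD)

text \<open>\<open>carrier B\<close> is generated in two stages and with negatives; this rule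
  flattens both, since a negative is a product with \<open>scalar_op (-1)\<close> and the Dunkl
  algebra is itself generated by scalars and Dunkl operators.\<close>

lemma B_induct [consumes 1, case_names scalar dunkl weyl add mult]:
  assumes "b \<in> carrier B"
    and "\<And>c. P (scalar_op c)" "\<And>y. P (T y)" "\<And>w. w \<in> W \<Longrightarrow> P (weyl_op w)"
    and add: "\<And>a b. a \<in> carrier B \<Longrightarrow> b \<in> carrier B \<Longrightarrow> P a \<Longrightarrow> P b \<Longrightarrow> P (a \<oplus>\<^bsub>end_ring\<^esub> b)"
    and mult: "\<And>a b. a \<in> carrier B \<Longrightarrow> b \<in> carrier B \<Longrightarrow> P a \<Longrightarrow> P b \<Longrightarrow> P (a \<otimes>\<^bsub>end_ring\<^esub> b)"
  shows "P b"
proof -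
  have one: "P \<one>\<^bsub>end_ring\<^esub>" using assms(2)[of 1] by (simp add: scalar_op_one)
  have minus: "P (\<ominus>\<^bsub>end_ring\<^esub> a)" if "a \<in> carrier B" "P a" for a
  proof -
    have "a \<in> carrier end_ring" using that(1) B_subset_H H_subset by blast
    then show ?thesis using mult[OF generators_in_B(1) that(1) assms(2) that(2)] by (simp add: E_minus_scalar)
  qed
  have D: "a \<in> carrier B \<and> P a" if "a \<in> carrier (dunkl_algebra R Rp k)" for a
    using that unfolding dunkl_algebra_carrier
  proof induction
    case one
    then show ?case using \<open>P \<one>\<^bsub>end_ring\<^esub>\<close> subringE(3)[OF subring_B] by blast
  next
    case (incl h)
    then show ?case using assms(2,3) generators_in_B by auto
  next
    case (a_inv h)
    then show ?case using minus subringE(5)[OF subring_B] by blast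
  next
    case (eng_add h1 h2)
    then show ?case using add subringE(7)[OF subring_B] by blast
  next
    case (eng_mult h1 h2)
    then show ?case using mult subringE(6)[OF subring_B] by blast
  qed
  show ?thesis
    using assms(1) unfolding B_carrier
  proof induction
    case (incl h)
    then show ?case using D assms(4) by (auto simp: B_generators_def)
  qed (use one minus add mult in \<open>simp_all add: B_carrier\<close>)
qed

section \<open>Commutation relations between the generators\<close>

lemma weyl_op_comp:
  assumes "w \<in> W" "w' \<in> W" shows "weyl_op (w \<circ> w') = weyl_op w \<otimes>\<^bsub>end_ring\<^esub> weyl_op w'"
proof (rule end_eqI)
  show "weyl_op (w \<circ> w') \<in> carrier end_ring" "weyl_op w \<otimes>\<^bsub>end_ring\<^esub> weyl_op w' \<in> carrier end_ring"
    using assms by (auto intro!: weyl_op_W_closed weyl_comp end_closed)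
  fix f :: "'a \<Rightarrow> complex" assume f: "f \<in> polyfun"
  have "inv_into UNIV (w \<circ> w') = inv_into UNIV w' \<circ> inv_into UNIV w"
    using assms by (intro o_inv_distrib weyl_bij[OF root_system])
  moreover have "f \<circ> inv_into UNIV w' \<in> polyfun"
    using weyl_op_W_closed[OF assms(2)] end_carrierD(1) f by fastforce
  ultimately show "weyl_op (w \<circ> w') f = (weyl_op w \<otimes>\<^bsub>end_ring\<^esub> weyl_op w') f"
    using f by (simp add: fun_eq_iff)
qed

lemma weyl_mult_op:
  assumes "w \<in> W" "linear x"
  shows "linear (x \<circ> inv_into UNIV w)"
    "weyl_op w \<otimes>\<^bsub>end_ring\<^esub> mult_op x = mult_op (x \<circ> inv_into UNIV w) \<otimes>\<^bsub>end_ring\<^esub> weyl_op w"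
proof -
  show lin: "linear (x \<circ> inv_into UNIV w)"
    using assms by (intro linear_compose weyl_linear[OF root_system] weyl_inv[OF root_system])
  show "weyl_op w \<otimes>\<^bsub>end_ring\<^esub> mult_op x = mult_op (x \<circ> inv_into UNIV w) \<otimes>\<^bsub>end_ring\<^esub> weyl_op w"
  proof (rule end_eqI)
    fix f :: "'a \<Rightarrow> complex" assume f: "f \<in> polyfun"
    have "f \<circ> inv_into UNIV w \<in> polyfun"
      using weyl_op_W_closed[OF assms(1)] end_carrierD(1) f by fastforce
    with f assms(2) show "(weyl_op w \<otimes>\<^bsub>end_ring\<^esub> mult_op x) f =
        (mult_op (x \<circ> inv_into UNIV w) \<otimes>\<^bsub>end_ring\<^esub> weyl_op w) f"
      by (simp add: polyfun_mult polyfun_linear comp_def)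
  qed (use assms lin in \<open>auto intro!: end_closed weyl_op_W_closed mult_op_closed\<close>)
qed

lemma dunkl_mult_op:
  assumes "linear x"
  shows "T y \<otimes>\<^bsub>end_ring\<^esub> mult_op x = (mult_op x \<otimes>\<^bsub>end_ring\<^esub> T y) \<oplus>\<^bsub>end_ring\<^esub> bracket_op y x"
proof (rule end_eqI)
  fix f :: "'a \<Rightarrow> complex" assume f: "f \<in> polyfun"
  then show "(T y \<otimes>\<^bsub>end_ring\<^esub> mult_op x) f = ((mult_op x \<otimes>\<^bsub>end_ring\<^esub> T y) \<oplus>\<^bsub>end_ring\<^esub> bracket_op y x) f"
    using assms end_carrierD(1)[OF dunkl_closed f] by (simp add: dunkl_linear_mult)
qed (use assms in \<open>auto intro!: end_closed mult_op_closed dunkl_closed bracket_op_closed\<close>)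

lemma euler_mult_op:
  assumes "linear x"
  shows "euler_op \<otimes>\<^bsub>end_ring\<^esub> mult_op x = (mult_op x \<otimes>\<^bsub>end_ring\<^esub> euler_op) \<oplus>\<^bsub>end_ring\<^esub> mult_op x"
  using assms
  by (intro end_eqI end_closed mult_op_closed euler_op_closed)
     (auto simp: euler_linear_mult polyfun_mult polyfun_linear polyfun_euler)

lemma euler_weyl_op:
  assumes "w \<in> W" shows "euler_op \<otimes>\<^bsub>end_ring\<^esub> weyl_op w = weyl_op w \<otimes>\<^bsub>end_ring\<^esub> euler_op"
proof (rule end_eqI)
  fix f :: "'a \<Rightarrow> complex" assume f: "f \<in> polyfun"
  have "f \<circ> inv_into UNIV w \<in> polyfun"
    using weyl_op_W_closed[OF assms(1)] end_carrierD(1) f by fastforce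
  with f show "(euler_op \<otimes>\<^bsub>end_ring\<^esub> weyl_op w) f = (weyl_op w \<otimes>\<^bsub>end_ring\<^esub> euler_op) f"
    using weyl_linear[OF root_system weyl_inv[OF root_system assms]]
    by (simp add: euler_compose_linear polyfun_euler)
qed (use assms in \<open>auto intro!: end_closed weyl_op_W_closed euler_op_closed\<close>)

text \<open>The relation \<open>[E, T_y] = - T_y\<close> with the negative moved across, so that no
  negatives enter when it is applied to a module.\<close>

lemma euler_dunkl_op:
  "(euler_op \<otimes>\<^bsub>end_ring\<^esub> T y) \<oplus>\<^bsub>end_ring\<^esub> T y = T y \<otimes>\<^bsub>end_ring\<^esub> euler_op"
proof (rule end_eqI)
  fix f :: "'a \<Rightarrow> complex" assume f: "f \<in> polyfun"
  show "((euler_op \<otimes>\<^bsub>end_ring\<^esub> T y) \<oplus>\<^bsub>end_ring\<^esub> T y) f = (T y \<otimes>\<^bsub>end_ring\<^esub> euler_op) f"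
    using f end_carrierD(1)[OF dunkl_closed f] by (simp add: euler_dunkl)
qed (auto intro!: end_closed dunkl_closed euler_op_closed)

lemma positive_reflection_op: "\<alpha> \<in> Rp \<Longrightarrow> weyl_op (root_reflection R \<alpha>) \<in> weyl_op ` W"
  using weyl_reflection[of \<alpha> R] Rp_subset by blast

text \<open>This is what lets a Dunkl operator be moved to the right past \<open>x\<close> at the
  cost of terms that preserve the degree.\<close>

lemma bracket_op_group_algebra: "bracket_op y x \<in> group_algebra"
  unfolding bracket_op_def
proof (rule subringE(7)[OF group_algebra_subring])
  show "scalar_op (pair_linear x y) \<in> group_algebra"
    unfolding group_algebra_def by (rule generate_ring.incl) simp
  show "(\<lambda>f\<in>polyfun. \<lambda>p. \<Sum>\<alpha>\<in>Rp. (scalar_op (k \<alpha> * pairing \<alpha> y * x (coroot R \<alpha>)) \<otimes>\<^bsub>end_ring\<^esub>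
      weyl_op (root_reflection R \<alpha>)) f p) \<in> group_algebra"
  proof (rule op_sum_in_subring[OF group_algebra_subring finite_Rp])
    fix \<alpha> assume "\<alpha> \<in> Rp"
    then show "scalar_op (k \<alpha> * pairing \<alpha> y * x (coroot R \<alpha>)) \<otimes>\<^bsub>end_ring\<^esub> weyl_op (root_reflection R \<alpha>) \<in> group_algebra"
      unfolding group_algebra_def using positive_reflection_op
      by (intro generate_ring.eng_mult generate_ring.incl) auto
  qed
qed

section \<open>The Euler field as an element of the Cherednik algebra\<close>

definition coord :: "'a \<Rightarrow> 'a \<Rightarrow> complex" where "coord b p = complex_of_real (p \<bullet> b)"

lemma linear_coord: "linear (coord b)"
  unfolding coord_def[abs_def] by (intro linear_complex_of_real linearI) (auto simp: inner_add_left)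

definition dunkl_sum :: "'a operator" where
  "dunkl_sum = (\<lambda>f\<in>polyfun. \<lambda>p. \<Sum>b\<in>Basis. (mult_op (coord b) \<otimes>\<^bsub>end_ring\<^esub> T (b, 0)) f p)"

text \<open>The difference between \<open>dunkl_sum\<close> and the Euler field. It lies in the
  group algebra, which later ties the Euler eigenvalue to the representation of W.\<close>

definition reflection_sum :: "'a operator" where
  "reflection_sum = (\<lambda>f\<in>polyfun. \<lambda>p. \<Sum>\<alpha>\<in>Rp. (scalar_op (k \<alpha>) \<otimes>\<^bsub>end_ring\<^esub>
     (\<one>\<^bsub>end_ring\<^esub> \<oplus>\<^bsub>end_ring\<^esub> (scalar_op (-1) \<otimes>\<^bsub>end_ring\<^esub> weyl_op (root_reflection R \<alpha>)))) f p)"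

lemma dunkl_sum_H: "dunkl_sum \<in> carrier H"
  unfolding dunkl_sum_def using generators_in_H(3)[OF linear_coord] generators_in_H(4) subringE(6)[OF subring_H]
  by (intro op_sum_in_subring[OF subring_H]) auto

lemma reflection_sum_group_algebra: "reflection_sum \<in> group_algebra"
  unfolding reflection_sum_def
proof (rule op_sum_in_subring[OF group_algebra_subring finite_Rp])
  fix \<alpha> assume "\<alpha> \<in> Rp"
  then show "scalar_op (k \<alpha>) \<otimes>\<^bsub>end_ring\<^esub> (\<one>\<^bsub>end_ring\<^esub> \<oplus>\<^bsub>end_ring\<^esub>
      (scalar_op (-1) \<otimes>\<^bsub>end_ring\<^esub> weyl_op (root_reflection R \<alpha>))) \<in> group_algebra"
    unfolding group_algebra_def using positive_reflection_op
    by (intro generate_ring.eng_mult generate_ring.eng_add generate_ring.one generate_ring.incl) auto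
qed

text \<open>The Euler field is \<open>\<Sum>\<^sub>i x\<^sub>i T\<^sub>i - \<Sum>\<^sub>\<alpha> k\<^sub>\<alpha> (1 - r\<^sub>\<alpha>)\<close>, because \<open>\<Sum>\<^sub>i x\<^sub>i \<langle>\<alpha>, e\<^sub>i\<rangle> = \<alpha>\<close>
  cancels the denominator of the divided difference.\<close>

lemma euler_plus_reflection_sum: "euler_op \<oplus>\<^bsub>end_ring\<^esub> reflection_sum = dunkl_sum"
proof (rule end_eqI)
  show "dunkl_sum \<in> carrier end_ring" using dunkl_sum_H H_subset by blast
  show "euler_op \<oplus>\<^bsub>end_ring\<^esub> reflection_sum \<in> carrier end_ring"
    using reflection_sum_group_algebra group_algebra_subset_H H_subset
    by (intro end_closed euler_op_closed) blast
  fix f :: "'a \<Rightarrow> complex" assume f: "f \<in> polyfun"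
  show "(euler_op \<oplus>\<^bsub>end_ring\<^esub> reflection_sum) f = dunkl_sum f"
  proof
    fix p
    have Rpf: "reflection_sum f p = (\<Sum>\<alpha>\<in>Rp. k \<alpha> * (f p - f (root_reflection R \<alpha> p)))"
      unfolding reflection_sum_def restrict_apply using f Rp_subset polyfun_add[OF f polyfun_cmult[of _ "-1"]]
      by (auto intro!: sum.cong simp: weyl_op_reflection polyfun_reflection subset_eq simp del: op_apply(3))
    have "dunkl_sum f p = (\<Sum>b\<in>Basis. coord b p * (dir_deriv b f p +
        (\<Sum>\<alpha>\<in>Rp. k \<alpha> * complex_of_real (\<alpha> b) * divided_difference R \<alpha> f p)))"
    proof -
      \<comment> \<open>The second component of \<open>(b, 0)\<close> contributes nothing, so
        \<open>pairing \<alpha> (b, 0)\<close> is the real number \<open>\<alpha> b\<close>.\<close>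
      have zero: "\<alpha> 0 = 0" if "\<alpha> \<in> Rp" for \<alpha>
        using that Rp_subset root_linear[OF root_system] linear_0 by blast
      have "T (b, 0) f p = dir_deriv b f p +
          (\<Sum>\<alpha>\<in>Rp. k \<alpha> * complex_of_real (\<alpha> b) * divided_difference R \<alpha> f p)" for b
        using f linear_0[OF linear_dir_deriv[OF f]]
        by (auto simp: dunkl_apply deriv_along_dir_deriv pairing_def complex_of_real_def zero intro!: sum.cong)
      moreover have "dunkl_sum f p = (\<Sum>b\<in>Basis. coord b p * T (b, 0) f p)"
        using f end_carrierD(1)[OF dunkl_closed f] by (simp add: dunkl_sum_def)
      ultimately show ?thesis by simp
    qed
    also have "\<dots> = (\<Sum>b\<in>Basis. of_real (p \<bullet> b) * dir_deriv b f p) +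
        (\<Sum>b\<in>Basis. \<Sum>\<alpha>\<in>Rp. k \<alpha> * divided_difference R \<alpha> f p * complex_of_real ((p \<bullet> b) * \<alpha> b))"
      unfolding sum.distrib[symmetric]
      by (intro sum.cong refl) (simp add: coord_def distrib_left sum_distrib_left mult_ac)
    also have "(\<Sum>b\<in>Basis. \<Sum>\<alpha>\<in>Rp. k \<alpha> * divided_difference R \<alpha> f p * complex_of_real ((p \<bullet> b) * \<alpha> b)) =
        (\<Sum>\<alpha>\<in>Rp. \<Sum>b\<in>Basis. k \<alpha> * divided_difference R \<alpha> f p * complex_of_real ((p \<bullet> b) * \<alpha> b))"
      by (rule sum.swap)
    also have "\<dots> = (\<Sum>\<alpha>\<in>Rp. k \<alpha> * (f p - f (root_reflection R \<alpha> p)))"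
    proof (rule sum.cong[OF refl])
      fix \<alpha> assume "\<alpha> \<in> Rp"
      then have \<alpha>: "\<alpha> \<in> R" using Rp_subset by auto
      have "\<alpha> p = \<alpha> (\<Sum>b\<in>Basis. (p \<bullet> b) *\<^sub>R b)" by (simp add: euclidean_representation)
      also have "\<dots> = (\<Sum>b\<in>Basis. (p \<bullet> b) * \<alpha> b)"
        using root_linear[OF root_system \<alpha>] by (simp add: linear_sum linear_scale)
      finally have "(\<Sum>b\<in>Basis. complex_of_real ((p \<bullet> b) * \<alpha> b)) = complex_of_real (\<alpha> p)" by simp
      then show "(\<Sum>b\<in>Basis. k \<alpha> * divided_difference R \<alpha> f p * complex_of_real ((p \<bullet> b) * \<alpha> b)) =
          k \<alpha> * (f p - f (root_reflection R \<alpha> p))"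
        unfolding sum_distrib_left[symmetric] using divided_difference(2)[OF \<alpha> f, of p] by (simp add: mult_ac)
    qed
    finally show "(euler_op \<oplus>\<^bsub>end_ring\<^esub> reflection_sum) f p = dunkl_sum f p"
      using f by (simp add: Rpf euler_eq_sum_Basis)
  qed
qed

lemma euler_op_H: "euler_op \<in> carrier H"
proof -
  have r: "reflection_sum \<in> carrier H" using reflection_sum_group_algebra group_algebra_subset_H by blast
  then have rc: "reflection_sum \<in> carrier end_ring" using H_subset by blast
  have "euler_op = dunkl_sum \<oplus>\<^bsub>end_ring\<^esub> (\<ominus>\<^bsub>end_ring\<^esub> reflection_sum)"
    unfolding euler_plus_reflection_sum[symmetric]
    by (simp only: E.a_assoc[OF euler_op_closed rc E.a_inv_closed[OF rc]] E.r_neg[OF rc]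
        E.r_zero[OF euler_op_closed])
  then show ?thesis using subringE(5,7)[OF subring_H] r dunkl_sum_H by metis
qed

end


section \<open>Left modules and quotients\<close>

context left_module
begin

lemma smult_r_zero: "a \<in> carrier A \<Longrightarrow> a \<odot>\<^bsub>M\<^esub> \<zero>\<^bsub>M\<^esub> = \<zero>\<^bsub>M\<^esub>"
  using smult_r_distr[of a "\<zero>\<^bsub>M\<^esub>" "\<zero>\<^bsub>M\<^esub>"] smult_closed[of a "\<zero>\<^bsub>M\<^esub>"]
  by (metis M.add.l_cancel_one M.r_zero M.zero_closed)

lemma smult_l_zero: "x \<in> carrier M \<Longrightarrow> \<zero>\<^bsub>A\<^esub> \<odot>\<^bsub>M\<^esub> x = \<zero>\<^bsub>M\<^esub>"
  using smult_l_distr[of "\<zero>\<^bsub>A\<^esub>" "\<zero>\<^bsub>A\<^esub>" x] smult_closed[of "\<zero>\<^bsub>A\<^esub>" x]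
  by (metis M.add.l_cancel_one A.r_zero A.zero_closed)

lemma smult_l_minus: "a \<in> carrier A \<Longrightarrow> x \<in> carrier M \<Longrightarrow> (\<ominus>\<^bsub>A\<^esub> a) \<odot>\<^bsub>M\<^esub> x = \<ominus>\<^bsub>M\<^esub> (a \<odot>\<^bsub>M\<^esub> x)"
  using smult_l_distr[of "\<ominus>\<^bsub>A\<^esub> a" a x] smult_closed[of a x] smult_closed[of "\<ominus>\<^bsub>A\<^esub> a" x]
  by (metis A.a_inv_closed A.l_neg M.minus_equality smult_l_zero)

lemma smult_r_minus: "a \<in> carrier A \<Longrightarrow> x \<in> carrier M \<Longrightarrow> a \<odot>\<^bsub>M\<^esub> (\<ominus>\<^bsub>M\<^esub> x) = \<ominus>\<^bsub>M\<^esub> (a \<odot>\<^bsub>M\<^esub> x)"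
  using smult_r_distr[of a "\<ominus>\<^bsub>M\<^esub> x" x] smult_closed[of a x] smult_closed[of a "\<ominus>\<^bsub>M\<^esub> x"]
  by (metis M.a_inv_closed M.l_neg M.minus_equality smult_r_zero)

text \<open>\<open>submodule\<close> also asks for closure under negatives; that comes from acting
  by minus the unit of the ring.\<close>

lemma submodule_intro:
  assumes "N \<subseteq> carrier M" "\<zero>\<^bsub>M\<^esub> \<in> N"
    and "\<And>x y. x \<in> N \<Longrightarrow> y \<in> N \<Longrightarrow> x \<oplus>\<^bsub>M\<^esub> y \<in> N"
    and "\<And>a x. a \<in> carrier A \<Longrightarrow> x \<in> N \<Longrightarrow> a \<odot>\<^bsub>M\<^esub> x \<in> N"
  shows "Module.submodule N A M"
proof (unfold_locales)
  fix x assume "x \<in> N"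
  then have "(\<ominus>\<^bsub>A\<^esub> \<one>\<^bsub>A\<^esub>) \<odot>\<^bsub>M\<^esub> x \<in> N" using assms(4) by blast
  moreover have "(\<ominus>\<^bsub>A\<^esub> \<one>\<^bsub>A\<^esub>) \<odot>\<^bsub>M\<^esub> x = \<ominus>\<^bsub>M\<^esub> x"
    using \<open>x \<in> N\<close> assms(1) by (subst smult_l_minus) (auto simp: smult_one)
  ultimately show "inv\<^bsub>add_monoid M\<^esub> x \<in> N" by (simp add: a_inv_def)
qed (use assms in auto)

end

lemma submoduleD:
  assumes "Module.submodule N A M"
  shows "N \<subseteq> carrier M" "\<zero>\<^bsub>M\<^esub> \<in> N"
    "\<And>x y. x \<in> N \<Longrightarrow> y \<in> N \<Longrightarrow> x \<oplus>\<^bsub>M\<^esub> y \<in> N" "\<And>x. x \<in> N \<Longrightarrow> \<ominus>\<^bsub>M\<^esub> x \<in> N"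
    "\<And>a x. a \<in> carrier A \<Longrightarrow> x \<in> N \<Longrightarrow> a \<odot>\<^bsub>M\<^esub> x \<in> N"
proof -
  interpret Module.submodule N A M by fact
  show "N \<subseteq> carrier M" using subset by simp
  show "\<zero>\<^bsub>M\<^esub> \<in> N" using one_closed by simp
  show "\<And>x y. x \<in> N \<Longrightarrow> y \<in> N \<Longrightarrow> x \<oplus>\<^bsub>M\<^esub> y \<in> N" using m_closed by simp
  show "\<And>x. x \<in> N \<Longrightarrow> \<ominus>\<^bsub>M\<^esub> x \<in> N" using m_inv_closed by (simp add: a_inv_def)
  show "\<And>a x. a \<in> carrier A \<Longrightarrow> x \<in> N \<Longrightarrow> a \<odot>\<^bsub>M\<^esub> x \<in> N" by (rule smult_closed)
qed

text \<open>The negative is defined by a description over the carrier, so shrinking the carrier to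
  \<open>K\<close> might change it; it does not, because \<open>K\<close> is an additive
  subgroup.\<close>

lemma (in ring) subring_a_inv:
  assumes "subring K R" "a \<in> K" shows "\<ominus>\<^bsub>R\<lparr>carrier := K\<rparr>\<^esub> a = \<ominus> a"
proof -
  have "subgroup K (add_monoid R)" using assms(1) by (simp add: subring_def)
  then show ?thesis
    using group.m_inv_consistent[OF add.is_group, of K a] assms(2) by (simp add: a_inv_def)
qed

text \<open>Closure of \<open>X\<close> under addition and negation lets stability under
  \<open>G\<close> spread to the generated ring. Membership in \<open>K\<close> is carried through
  the induction because the module axioms hold only there.\<close>

lemma (in ring) generate_ring_preserves:
  assumes "subring K R" "left_module (R\<lparr>carrier := K\<rparr>) M" "G \<subseteq> K"
    and X: "X \<subseteq> carrier M" "\<And>x y. x \<in> X \<Longrightarrow> y \<in> X \<Longrightarrow> x \<oplus>\<^bsub>M\<^esub> y \<in> X"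
      "\<And>x. x \<in> X \<Longrightarrow> \<ominus>\<^bsub>M\<^esub> x \<in> X"
    and G: "\<And>g x. g \<in> G \<Longrightarrow> x \<in> X \<Longrightarrow> g \<odot>\<^bsub>M\<^esub> x \<in> X"
    and "a \<in> generate_ring R G" "x \<in> X"
  shows "a \<odot>\<^bsub>M\<^esub> x \<in> X"
proof -
  interpret L: left_module "R\<lparr>carrier := K\<rparr>" M by fact
  have "a \<in> K \<and> (\<forall>x\<in>X. a \<odot>\<^bsub>M\<^esub> x \<in> X)"
    using assms(8)
  proof induction
    case one
    then show ?case using L.smult_one X(1) subringE(3)[OF assms(1)] by auto
  next
    case (incl h)
    then show ?case using assms(3) G by auto
  next
    case (a_inv h)
    then have "\<ominus> h \<in> K" using subringE(5)[OF assms(1)] by blast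
    moreover have "(\<ominus> h) \<odot>\<^bsub>M\<^esub> x \<in> X" if "x \<in> X" for x
      using L.smult_l_minus[of h x] subring_a_inv[OF assms(1), of h] a_inv that X by auto
    ultimately show ?case by blast
  next
    case (eng_add h1 h2)
    then have "h1 \<oplus> h2 \<in> K" using subringE(7)[OF assms(1)] by blast
    moreover have "(h1 \<oplus> h2) \<odot>\<^bsub>M\<^esub> x \<in> X" if "x \<in> X" for x
      using L.smult_l_distr[of h1 h2 x] eng_add that X by auto
    ultimately show ?case by blast
  next
    case (eng_mult h1 h2)
    then have "h1 \<otimes> h2 \<in> K" using subringE(6)[OF assms(1)] by blast
    moreover have "(h1 \<otimes> h2) \<odot>\<^bsub>M\<^esub> x \<in> X" if "x \<in> X" for x
      using L.smult_assoc[of h1 h2 x] eng_mult that X by auto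
    ultimately show ?case by blast
  qed
  then show ?thesis using assms(9) by blast
qed

text \<open>Quotients occur twice: a module by a submodule, and the free group on pairs by the
  tensor relations, which becomes a module only after division. What both share is an additive
  action that stabilises a subgroup.\<close>

locale additive_action = abelian_group F for F :: "('r, 'm, 'z) module_scheme" (structure) +
  fixes C :: "'r set" and N :: "'m set"
  assumes N_subgroup: "subgroup N (add_monoid F)"
    and act_closed: "a \<in> C \<Longrightarrow> x \<in> carrier F \<Longrightarrow> a \<odot>\<^bsub>F\<^esub> x \<in> carrier F"
    and act_add: "a \<in> C \<Longrightarrow> x \<in> carrier F \<Longrightarrow> y \<in> carrier F \<Longrightarrow> a \<odot>\<^bsub>F\<^esub> (x \<oplus> y) = a \<odot>\<^bsub>F\<^esub> x \<oplus> a \<odot>\<^bsub>F\<^esub> y"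
    and act_N: "a \<in> C \<Longrightarrow> x \<in> N \<Longrightarrow> a \<odot>\<^bsub>F\<^esub> x \<in> N"
begin

sublocale quot: abelian_subgroup N F
  using N_subgroup by (intro abelian_subgroupI3 additive_subgroupI abelian_group_axioms)

lemma coset_eq_iff:
  assumes "x \<in> carrier F" "y \<in> carrier F"
  shows "N +> x = N +> y \<longleftrightarrow> x \<ominus> y \<in> N"
  using assms quot.a_rcos_module[of y x] quot.a_repr_independence' quot.a_rcos_self
  by (metis a_minus_def)

lemma coset_add: "x \<in> carrier F \<Longrightarrow> y \<in> carrier F \<Longrightarrow> (N +> x) <+>\<^bsub>F\<^esub> (N +> y) = N +> (x \<oplus> y)"
  by (rule quot.a_rcos_sum)

lemma cosets_iff: "X \<in> a_rcosets N \<longleftrightarrow> (\<exists>x\<in>carrier F. X = N +> x)"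
  by (auto simp: A_RCOSETS_def')

text \<open>The action on cosets is a union over representatives; each of them gives the same coset
  because the action preserves \<open>N\<close>, so the union collapses.\<close>

lemma coset_act:
  assumes "a \<in> C" "x \<in> carrier F"
  shows "(\<Union>y\<in>N +> x. N +> (a \<odot>\<^bsub>F\<^esub> y)) = N +> (a \<odot>\<^bsub>F\<^esub> x)"
proof -
  have "N +> (a \<odot>\<^bsub>F\<^esub> y) = N +> (a \<odot>\<^bsub>F\<^esub> x)" if "y \<in> N +> x" for y
  proof -
    from that obtain n where n: "n \<in> N" "y = n \<oplus> x" by (auto simp: a_r_coset_def')
    have nc: "n \<in> carrier F" using n(1) quot.a_subset by auto
    have "a \<odot>\<^bsub>F\<^esub> y = a \<odot>\<^bsub>F\<^esub> n \<oplus> a \<odot>\<^bsub>F\<^esub> x" using act_add assms nc n(2) by simp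
    then have "a \<odot>\<^bsub>F\<^esub> y \<in> N +> (a \<odot>\<^bsub>F\<^esub> x)" using act_N[OF assms(1) n(1)] by (auto simp: a_r_coset_def')
    then show ?thesis using quot.a_repr_independence' act_closed[OF assms] by metis
  qed
  moreover have "x \<in> N +> x" using quot.a_rcos_self assms(2) by blast
  ultimately show ?thesis by blast
qed

lemma coset_zero: "N +> \<zero> = N"
  using a_coset_add_zero quot.a_subset by blast

lemma abelian_group_cosets:
  assumes "carrier Q = a_rcosets N" "\<zero>\<^bsub>Q\<^esub> = N" "ring.add Q = set_add F"
  shows "abelian_group Q"
proof (rule abelian_groupI)
  show "\<zero>\<^bsub>Q\<^esub> \<in> carrier Q" using coset_zero by (auto simp: assms cosets_iff)
  fix X assume X: "X \<in> carrier Q"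
  then obtain x where x: "x \<in> carrier F" "X = N +> x" by (auto simp: assms cosets_iff)
  show "\<zero>\<^bsub>Q\<^esub> \<oplus>\<^bsub>Q\<^esub> X = X" using coset_add[of \<zero> x] x by (simp add: assms coset_zero)
  show "\<exists>Y\<in>carrier Q. Y \<oplus>\<^bsub>Q\<^esub> X = \<zero>\<^bsub>Q\<^esub>"
    using coset_add[of "\<ominus> x" x] x by (intro bexI[of _ "N +> (\<ominus> x)"]) (auto simp: assms coset_zero cosets_iff l_neg)
  fix Y assume Y: "Y \<in> carrier Q"
  then obtain y where y: "y \<in> carrier F" "Y = N +> y" by (auto simp: assms cosets_iff)
  show "X \<oplus>\<^bsub>Q\<^esub> Y \<in> carrier Q" using x y by (auto simp: assms coset_add cosets_iff)
  show "X \<oplus>\<^bsub>Q\<^esub> Y = Y \<oplus>\<^bsub>Q\<^esub> X" using x y by (simp add: assms coset_add a_comm)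
  fix Z assume Z: "Z \<in> carrier Q"
  then obtain z where z: "z \<in> carrier F" "Z = N +> z" by (auto simp: assms cosets_iff)
  show "X \<oplus>\<^bsub>Q\<^esub> Y \<oplus>\<^bsub>Q\<^esub> Z = X \<oplus>\<^bsub>Q\<^esub> (Y \<oplus>\<^bsub>Q\<^esub> Z)"
    using x y z by (simp add: assms coset_add a_assoc)
qed

end

context left_module
begin

lemma additive_action_submodule: "Module.submodule N A M \<Longrightarrow> additive_action M (carrier A) N"
  by (intro additive_action.intro additive_action_axioms.intro M.abelian_group_axioms)
     (auto simp: Module.submodule_def smult_closed smult_r_distr Module.submodule_axioms_def)

end

text \<open>The first isomorphism theorem, with the map going from \<open>V\<close> to the quotient
  through chosen preimages, the direction in which the final claim is stated. Cosets of
  \<open>K\<close> coincide exactly when the images do, so the choice is immaterial.\<close>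

lemma module_isomorphic_quotient:
  fixes A :: "'r ring" and M :: "('r, 'm) module"
  assumes M: "left_module A M" and V: "left_module A V"
    and hom: "\<And>x. x \<in> carrier M \<Longrightarrow> h x \<in> carrier V"
      "\<And>x y. x \<in> carrier M \<Longrightarrow> y \<in> carrier M \<Longrightarrow> h (x \<oplus>\<^bsub>M\<^esub> y) = h x \<oplus>\<^bsub>V\<^esub> h y"
      "\<And>a x. a \<in> carrier A \<Longrightarrow> x \<in> carrier M \<Longrightarrow> h (a \<odot>\<^bsub>M\<^esub> x) = a \<odot>\<^bsub>V\<^esub> h x"
    and surj: "h ` carrier M = carrier V"
    and K: "Module.submodule K A M" "K = {x \<in> carrier M. h x = \<zero>\<^bsub>V\<^esub>}"
  shows "module_isomorphic A V (quotient_module M K)"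
proof -
  interpret left_module A M by fact
  interpret V: left_module A V by fact
  interpret Q: additive_action M "carrier A" K by (rule additive_action_submodule[OF K(1)])
  define g where "g v = (SOME x. x \<in> carrier M \<and> h x = v)" for v
  have g: "g v \<in> carrier M" "h (g v) = v" if "v \<in> carrier V" for v
  proof -
    have "\<exists>x. x \<in> carrier M \<and> h x = v" using that by (metis imageE surj)
    from someI_ex[OF this] show "g v \<in> carrier M" "h (g v) = v" unfolding g_def by auto
  qed
  have K_iff: "z \<in> K \<longleftrightarrow> z \<in> carrier M \<and> h z = \<zero>\<^bsub>V\<^esub>" for z
    by (subst K(2)) (rule mem_Collect_eq)
  have hz: "h \<zero>\<^bsub>M\<^esub> = \<zero>\<^bsub>V\<^esub>" using submoduleD(2)[OF K(1)] K_iff by metis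
  have hm: "h (\<ominus>\<^bsub>M\<^esub> x) = \<ominus>\<^bsub>V\<^esub> h x" if "x \<in> carrier M" for x
    using hom(2)[of "\<ominus>\<^bsub>M\<^esub> x" x] hom(1) that hz by (metis M.a_inv_closed M.l_neg V.minus_equality)
  have eq: "K +>\<^bsub>M\<^esub> x = K +>\<^bsub>M\<^esub> y \<longleftrightarrow> h x = h y" if "x \<in> carrier M" "y \<in> carrier M" for x y
  proof -
    have "h (x \<ominus>\<^bsub>M\<^esub> y) = h x \<ominus>\<^bsub>V\<^esub> h y" using that by (simp add: a_minus_def hom(2) hm)
    moreover have "x \<ominus>\<^bsub>M\<^esub> y \<in> carrier M" using that by simp
    ultimately have "x \<ominus>\<^bsub>M\<^esub> y \<in> K \<longleftrightarrow> h x \<ominus>\<^bsub>V\<^esub> h y = \<zero>\<^bsub>V\<^esub>" using K_iff by metis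
    also have "\<dots> \<longleftrightarrow> h x = h y" using hom(1)[OF that(1)] hom(1)[OF that(2)] unfolding a_minus_def
      by (metis V.M.add.inv_closed V.M.add.inv_comm V.M.add.inv_equality V.M.add.inv_inv V.M.add.r_inv a_inv_def)
    finally show ?thesis unfolding Q.coset_eq_iff[OF that] .
  qed
  show ?thesis unfolding module_isomorphic_def
  proof (intro exI[of _ "\<lambda>v. K +>\<^bsub>M\<^esub> g v"] conjI ballI)
    show "bij_betw (\<lambda>v. K +>\<^bsub>M\<^esub> g v) (carrier V) (carrier (quotient_module M K))"
      unfolding bij_betw_def
    proof
      show "inj_on (\<lambda>v. K +>\<^bsub>M\<^esub> g v) (carrier V)" using eq g by (auto intro!: inj_onI)
      have "K +>\<^bsub>M\<^esub> x \<in> (\<lambda>v. K +>\<^bsub>M\<^esub> g v) ` carrier V" if "x \<in> carrier M" for x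
        using eq[of x "g (h x)"] g[of "h x"] hom(1) that by (intro image_eqI[of _ _ "h x"]) auto
      then show "(\<lambda>v. K +>\<^bsub>M\<^esub> g v) ` carrier V = carrier (quotient_module M K)"
        using g(1) by (auto simp: quotient_module_def Q.cosets_iff intro!: bexI)
    qed
  next
    fix v w assume "v \<in> carrier V" "w \<in> carrier V"
    then show "K +>\<^bsub>M\<^esub> g (v \<oplus>\<^bsub>V\<^esub> w) = (K +>\<^bsub>M\<^esub> g v) \<oplus>\<^bsub>quotient_module M K\<^esub> (K +>\<^bsub>M\<^esub> g w)"
      using g by (simp add: quotient_module_def Q.coset_add eq hom)
  next
    fix a v assume "a \<in> carrier A" "v \<in> carrier V"
    then show "K +>\<^bsub>M\<^esub> g (a \<odot>\<^bsub>V\<^esub> v) = a \<odot>\<^bsub>quotient_module M K\<^esub> (K +>\<^bsub>M\<^esub> g v)"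
      using g by (simp add: quotient_module_def Q.coset_act eq hom smult_closed V.smult_closed)
  qed
qed


section \<open>Induced modules\<close>

text \<open>The closure conditions on \<open>U\<close> keep the tensor relations inside the free
  group on the pairs; \<open>t u\<close> will be the class of 1 \<otimes> u.\<close>

locale induced = A: ring A for A :: "'r ring" +
  fixes B :: "'r ring" and U :: "('r, 'u) module"
  assumes B_subset: "carrier B \<subseteq> carrier A"
    and U_add: "u \<in> carrier U \<Longrightarrow> u' \<in> carrier U \<Longrightarrow> u \<oplus>\<^bsub>U\<^esub> u' \<in> carrier U"
    and U_smult: "b \<in> carrier B \<Longrightarrow> u \<in> carrier U \<Longrightarrow> b \<odot>\<^bsub>U\<^esub> u \<in> carrier U"
begin

abbreviation "F \<equiv> free_pairs A U"
abbreviation "S \<equiv> carrier A \<times> carrier U"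
definition "N = generate (add_monoid F) (tensor_relations A B U)"
abbreviation "M \<equiv> induced_module A B U"
definition "t u = N +>\<^bsub>F\<^esub> frag_of (\<one>\<^bsub>A\<^esub>, u)"

section \<open>The free group on pairs and the tensor relations\<close>

lemma F_simps [simp]: "ring.zero F = 0" "ring.add F = (+)"
  by (simp_all add: free_pairs_def)

lemma F_carrier: "x \<in> carrier F \<longleftrightarrow> Poly_Mapping.keys x \<subseteq> S"
  by (simp add: free_pairs_def)

lemma F_closed [simp]:
  "0 \<in> carrier F"
  "x \<in> carrier F \<Longrightarrow> y \<in> carrier F \<Longrightarrow> x + y \<in> carrier F"
  "x \<in> carrier F \<Longrightarrow> - x \<in> carrier F"
  "x \<in> carrier F \<Longrightarrow> y \<in> carrier F \<Longrightarrow> x - y \<in> carrier F"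
  "frag_of p \<in> carrier F \<longleftrightarrow> p \<in> S"
  unfolding F_carrier using keys_add[of x y] keys_diff[of x y] by (simp_all, blast+)

lemma F_induct [consumes 1, case_names zero diff of]:
  assumes "x \<in> carrier F" "P 0"
    "\<And>x y. x \<in> carrier F \<Longrightarrow> y \<in> carrier F \<Longrightarrow> P x \<Longrightarrow> P y \<Longrightarrow> P (x - y)"
    "\<And>h u. h \<in> carrier A \<Longrightarrow> u \<in> carrier U \<Longrightarrow> P (frag_of (h, u))"
  shows "P x"
  using assms(1)[unfolded F_carrier]
  by (rule free_Abelian_group_induct) (use assms(2-) in \<open>auto simp: F_carrier\<close>)

lemma abelian_group_F: "abelian_group F"
  by (rule abelian_groupI) (auto intro: bexI[of _ "- x" for x])

lemma F_minus: "x \<in> carrier F \<Longrightarrow> \<ominus>\<^bsub>F\<^esub> x = - x"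
  using abelian_group.minus_equality[OF abelian_group_F, of "- x" x] by simp

lemma F_inv: "x \<in> carrier F \<Longrightarrow> inv\<^bsub>add_monoid F\<^esub> x = - x"
  using F_minus by (simp only: a_inv_def)

lemma F_act_of: "a \<odot>\<^bsub>F\<^esub> frag_of (h, u) = frag_of (a \<otimes>\<^bsub>A\<^esub> h, u)"
  by (simp add: free_pairs_def)

lemma F_act_0: "a \<odot>\<^bsub>F\<^esub> 0 = 0"
  and F_act_add: "a \<odot>\<^bsub>F\<^esub> (x + y) = a \<odot>\<^bsub>F\<^esub> x + a \<odot>\<^bsub>F\<^esub> y"
  and F_act_minus: "a \<odot>\<^bsub>F\<^esub> (- x) = - (a \<odot>\<^bsub>F\<^esub> x)"
  and F_act_diff: "a \<odot>\<^bsub>F\<^esub> (x - y) = a \<odot>\<^bsub>F\<^esub> x - a \<odot>\<^bsub>F\<^esub> y"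
  by (simp_all add: free_pairs_def frag_extend_add frag_extend_minus frag_extend_diff)

lemma F_act_closed:
  assumes "a \<in> carrier A" "x \<in> carrier F" shows "a \<odot>\<^bsub>F\<^esub> x \<in> carrier F"
  using assms(2) by (induction rule: F_induct) (auto simp: F_act_0 F_act_diff F_act_of assms(1))

lemma tensor_relations_cases:
  assumes "x \<in> tensor_relations A B U"
  obtains (distrib_left) h h' u where "x = frag_of (h \<oplus>\<^bsub>A\<^esub> h', u) - frag_of (h, u) - frag_of (h', u)"
      "h \<in> carrier A" "h' \<in> carrier A" "u \<in> carrier U"
    | (distrib_right) h u u' where "x = frag_of (h, u \<oplus>\<^bsub>U\<^esub> u') - frag_of (h, u) - frag_of (h, u')"
      "h \<in> carrier A" "u \<in> carrier U" "u' \<in> carrier U"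
    | (balance) h b u where "x = frag_of (h \<otimes>\<^bsub>A\<^esub> b, u) - frag_of (h, b \<odot>\<^bsub>U\<^esub> u)"
      "h \<in> carrier A" "b \<in> carrier B" "u \<in> carrier U"
  using assms unfolding tensor_relations_def by blast

lemma tensor_relations_intros:
  "h \<in> carrier A \<Longrightarrow> h' \<in> carrier A \<Longrightarrow> u \<in> carrier U \<Longrightarrow>
     frag_of (h \<oplus>\<^bsub>A\<^esub> h', u) - frag_of (h, u) - frag_of (h', u) \<in> tensor_relations A B U"
  "h \<in> carrier A \<Longrightarrow> u \<in> carrier U \<Longrightarrow> u' \<in> carrier U \<Longrightarrow>
     frag_of (h, u \<oplus>\<^bsub>U\<^esub> u') - frag_of (h, u) - frag_of (h, u') \<in> tensor_relations A B U"
  "h \<in> carrier A \<Longrightarrow> b \<in> carrier B \<Longrightarrow> u \<in> carrier U \<Longrightarrow>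
     frag_of (h \<otimes>\<^bsub>A\<^esub> b, u) - frag_of (h, b \<odot>\<^bsub>U\<^esub> u) \<in> tensor_relations A B U"
  unfolding tensor_relations_def by blast+

lemma relations_closed: "tensor_relations A B U \<subseteq> carrier F"
proof
  fix x assume "x \<in> tensor_relations A B U"
  then show "x \<in> carrier F"
    by (cases rule: tensor_relations_cases) (use B_subset in \<open>auto simp: U_smult U_add\<close>)
qed

lemma relations_act:
  assumes "a \<in> carrier A" "x \<in> tensor_relations A B U" shows "a \<odot>\<^bsub>F\<^esub> x \<in> tensor_relations A B U"
  using assms(2)
proof (cases rule: tensor_relations_cases)
  case (distrib_left h h' u)
  then show ?thesis using assms(1) tensor_relations_intros(1)[of "a \<otimes>\<^bsub>A\<^esub> h" "a \<otimes>\<^bsub>A\<^esub> h'" u]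
    by (simp add: F_act_diff F_act_of A.r_distr)
next
  case (distrib_right h u u')
  then show ?thesis using assms(1) tensor_relations_intros(2)[of "a \<otimes>\<^bsub>A\<^esub> h" u u']
    by (simp add: F_act_diff F_act_of)
next
  case (balance h b u)
  then have "b \<in> carrier A" using B_subset by auto
  with balance show ?thesis using assms(1) tensor_relations_intros(3)[of "a \<otimes>\<^bsub>A\<^esub> h" b u]
    by (simp add: F_act_diff F_act_of A.m_assoc)
qed

lemma N_subgroup: "subgroup N (add_monoid F)"
  unfolding N_def using relations_closed
  by (intro group.generate_is_subgroup abelian_group.a_group abelian_group_F) auto

text \<open>Left multiplication turns each defining relation into another one of the same kind, so
  the generated subgroup is stable.\<close>

lemma N_act:
  assumes "a \<in> carrier A" "x \<in> N" shows "a \<odot>\<^bsub>F\<^esub> x \<in> N"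
  using assms(2) unfolding N_def
proof induction
  case one
  then show ?case using generate.one[of "add_monoid F"] by (simp add: F_act_0)
next
  case (incl h)
  then show ?case using relations_act[OF assms(1)] by (intro generate.incl)
next
  case (inv h)
  have k: "h \<in> carrier F" "a \<odot>\<^bsub>F\<^esub> h \<in> carrier F"
    using inv relations_closed relations_act[OF assms(1)] by blast+
  have "inv\<^bsub>add_monoid F\<^esub> (a \<odot>\<^bsub>F\<^esub> h) \<in> generate (add_monoid F) (tensor_relations A B U)"
    using inv relations_act[OF assms(1)] by (intro generate.inv)
  then show ?case by (simp only: F_inv[OF k(1)] F_inv[OF k(2)] F_act_minus)
next
  case (eng h1 h2)
  then show ?case using generate.eng by (fastforce simp: F_act_add)
qed

sublocale F: additive_action F "carrier A" N
  by (intro additive_action.intro additive_action_axioms.intro abelian_group_F N_subgroup)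
     (simp_all add: F_act_closed F_act_add N_act)

lemma M_simps: "carrier M = a_rcosets\<^bsub>F\<^esub> N" "ring.zero M = N" "ring.add M = set_add F"
    "a \<odot>\<^bsub>M\<^esub> X = (\<Union>x\<in>X. N +>\<^bsub>F\<^esub> (a \<odot>\<^bsub>F\<^esub> x))"
  by (simp_all add: induced_module_def quotient_module_def N_def)

lemma M_carrier: "X \<in> carrier M \<longleftrightarrow> (\<exists>x\<in>carrier F. X = N +>\<^bsub>F\<^esub> x)"
  by (simp only: M_simps F.cosets_iff)

lemma M_add: "x \<in> carrier F \<Longrightarrow> y \<in> carrier F \<Longrightarrow> (N +>\<^bsub>F\<^esub> x) \<oplus>\<^bsub>M\<^esub> (N +>\<^bsub>F\<^esub> y) = N +>\<^bsub>F\<^esub> (x + y)"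
  using F.coset_add by (simp only: M_simps F_simps)

lemma M_act: "a \<in> carrier A \<Longrightarrow> x \<in> carrier F \<Longrightarrow> a \<odot>\<^bsub>M\<^esub> (N +>\<^bsub>F\<^esub> x) = N +>\<^bsub>F\<^esub> (a \<odot>\<^bsub>F\<^esub> x)"
  using F.coset_act by (simp only: M_simps)

lemma coset_eqI: "x \<in> carrier F \<Longrightarrow> y \<in> carrier F \<Longrightarrow> x - y \<in> N \<Longrightarrow> N +>\<^bsub>F\<^esub> x = N +>\<^bsub>F\<^esub> y"
  using F.coset_eq_iff[of x y] by (simp add: a_minus_def F_minus)

lemma relation_in_N: "x \<in> tensor_relations A B U \<Longrightarrow> x \<in> N"
  unfolding N_def by (rule generate.incl)

lemma N_diff: "x \<in> N \<Longrightarrow> y \<in> N \<Longrightarrow> x - y \<in> N"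
  using F.quot.a_subset F.quot.a_closed F.quot.a_inv_closed F_minus
  by (metis F_simps(2) F.quot.a_Hcarr diff_conv_add_uminus)

text \<open>Additivity in the ring variable is the axiom that generally fails in the free group,
  where a pair with first entry \<open>a \<oplus> b\<close> is a new generator. It holds modulo
  \<open>N\<close> by the first family of relations; the remaining laws of the action already hold
  before dividing.\<close>

lemma left_module_M: "left_module A M"
proof (intro left_module.intro left_module_axioms.intro)
  show "ring A" by (rule A.ring_axioms)
  show "abelian_group M" by (rule F.abelian_group_cosets[OF M_simps(1-3)])
next
  fix a X assume "a \<in> carrier A" "X \<in> carrier M"
  then show "a \<odot>\<^bsub>M\<^esub> X \<in> carrier M"
    unfolding M_carrier using M_act F.act_closed by metis
next
  fix a b X assume ab: "a \<in> carrier A" "b \<in> carrier A" and "X \<in> carrier M"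
  then obtain x where x: "x \<in> carrier F" "X = N +>\<^bsub>F\<^esub> x" unfolding M_carrier by blast
  have "(a \<oplus>\<^bsub>A\<^esub> b) \<odot>\<^bsub>F\<^esub> x - (a \<odot>\<^bsub>F\<^esub> x + b \<odot>\<^bsub>F\<^esub> x) \<in> N"
    using x(1)
  proof (induction rule: F_induct)
    case zero
    then show ?case using F.quot.zero_closed by (simp add: F_act_0)
  next
    case (diff x y)
    from N_diff[OF diff(3,4)] show ?case by (simp add: F_act_diff algebra_simps)
  next
    case (of h u)
    then show ?case using ab relation_in_N[OF tensor_relations_intros(1)[of "a \<otimes>\<^bsub>A\<^esub> h" "b \<otimes>\<^bsub>A\<^esub> h" u]]
      by (simp add: F_act_of diff_diff_eq A.l_distr)
  qed
  moreover have "a \<odot>\<^bsub>F\<^esub> x \<in> carrier F" "b \<odot>\<^bsub>F\<^esub> x \<in> carrier F" "(a \<oplus>\<^bsub>A\<^esub> b) \<odot>\<^bsub>F\<^esub> x \<in> carrier F"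
    using F.act_closed ab x(1) by simp_all
  ultimately have "N +>\<^bsub>F\<^esub> ((a \<oplus>\<^bsub>A\<^esub> b) \<odot>\<^bsub>F\<^esub> x) = N +>\<^bsub>F\<^esub> (a \<odot>\<^bsub>F\<^esub> x + b \<odot>\<^bsub>F\<^esub> x)"
    by (intro coset_eqI) auto
  then show "(a \<oplus>\<^bsub>A\<^esub> b) \<odot>\<^bsub>M\<^esub> X = a \<odot>\<^bsub>M\<^esub> X \<oplus>\<^bsub>M\<^esub> b \<odot>\<^bsub>M\<^esub> X"
    using ab x F.act_closed by (simp only: x M_act M_add A.a_closed)
next
  fix a X Y assume a: "a \<in> carrier A" and "X \<in> carrier M" "Y \<in> carrier M"
  then obtain x y where x: "x \<in> carrier F" "X = N +>\<^bsub>F\<^esub> x" "y \<in> carrier F" "Y = N +>\<^bsub>F\<^esub> y"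
    unfolding M_carrier by blast
  then have "x + y \<in> carrier F" by simp
  then show "a \<odot>\<^bsub>M\<^esub> (X \<oplus>\<^bsub>M\<^esub> Y) = a \<odot>\<^bsub>M\<^esub> X \<oplus>\<^bsub>M\<^esub> a \<odot>\<^bsub>M\<^esub> Y"
    using a x F.act_closed by (simp only: x M_act M_add F_act_add)
next
  fix a b X assume ab: "a \<in> carrier A" "b \<in> carrier A" and "X \<in> carrier M"
  then obtain x where x: "x \<in> carrier F" "X = N +>\<^bsub>F\<^esub> x" unfolding M_carrier by blast
  have "(a \<otimes>\<^bsub>A\<^esub> b) \<odot>\<^bsub>F\<^esub> x = a \<odot>\<^bsub>F\<^esub> (b \<odot>\<^bsub>F\<^esub> x)"
    using x(1)
  proof (induction rule: F_induct)
    case (of h u)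
    then show ?case using ab by (simp add: F_act_of A.m_assoc)
  qed (simp_all add: F_act_0 F_act_diff)
  then show "(a \<otimes>\<^bsub>A\<^esub> b) \<odot>\<^bsub>M\<^esub> X = a \<odot>\<^bsub>M\<^esub> (b \<odot>\<^bsub>M\<^esub> X)"
    using ab x F.act_closed by (simp only: x M_act A.m_closed)
next
  fix X assume "X \<in> carrier M"
  then obtain x where x: "x \<in> carrier F" "X = N +>\<^bsub>F\<^esub> x" unfolding M_carrier by blast
  have "\<one>\<^bsub>A\<^esub> \<odot>\<^bsub>F\<^esub> x = x"
    using x(1)
  proof (induction rule: F_induct)
    case (of h u)
    then show ?case by (simp add: F_act_of)
  qed (simp_all add: F_act_0 F_act_diff)
  then show "\<one>\<^bsub>A\<^esub> \<odot>\<^bsub>M\<^esub> X = X" using x by (simp only: x M_act A.one_closed)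
qed

section \<open>Generation and the universal property of the induced module\<close>

lemma t_closed: "u \<in> carrier U \<Longrightarrow> t u \<in> carrier M"
  unfolding M_carrier t_def by (intro bexI[of _ "frag_of (\<one>\<^bsub>A\<^esub>, u)"]) simp_all

lemma t_add:
  assumes "u \<in> carrier U" "u' \<in> carrier U" shows "t (u \<oplus>\<^bsub>U\<^esub> u') = t u \<oplus>\<^bsub>M\<^esub> t u'"
proof -
  have "frag_of (\<one>\<^bsub>A\<^esub>, u \<oplus>\<^bsub>U\<^esub> u') - (frag_of (\<one>\<^bsub>A\<^esub>, u) + frag_of (\<one>\<^bsub>A\<^esub>, u')) \<in> N"
    using assms tensor_relations_intros(2)[of "\<one>\<^bsub>A\<^esub>" u u'] by (intro relation_in_N) (simp add: diff_diff_eq)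
  moreover have "frag_of (\<one>\<^bsub>A\<^esub>, u) + frag_of (\<one>\<^bsub>A\<^esub>, u') \<in> carrier F"
    using assms by simp
  ultimately have "N +>\<^bsub>F\<^esub> frag_of (\<one>\<^bsub>A\<^esub>, u \<oplus>\<^bsub>U\<^esub> u') = N +>\<^bsub>F\<^esub> (frag_of (\<one>\<^bsub>A\<^esub>, u) + frag_of (\<one>\<^bsub>A\<^esub>, u'))"
    using assms U_add by (intro coset_eqI) auto
  then show ?thesis using assms unfolding t_def by (subst M_add) auto
qed

lemma t_smult:
  assumes "b \<in> carrier B" "u \<in> carrier U" shows "t (b \<odot>\<^bsub>U\<^esub> u) = b \<odot>\<^bsub>M\<^esub> t u"
proof -
  have b: "b \<in> carrier A" using assms B_subset by auto
  have "frag_of (\<one>\<^bsub>A\<^esub> \<otimes>\<^bsub>A\<^esub> b, u) - frag_of (\<one>\<^bsub>A\<^esub>, b \<odot>\<^bsub>U\<^esub> u) \<in> N"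
    using assms by (intro relation_in_N tensor_relations_intros) auto
  then have "N +>\<^bsub>F\<^esub> frag_of (b, u) = N +>\<^bsub>F\<^esub> frag_of (\<one>\<^bsub>A\<^esub>, b \<odot>\<^bsub>U\<^esub> u)"
    using assms U_smult b by (intro coset_eqI) auto
  then show ?thesis using assms b by (simp add: t_def M_act F_act_of)
qed

text \<open>Since h \<otimes> u = h (1 \<otimes> u), a submodule containing all \<open>t u\<close>
  contains the class of each pair.\<close>

lemma M_generated:
  assumes "Module.submodule L A M" "t ` carrier U \<subseteq> L" shows "L = carrier M"
proof
  show "L \<subseteq> carrier M" by (rule submoduleD(1)[OF assms(1)])
  show "carrier M \<subseteq> L"
  proof
    fix X assume "X \<in> carrier M"
    then obtain x where x: "x \<in> carrier F" "X = N +>\<^bsub>F\<^esub> x" unfolding M_carrier by blast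
    interpret M: left_module A M by (rule left_module_M)
    have "N +>\<^bsub>F\<^esub> x \<in> L"
      using x(1)
    proof (induction rule: F_induct)
      case zero
      have "N +>\<^bsub>F\<^esub> 0 = \<zero>\<^bsub>M\<^esub>" using F.coset_zero by (simp add: M_simps)
      then show ?case using submoduleD(2)[OF assms(1)] by simp
    next
      case (diff x y)
      have "(N +>\<^bsub>F\<^esub> y) \<oplus>\<^bsub>M\<^esub> (N +>\<^bsub>F\<^esub> (x - y)) = N +>\<^bsub>F\<^esub> x"
        using diff by (simp add: M_add)
      moreover have "N +>\<^bsub>F\<^esub> y \<in> carrier M" "N +>\<^bsub>F\<^esub> (x - y) \<in> carrier M"
        unfolding M_carrier using diff by auto
      ultimately have "N +>\<^bsub>F\<^esub> (x - y) = \<ominus>\<^bsub>M\<^esub> (N +>\<^bsub>F\<^esub> y) \<oplus>\<^bsub>M\<^esub> (N +>\<^bsub>F\<^esub> x)"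
        by (metis M.M.r_neg1)
      then show ?case using diff submoduleD(3,4)[OF assms(1)] by simp
    next
      case (of h u)
      then have "N +>\<^bsub>F\<^esub> frag_of (h, u) = h \<odot>\<^bsub>M\<^esub> t u" by (simp add: t_def M_act F_act_of)
      then show ?case using of assms(2) submoduleD(5)[OF assms(1)] by auto
    qed
    then show "X \<in> L" using x by simp
  qed
qed

text \<open>The formula h \<otimes> u \<mapsto> h (T u) defines a map on the free group; each family
  of relations dies by the matching property of \<open>T\<close> and of the action, so the map
  factors through \<open>N\<close>.\<close>

lemma M_universal:
  assumes V: "left_module A V"
    and T: "\<And>u. u \<in> carrier U \<Longrightarrow> T u \<in> carrier V"
      "\<And>u u'. u \<in> carrier U \<Longrightarrow> u' \<in> carrier U \<Longrightarrow> T (u \<oplus>\<^bsub>U\<^esub> u') = T u \<oplus>\<^bsub>V\<^esub> T u'"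
      "\<And>b u. b \<in> carrier B \<Longrightarrow> u \<in> carrier U \<Longrightarrow> T (b \<odot>\<^bsub>U\<^esub> u) = b \<odot>\<^bsub>V\<^esub> T u"
  obtains h where "\<And>x. x \<in> carrier M \<Longrightarrow> h x \<in> carrier V"
      "\<And>x y. x \<in> carrier M \<Longrightarrow> y \<in> carrier M \<Longrightarrow> h (x \<oplus>\<^bsub>M\<^esub> y) = h x \<oplus>\<^bsub>V\<^esub> h y"
      "\<And>a x. a \<in> carrier A \<Longrightarrow> x \<in> carrier M \<Longrightarrow> h (a \<odot>\<^bsub>M\<^esub> x) = a \<odot>\<^bsub>V\<^esub> h x"
      "\<And>u. u \<in> carrier U \<Longrightarrow> h (t u) = T u"
proof -
  interpret V: left_module A V by fact
  have "(\<lambda>(h, u). h \<odot>\<^bsub>V\<^esub> T u) ` S \<subseteq> carrier (add_monoid V)"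
    using T(1) V.smult_closed by auto
  from comm_group.free_Abelian_group_universal[OF V.M.a_comm_group this]
  obtain f where f: "f \<in> hom (free_Abelian_group S) (add_monoid V)"
      "\<And>x. x \<in> S \<Longrightarrow> f (frag_of x) = (\<lambda>(h, u). h \<odot>\<^bsub>V\<^esub> T u) x" by blast
  have fc: "f x \<in> carrier V" if "x \<in> carrier F" for x
    using f(1) that by (auto simp: hom_def Pi_def F_carrier)
  have fadd: "f (x + y) = f x \<oplus>\<^bsub>V\<^esub> f y" if "x \<in> carrier F" "y \<in> carrier F" for x y
    using f(1) that by (auto simp: hom_def F_carrier)
  have f0: "f 0 = \<zero>\<^bsub>V\<^esub>" using fadd[of 0 0] fc[of 0] by simp
  have fminus: "f (- x) = \<ominus>\<^bsub>V\<^esub> f x" if "x \<in> carrier F" for x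
    using fadd[of "- x" x] fc that f0 by (simp add: V.M.minus_equality)
  have fdiff: "f (x - y) = f x \<ominus>\<^bsub>V\<^esub> f y" if "x \<in> carrier F" "y \<in> carrier F" for x y
    using fadd[of x "- y"] fminus[of y] that by (simp add: a_minus_def)
  have fof: "f (frag_of (h, u)) = h \<odot>\<^bsub>V\<^esub> T u" if "h \<in> carrier A" "u \<in> carrier U" for h u
    using f(2) that by auto
  have keys2: "frag_of p + frag_of q \<in> carrier F" if "p \<in> S" "q \<in> S" for p q
    using that by simp
  have frel: "f x = \<zero>\<^bsub>V\<^esub>" if "x \<in> tensor_relations A B U" for x
  proof -
    from that show ?thesis
    proof (cases rule: tensor_relations_cases)
      case (distrib_left h h' u)
      then have "f x = f (frag_of (h \<oplus>\<^bsub>A\<^esub> h', u)) \<ominus>\<^bsub>V\<^esub> (f (frag_of (h, u)) \<oplus>\<^bsub>V\<^esub> f (frag_of (h', u)))"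
        using keys2[of "(h, u)" "(h', u)"] by (simp add: diff_diff_eq fdiff fadd)
      with distrib_left show ?thesis
        using T V.smult_closed by (simp add: fof V.smult_l_distr a_minus_def V.M.r_neg)
    next
      case (distrib_right h u u')
      then have "f x = f (frag_of (h, u \<oplus>\<^bsub>U\<^esub> u')) \<ominus>\<^bsub>V\<^esub> (f (frag_of (h, u)) \<oplus>\<^bsub>V\<^esub> f (frag_of (h, u')))"
        using keys2[of "(h, u)" "(h, u')"] by (simp add: diff_diff_eq fdiff fadd U_add)
      with distrib_right show ?thesis
        using T V.smult_closed by (simp add: fof V.smult_r_distr a_minus_def V.M.r_neg U_add)
    next
      case (balance h b u)
      then have "b \<in> carrier A" using B_subset by auto
      with balance show ?thesis
        using T V.smult_closed by (simp add: fof fdiff V.smult_assoc a_minus_def V.M.r_neg U_smult)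
    qed
  qed
  have fN: "x \<in> carrier F \<and> f x = \<zero>\<^bsub>V\<^esub>" if "x \<in> N" for x
    using that unfolding N_def
  proof induction
    case one
    then show ?case by (simp add: f0)
  next
    case (incl h)
    then show ?case using frel relations_closed by blast
  next
    case (inv h)
    then have "h \<in> carrier F" using relations_closed by blast
    with inv show ?case using frel[of h] fminus[of h] unfolding F_inv[OF \<open>h \<in> carrier F\<close>] by simp
  next
    case (eng x y)
    then show ?case by (simp add: fadd)
  qed
  have fact: "f (a \<odot>\<^bsub>F\<^esub> x) = a \<odot>\<^bsub>V\<^esub> f x" if "a \<in> carrier A" "x \<in> carrier F" for a x
    using that(2)
  proof (induction rule: F_induct)
    case zero
    then show ?case using that V.smult_r_zero by (simp add: F_act_0 f0)
  next
    case (diff x y)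
    then show ?case using that F_act_closed fc
      by (simp add: F_act_diff fdiff a_minus_def V.smult_r_distr V.smult_r_minus)
  next
    case (of h u)
    then show ?case using that T(1) by (simp add: F_act_of fof V.smult_assoc)
  qed
  \<comment> \<open>\<open>f\<close> is constant on cosets of \<open>N\<close>, so the image of a
    coset is a singleton and \<open>the_elem\<close> extracts its value.\<close>
  define h where "h X = the_elem (f ` X)" for X
  have h: "h (N +>\<^bsub>F\<^esub> x) = f x" if "x \<in> carrier F" for x
  proof -
    have "f y = f x" if "y \<in> N +>\<^bsub>F\<^esub> x" for y
    proof -
      from that obtain n where n: "n \<in> N" "y = n + x" by (auto simp: a_r_coset_def')
      then show ?thesis using fN[of n] fadd[of n x] fc[of x] \<open>x \<in> carrier F\<close> by simp
    qed
    moreover have "x \<in> N +>\<^bsub>F\<^esub> x" using F.quot.a_rcos_self that by blast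
    ultimately have "f ` (N +>\<^bsub>F\<^esub> x) = {f x}" by blast
    then show ?thesis by (simp add: h_def)
  qed
  show thesis
  proof
    fix X assume "X \<in> carrier M"
    then show "h X \<in> carrier V" unfolding M_carrier using h fc by auto
  next
    fix X Y assume "X \<in> carrier M" "Y \<in> carrier M"
    then obtain x y where x: "x \<in> carrier F" "X = N +>\<^bsub>F\<^esub> x" "y \<in> carrier F" "Y = N +>\<^bsub>F\<^esub> y"
      unfolding M_carrier by blast
    then have "x + y \<in> carrier F" by simp
    then show "h (X \<oplus>\<^bsub>M\<^esub> Y) = h X \<oplus>\<^bsub>V\<^esub> h Y" using x by (simp only: x M_add h fadd)
  next
    fix a X assume a: "a \<in> carrier A" and "X \<in> carrier M"
    then obtain x where x: "x \<in> carrier F" "X = N +>\<^bsub>F\<^esub> x" unfolding M_carrier by blast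
    then show "h (a \<odot>\<^bsub>M\<^esub> X) = a \<odot>\<^bsub>V\<^esub> h X"
      using a F.act_closed by (simp only: x M_act h fact)
  next
    fix u assume "u \<in> carrier U"
    then show "h (t u) = T u" using T(1) V.smult_one by (simp add: t_def h fof)
  qed
qed

end


section \<open>Subspaces and coordinates\<close>

text \<open>Says that the \<open>m\<close> columns are linearly independent; such matrices stand in
  for bases of subspaces.\<close>

definition inj_mat :: "nat \<Rightarrow> complex mat \<Rightarrow> bool" where
  "inj_mat m A \<longleftrightarrow> (\<forall>x\<in>carrier_vec m. A *\<^sub>v x = 0\<^sub>v (dim_row A) \<longrightarrow> x = 0\<^sub>v m)"

definition vec_subspace :: "nat \<Rightarrow> complex vec set \<Rightarrow> bool" where
  "vec_subspace n S \<longleftrightarrow> S \<subseteq> carrier_vec n \<and> 0\<^sub>v n \<in> S \<and>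
     (\<forall>u\<in>S. \<forall>v\<in>S. u + v \<in> S) \<and> (\<forall>c. \<forall>u\<in>S. c \<cdot>\<^sub>v u \<in> S)"

lemma vec_subspaceD:
  assumes "vec_subspace n S"
  shows "u \<in> S \<Longrightarrow> u \<in> carrier_vec n" "0\<^sub>v n \<in> S" "u \<in> S \<Longrightarrow> v \<in> S \<Longrightarrow> u + v \<in> S"
    "u \<in> S \<Longrightarrow> c \<cdot>\<^sub>v u \<in> S"
  using assms by (auto simp: vec_subspace_def)

lemma inj_mat_eqD:
  assumes "A \<in> carrier_mat n m" "inj_mat m A" "x \<in> carrier_vec m" "y \<in> carrier_vec m" "A *\<^sub>v x = A *\<^sub>v y"
  shows "x = y"
proof -
  have "A *\<^sub>v (x - y) = 0\<^sub>v n" using assms by (simp add: mult_minus_distrib_mat_vec)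
  then have xy: "x - y = 0\<^sub>v m" using assms by (auto simp: inj_mat_def)
  show ?thesis
  proof (rule eq_vecI)
    fix i assume i: "i < dim_vec y"
    then have "(x - y) $ i = 0" unfolding xy using assms(4) by simp
    then show "x $ i = y $ i" using i by simp
  qed (use assms in simp)
qed

lemma inj_mat_mult:
  assumes "A \<in> carrier_mat n m" "inj_mat m A" "B \<in> carrier_mat m k" "inj_mat k B"
  shows "inj_mat k (A * B)"
  unfolding inj_mat_def
proof (intro ballI impI)
  fix x assume x: "x \<in> carrier_vec k" and "A * B *\<^sub>v x = 0\<^sub>v (dim_row (A * B))"
  then have "A *\<^sub>v (B *\<^sub>v x) = 0\<^sub>v n" using assms by simp
  then have "B *\<^sub>v x = 0\<^sub>v m" using assms x by (auto simp: inj_mat_def)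
  then show "x = 0\<^sub>v k" using assms x by (auto simp: inj_mat_def)
qed

lemma square_inj_mat_iff_det: "A \<in> carrier_mat n n \<Longrightarrow> inj_mat n A \<longleftrightarrow> det A \<noteq> 0"
  using det_0_iff_vec_prod_zero[of A n] by (auto simp: inj_mat_def)

text \<open>With more columns than rows, padding by zero rows gives a square matrix of determinant
  zero; a nonzero vector in its kernel is killed by \<open>A\<close> as well.\<close>

lemma inj_mat_dim_le:
  assumes "A \<in> carrier_mat n m" "inj_mat m A" shows "m \<le> n"
proof (rule ccontr)
  assume "\<not> m \<le> n"
  define A' where "A' = mat m m (\<lambda>(i, j). if i < n then A $$ (i, j) else 0)"
  have A': "A' \<in> carrier_mat m m" by (simp add: A'_def)
  \<comment> \<open>Row \<open>n\<close>, counted from 0, is the first padded one, so the transpose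
    kills the unit vector with that index.\<close>
  have "transpose_mat A' *\<^sub>v unit_vec m n = 0\<^sub>v m"
    using \<open>\<not> m \<le> n\<close> by (intro eq_vecI) (auto simp: A'_def scalar_prod_def unit_vec_def if_distrib sum.If_cases)
  moreover have "unit_vec m n \<noteq> (0\<^sub>v m :: complex vec)" using \<open>\<not> m \<le> n\<close> by simp
  ultimately have "det (transpose_mat A') = 0"
    using A' det_0_iff_vec_prod_zero[of "transpose_mat A'" m] by (auto intro!: exI[of _ "unit_vec m n"])
  then have "det A' = 0" using det_transpose[OF A'] by simp
  then obtain v where v: "v \<in> carrier_vec m" "v \<noteq> 0\<^sub>v m" "A' *\<^sub>v v = 0\<^sub>v m"
    using det_0_iff_vec_prod_zero[OF A'] by auto
  have "A *\<^sub>v v = 0\<^sub>v n"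
  proof (rule eq_vecI)
    fix i assume "i < dim_vec (0\<^sub>v n :: complex vec)"
    then have i: "i < n" "i < m" using \<open>\<not> m \<le> n\<close> by auto
    have "row A i = row A' i" using assms(1) i by (intro eq_vecI) (auto simp: A'_def)
    moreover have "(A' *\<^sub>v v) $ i = 0" using v(3) i by simp
    ultimately show "(A *\<^sub>v v) $ i = 0\<^sub>v n $ i" using assms(1) A' i by simp
  qed (use assms in auto)
  then show False using v assms by (auto simp: inj_mat_def)
qed

text \<open>The basis is an injective matrix into \<open>S\<close> with the largest number of
  columns; if some \<open>v\<close> in \<open>S\<close> were outside its image, appending
  \<open>v\<close> as a column would give a larger one.\<close>

lemma vec_subspace_basis:
  assumes S: "vec_subspace n S"
  obtains m Q where "Q \<in> carrier_mat n m" "inj_mat m Q" "S = (\<lambda>x. Q *\<^sub>v x) ` carrier_vec m"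
    "S \<noteq> carrier_vec n \<Longrightarrow> m < n" "S \<noteq> {0\<^sub>v n} \<Longrightarrow> 0 < m"
proof -
  define P where "P m \<longleftrightarrow> (\<exists>Q\<in>carrier_mat n m. inj_mat m Q \<and> (\<forall>x\<in>carrier_vec m. Q *\<^sub>v x \<in> S))" for m
  have "P 0"
  proof -
    have "(0\<^sub>m n 0 :: complex mat) *\<^sub>v x = 0\<^sub>v n" if "x \<in> carrier_vec 0" for x :: "complex vec"
      using that by (intro eq_vecI) (auto simp: scalar_prod_def)
    then show ?thesis unfolding P_def
      by (intro bexI[of _ "0\<^sub>m n 0"]) (auto simp: inj_mat_def vec_subspaceD(2)[OF S])
  qed
  moreover have bound: "P m \<Longrightarrow> m \<le> n" for m unfolding P_def using inj_mat_dim_le by blast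
  ultimately obtain m where m: "P m" "\<And>m'. P m' \<Longrightarrow> m' \<le> m"
    using Nat.ex_has_greatest_nat[of P 0 n] by blast
  from m(1) obtain Q where Q: "Q \<in> carrier_mat n m" "inj_mat m Q" "\<And>x. x \<in> carrier_vec m \<Longrightarrow> Q *\<^sub>v x \<in> S"
    unfolding P_def by blast
  have SQ: "S = (\<lambda>x. Q *\<^sub>v x) ` carrier_vec m"
  proof (rule ccontr)
    assume "S \<noteq> (\<lambda>x. Q *\<^sub>v x) ` carrier_vec m"
    then obtain v where v: "v \<in> S" "\<And>x. x \<in> carrier_vec m \<Longrightarrow> v \<noteq> Q *\<^sub>v x" using Q(3) by blast
    have vc: "v \<in> carrier_vec n" by (rule vec_subspaceD(1)[OF S v(1)])
    define Q' where "Q' = mat n (Suc m) (\<lambda>(i, j). if j < m then Q $$ (i, j) else v $ i)"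
    define pr where "pr x = vec m (\<lambda>i. x $ i)" for x :: "complex vec"
    have Q'x: "Q' *\<^sub>v x = Q *\<^sub>v pr x + x $ m \<cdot>\<^sub>v v" if "x \<in> carrier_vec (Suc m)" for x :: "complex vec"
      using that Q(1) vc by (intro eq_vecI) (auto simp: Q'_def pr_def scalar_prod_def)
    have "P (Suc m)" unfolding P_def
    proof (intro bexI[of _ Q'] conjI ballI)
      show "Q' \<in> carrier_mat n (Suc m)" by (simp add: Q'_def)
      show "inj_mat (Suc m) Q'" unfolding inj_mat_def
      proof (intro ballI impI)
        fix x assume x: "x \<in> carrier_vec (Suc m)" and "Q' *\<^sub>v x = 0\<^sub>v (dim_row Q')"
        then have eq: "Q *\<^sub>v pr x + x $ m \<cdot>\<^sub>v v = 0\<^sub>v n" using Q'x[OF x] by (simp add: Q'_def)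
        have prc: "pr x \<in> carrier_vec m" by (simp add: pr_def)
        have xm: "x $ m = 0"
        proof (rule ccontr)
          assume nz: "x $ m \<noteq> 0"
          \<comment> \<open>A relation with nonzero last coefficient would express \<open>v\<close>
            through the columns of \<open>Q\<close>.\<close>
          have "v = Q *\<^sub>v ((- 1 / x $ m) \<cdot>\<^sub>v pr x)"
          proof (rule eq_vecI)
            fix i assume "i < dim_vec (Q *\<^sub>v ((- 1 / x $ m) \<cdot>\<^sub>v pr x))"
            then have i: "i < n" using Q(1) by simp
            have "(Q *\<^sub>v pr x) $ i + x $ m * v $ i = 0"
              using arg_cong[OF eq, of "\<lambda>u::complex vec. u $ i"] i Q(1) vc by simp
            then have "v $ i = (- 1 / x $ m) * (Q *\<^sub>v pr x) $ i" using nz by (simp add: field_simps add_eq_0_iff2)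
            then show "v $ i = (Q *\<^sub>v ((- 1 / x $ m) \<cdot>\<^sub>v pr x)) $ i"
              using mult_mat_vec[OF Q(1) prc, of "- 1 / x $ m"] i Q(1) by simp
          qed (use Q(1) vc in simp)
          then show False using v(2)[of "(- 1 / x $ m) \<cdot>\<^sub>v pr x"] prc by simp
        qed
        have "0 \<cdot>\<^sub>v v = 0\<^sub>v n" using vc by (intro eq_vecI) auto
        then have "Q *\<^sub>v pr x = 0\<^sub>v n" using eq xm Q(1) prc by simp
        then have p0: "pr x = 0\<^sub>v m" using Q(1,2) prc by (auto simp: inj_mat_def)
        show "x = 0\<^sub>v (Suc m)"
        proof (rule eq_vecI)
          fix i assume "i < dim_vec (0\<^sub>v (Suc m) :: complex vec)"
          then show "x $ i = 0\<^sub>v (Suc m) $ i"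
            using xm arg_cong[OF p0, of "\<lambda>u::complex vec. u $ i"] by (cases "i = m") (auto simp: pr_def)
        qed (use x in simp)
      qed
      fix x :: "complex vec" assume "x \<in> carrier_vec (Suc m)"
      then show "Q' *\<^sub>v x \<in> S"
        using Q'x Q(3)[of "pr x"] vec_subspaceD(3,4)[OF S] v(1) by (simp add: pr_def)
    qed
    then show False using m(2) by fastforce
  qed
  show thesis
  proof (rule that[OF Q(1,2) SQ])
    assume "S \<noteq> {0\<^sub>v n}"
    show "0 < m"
    proof (rule ccontr)
      assume "\<not> 0 < m"
      then have "Q *\<^sub>v x = 0\<^sub>v n" if "x \<in> carrier_vec m" for x
        using that Q(1) by (intro eq_vecI) (auto simp: scalar_prod_def)
      then have "S \<subseteq> {0\<^sub>v n}" unfolding SQ by auto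
      then show False using \<open>S \<noteq> {0\<^sub>v n}\<close> vec_subspaceD(2)[OF S] by blast
    qed
  next
    assume ne: "S \<noteq> carrier_vec n"
    show "m < n"
    proof (rule ccontr)
      assume "\<not> m < n"
      then have mn: "m = n" using bound[OF m(1)] by simp
      have "det Q \<noteq> 0" using Q(1,2) square_inj_mat_iff_det mn by blast
      then obtain Q' where Q': "Q' \<in> carrier_mat n n" "Q * Q' = 1\<^sub>m n"
        using det_non_zero_imp_unit[of Q n] Q(1) mn unfolding Units_def ring_mat_def by auto
      have "u \<in> S" if "u \<in> carrier_vec n" for u
      proof -
        have "u = Q *\<^sub>v (Q' *\<^sub>v u)" using Q(1) Q' mn that by (metis assoc_mult_mat_vec one_mult_mat_vec)
        then show ?thesis using Q(3)[of "Q' *\<^sub>v u"] Q'(1) mn that by simp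
      qed
      then show False using ne vec_subspaceD(1)[OF S] by blast
    qed
  qed
qed

section \<open>Coordinates on a finitely spanned complex vector space\<close>

locale complex_space = abelian_group M for M :: "('m, 'z) ring_scheme" (structure) +
  fixes s :: "complex \<Rightarrow> 'm \<Rightarrow> 'm"
  assumes s_closed: "x \<in> carrier M \<Longrightarrow> s c x \<in> carrier M"
    and s_add_left: "x \<in> carrier M \<Longrightarrow> s (c + d) x = s c x \<oplus> s d x"
    and s_add_right: "x \<in> carrier M \<Longrightarrow> y \<in> carrier M \<Longrightarrow> s c (x \<oplus> y) = s c x \<oplus> s c y"
    and s_mult: "x \<in> carrier M \<Longrightarrow> s (c * d) x = s c (s d x)"
    and s_one: "x \<in> carrier M \<Longrightarrow> s 1 x = x"
begin

lemma s_zero_left: "x \<in> carrier M \<Longrightarrow> s 0 x = \<zero>"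
  using s_add_left[of x 0 0] s_closed[of x 0] by (metis add.l_cancel_one add_0 r_zero zero_closed)

lemma s_zero_right: "s c \<zero> = \<zero>"
  using s_add_right[of \<zero> \<zero> c] s_closed[of \<zero> c] by (metis add.l_cancel_one r_zero zero_closed)

lemma s_finsum:
  assumes "finite I" "\<And>i. i \<in> I \<Longrightarrow> f i \<in> carrier M"
  shows "s c (\<Oplus>i\<in>I. f i) = (\<Oplus>i\<in>I. s c (f i))"
  using assms by (induction I) (auto simp: s_zero_right s_add_right s_closed Pi_def)

text \<open>A spanning set of least cardinality is independent: a relation with a nonzero
  coefficient at \<open>b0\<close> would allow \<open>b0\<close> to be removed. Numbering its
  elements identifies coordinate vectors with elements of the space.\<close>

lemma coordinates:
  assumes "finite B0" "B0 \<subseteq> carrier M" "\<And>v. v \<in> carrier M \<Longrightarrow> \<exists>c. v = (\<Oplus>b\<in>B0. s (c b) b)"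
  obtains N \<psi> where "bij_betw \<psi> (carrier_vec N) (carrier M)"
    "\<And>x y. x \<in> carrier_vec N \<Longrightarrow> y \<in> carrier_vec N \<Longrightarrow> \<psi> (x + y) = \<psi> x \<oplus> \<psi> y"
    "\<And>c x. x \<in> carrier_vec N \<Longrightarrow> \<psi> (c \<cdot>\<^sub>v x) = s c (\<psi> x)"
proof -
  define spans where "spans B \<longleftrightarrow> finite B \<and> B \<subseteq> carrier M \<and> (\<forall>v\<in>carrier M. \<exists>c. v = (\<Oplus>b\<in>B. s (c b) b))" for B
  have "spans B0" using assms by (auto simp: spans_def)
  then obtain B where B: "spans B" and min: "\<And>B'. spans B' \<Longrightarrow> card B \<le> card B'"
    using ex_has_least_nat[of spans B0 card] by blast
  have fin: "finite B" and sub: "B \<subseteq> carrier M" using B by (auto simp: spans_def)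
  define lin where "lin c = (\<Oplus>b\<in>B. s (c b) b)" for c
  have sb: "s c b \<in> carrier M" if "b \<in> B" for c b using that sub s_closed by blast
  have lin_closed: "lin c \<in> carrier M" for c unfolding lin_def using sb by (intro finsum_closed) auto
  have lin_add: "lin (\<lambda>b. c b + d b) = lin c \<oplus> lin d" for c d
  proof -
    have "lin (\<lambda>b. c b + d b) = (\<Oplus>b\<in>B. s (c b) b \<oplus> s (d b) b)"
      unfolding lin_def using sb sub by (intro finsum_cong') (auto simp: s_add_left subset_eq)
    then show ?thesis unfolding lin_def using sb by (simp add: finsum_addf Pi_def)
  qed
  have lin_scale: "lin (\<lambda>b. a * c b) = s a (lin c)" for a c
  proof -
    have "lin (\<lambda>b. a * c b) = (\<Oplus>b\<in>B. s a (s (c b) b))"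
      unfolding lin_def using sb sub s_closed by (intro finsum_cong') (auto simp: s_mult subset_eq)
    then show ?thesis unfolding lin_def using sb fin by (simp add: s_finsum)
  qed
  have indep: "c b0 = 0" if c: "lin c = \<zero>" and b0: "b0 \<in> B" for c b0
  proof (rule ccontr)
    assume nz: "c b0 \<noteq> 0"
    have "spans (B - {b0})" unfolding spans_def
    proof (intro conjI ballI)
      fix v assume "v \<in> carrier M"
      then obtain d where d: "v = lin d" using B by (auto simp: spans_def lin_def)
      \<comment> \<open>Subtract from \<open>d\<close> the multiple of the relation \<open>c\<close>
        that cancels the coefficient at \<open>b0\<close>.\<close>
      define e where "e b = d b + (- d b0 / c b0) * c b" for b
      have "lin e = lin d \<oplus> s (- d b0 / c b0) (lin c)" unfolding e_def lin_add lin_scale ..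
      then have "v = lin e" using c d lin_closed by (simp add: s_zero_right)
      also have "\<dots> = s (e b0) b0 \<oplus> (\<Oplus>b\<in>B - {b0}. s (e b) b)"
        unfolding lin_def using fin b0 sb
        by (subst finsum_insert[of "B - {b0}" b0, symmetric]) (auto simp: insert_absorb)
      also have "s (e b0) b0 = \<zero>" using nz b0 sub by (simp add: e_def s_zero_left subset_eq)
      also have "\<zero> \<oplus> (\<Oplus>b\<in>B - {b0}. s (e b) b) = (\<Oplus>b\<in>B - {b0}. s (e b) b)"
        using sb by (intro l_zero finsum_closed) auto
      finally show "\<exists>c. v = (\<Oplus>b\<in>B - {b0}. s (c b) b)" by blast
    qed (use fin sub in auto)
    then have "card B \<le> card (B - {b0})" by (rule min)
    then show False using card_Diff1_less[OF fin b0] by simp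
  qed
  define N where "N = card B"
  obtain h where h: "bij_betw h {0..<N} B" using ex_bij_betw_nat_finite[OF fin] unfolding N_def by blast
  define g where "g = the_inv_into {0..<N} h"
  have g: "g b < N" "h (g b) = b" if "b \<in> B" for b
    using h that f_the_inv_into_f[of h "{0..<N}" b] the_inv_into_into[of h "{0..<N}" b "{0..<N}"]
    by (auto simp: g_def bij_betw_def)
  have gh: "g (h i) = i" "h i \<in> B" if "i < N" for i
    using h that the_inv_into_f_f[of h "{0..<N}" i] by (auto simp: g_def bij_betw_def)
  have lin_cong: "lin c = lin d" if "\<And>b. b \<in> B \<Longrightarrow> c b = d b" for c d
    unfolding lin_def using sb that by (intro finsum_cong') auto
  define \<psi> where "\<psi> x = lin (\<lambda>b. x $ g b)" for x
  have add: "\<psi> (x + y) = \<psi> x \<oplus> \<psi> y" if "x \<in> carrier_vec N" "y \<in> carrier_vec N" for x y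
    unfolding \<psi>_def lin_add[symmetric] using that g by (intro lin_cong) auto
  have scale: "\<psi> (c \<cdot>\<^sub>v x) = s c (\<psi> x)" if "x \<in> carrier_vec N" for c x
    unfolding \<psi>_def lin_scale[symmetric] using that g by (intro lin_cong) auto
  have "bij_betw \<psi> (carrier_vec N) (carrier M)"
    unfolding bij_betw_def
  proof
    show "inj_on \<psi> (carrier_vec N)"
    proof (rule inj_onI)
      fix x y assume x: "x \<in> carrier_vec N" and y: "y \<in> carrier_vec N" and eq: "\<psi> x = \<psi> y"
      have "lin (\<lambda>b. x $ g b + (-1) * y $ g b) = lin (\<lambda>b. y $ g b + (-1) * y $ g b)"
        using eq unfolding lin_add by (simp add: \<psi>_def)
      also have "\<dots> = lin (\<lambda>b. 0 * 0)" by simp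
      also have "\<dots> = \<zero>" unfolding lin_scale using lin_closed by (simp add: s_zero_left)
      finally have "x $ g b + (-1) * y $ g b = 0" if "b \<in> B" for b using indep that by blast
      then have "x $ i = y $ i" if "i < N" for i using gh[OF that] by force
      then show "x = y" using x y by (intro eq_vecI) auto
    qed
    show "\<psi> ` carrier_vec N = carrier M"
    proof
      show "\<psi> ` carrier_vec N \<subseteq> carrier M" using lin_closed by (auto simp: \<psi>_def)
      show "carrier M \<subseteq> \<psi> ` carrier_vec N"
      proof
        fix v assume "v \<in> carrier M"
        then obtain c where "v = lin c" using B by (auto simp: spans_def lin_def)
        also have "\<dots> = \<psi> (vec N (\<lambda>i. c (h i)))" unfolding \<psi>_def using g by (intro lin_cong) auto
        finally show "v \<in> \<psi> ` carrier_vec N" by auto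
      qed
    qed
  qed
  with add scale that show thesis by blast
qed

end


section \<open>Irreducible representations and characters\<close>

lemma mult_unit_vec_col:
  fixes A :: "complex mat"
  assumes "A \<in> carrier_mat n m" "j < m" shows "A *\<^sub>v unit_vec m j = col A j"
  using assms by (intro eq_vecI) (auto simp: scalar_prod_right_unit)

lemma mult_zero_vec:
  fixes A :: "complex mat"
  assumes "A \<in> carrier_mat n m" shows "A *\<^sub>v 0\<^sub>v m = 0\<^sub>v n"
  using assms by (intro eq_vecI) (auto simp: scalar_prod_def)

lemma mat_factor:
  fixes P A :: "complex mat"
  assumes "P \<in> carrier_mat N n" "A \<in> carrier_mat N m"
    "\<And>x. x \<in> carrier_vec m \<Longrightarrow> \<exists>y\<in>carrier_vec n. A *\<^sub>v x = P *\<^sub>v y"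
  shows "\<exists>X\<in>carrier_mat n m. A = P * X"
proof -
  have "\<exists>y\<in>carrier_vec n. col A j = P *\<^sub>v y" if "j < m" for j
  proof -
    have "col A j = A *\<^sub>v unit_vec m j" by (rule mult_unit_vec_col[OF assms(2) that, symmetric])
    then show ?thesis using assms(3)[of "unit_vec m j"] by simp
  qed
  then obtain y where y: "\<And>j. j < m \<Longrightarrow> y j \<in> carrier_vec n" "\<And>j. j < m \<Longrightarrow> col A j = P *\<^sub>v y j"
    by metis
  define X where "X = mat n m (\<lambda>(i, j). y j $ i)"
  have "A = P * X"
  proof (rule mat_col_eqI)
    fix j assume "j < dim_col (P * X)"
    then have j: "j < m" by (simp add: X_def)
    have "col X j = y j" using y(1)[OF j] j by (intro eq_vecI) (auto simp: X_def)
    then show "col A j = col (P * X) j"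
      using y(2)[OF j] col_mult2[OF assms(1), of X m j] j by (simp add: X_def)
  qed (use assms(1,2) in \<open>auto simp: X_def\<close>)
  then show ?thesis by (auto simp: X_def)
qed

text \<open>Among the injective matrices into \<open>U\<close> with \<open>G\<close>-stable image
  and at least one column, one with the fewest columns is irreducible: a proper nonzero invariant
  subspace with basis \<open>Q\<close> would give the smaller \<open>P * Q\<close>.
  \<open>\<rho>\<close> is the action expressed in the basis \<open>P\<close>.\<close>

lemma vec_subspace_irreducible_subrep:
  assumes \<Phi>: "\<And>g. g \<in> G \<Longrightarrow> \<Phi> g \<in> carrier_mat N N"
    and U: "vec_subspace N U" "U \<noteq> {0\<^sub>v N}" "\<And>g u. g \<in> G \<Longrightarrow> u \<in> U \<Longrightarrow> \<Phi> g *\<^sub>v u \<in> U"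
  obtains n P \<rho> where "0 < n" "P \<in> carrier_mat N n" "inj_mat n P"
    "\<And>x. x \<in> carrier_vec n \<Longrightarrow> P *\<^sub>v x \<in> U"
    "\<And>g. g \<in> G \<Longrightarrow> \<rho> g \<in> carrier_mat n n" "\<And>g. g \<in> G \<Longrightarrow> \<Phi> g * P = P * \<rho> g"
    "\<And>S. vec_subspace n S \<Longrightarrow> (\<And>g u. g \<in> G \<Longrightarrow> u \<in> S \<Longrightarrow> \<rho> g *\<^sub>v u \<in> S) \<Longrightarrow>
       S = {0\<^sub>v n} \<or> S = carrier_vec n"
proof -
  define good where "good n P \<longleftrightarrow> 0 < n \<and> P \<in> carrier_mat N n \<and> inj_mat n P \<and>
      (\<forall>x\<in>carrier_vec n. P *\<^sub>v x \<in> U) \<and>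
      (\<forall>g\<in>G. \<forall>x\<in>carrier_vec n. \<exists>y\<in>carrier_vec n. \<Phi> g *\<^sub>v (P *\<^sub>v x) = P *\<^sub>v y)" for n P
  have "\<exists>n P. good n P"
  proof -
    from vec_subspace_basis[OF U(1)] U(2) obtain m Q where Q: "Q \<in> carrier_mat N m" "inj_mat m Q"
      "U = (\<lambda>x. Q *\<^sub>v x) ` carrier_vec m" "0 < m" by metis
    have "good m Q" unfolding good_def
    proof (intro conjI ballI)
      fix g and x :: "complex vec" assume "g \<in> G" "x \<in> carrier_vec m"
      then have "\<Phi> g *\<^sub>v (Q *\<^sub>v x) \<in> U" using U(3) Q(3) by blast
      then show "\<exists>y\<in>carrier_vec m. \<Phi> g *\<^sub>v (Q *\<^sub>v x) = Q *\<^sub>v y" using Q(3) by auto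
    qed (use Q in auto)
    then show ?thesis by blast
  qed
  then obtain n where ex: "\<exists>P. good n P" and min: "\<And>m. m < n \<Longrightarrow> \<not> (\<exists>P. good m P)"
    using exists_least_iff[of "\<lambda>n. \<exists>P. good n P"] by blast
  then obtain P where P: "good n P" by blast
  then have Pn: "0 < n" "P \<in> carrier_mat N n" "inj_mat n P"
    "\<And>x. x \<in> carrier_vec n \<Longrightarrow> P *\<^sub>v x \<in> U" by (auto simp: good_def)
  have "\<exists>X\<in>carrier_mat n n. \<Phi> g * P = P * X" if "g \<in> G" for g
  proof (rule mat_factor[OF Pn(2)])
    fix x :: "complex vec" assume "x \<in> carrier_vec n"
    then show "\<exists>y\<in>carrier_vec n. \<Phi> g * P *\<^sub>v x = P *\<^sub>v y"
      using P that \<Phi>[OF that] Pn(2) by (auto simp: good_def)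
  qed (use \<Phi>[OF that] Pn(2) in simp)
  then obtain \<rho> where \<rho>: "\<And>g. g \<in> G \<Longrightarrow> \<rho> g \<in> carrier_mat n n" "\<And>g. g \<in> G \<Longrightarrow> \<Phi> g * P = P * \<rho> g"
    by metis
  show thesis
  proof (rule that[OF Pn \<rho>])
    fix S assume S: "vec_subspace n S" "\<And>g u. g \<in> G \<Longrightarrow> u \<in> S \<Longrightarrow> \<rho> g *\<^sub>v u \<in> S"
    show "S = {0\<^sub>v n} \<or> S = carrier_vec n"
    proof (rule ccontr)
      assume "\<not> (S = {0\<^sub>v n} \<or> S = carrier_vec n)"
      with vec_subspace_basis[OF S(1)] obtain m Q where Q: "Q \<in> carrier_mat n m" "inj_mat m Q"
        "S = (\<lambda>x. Q *\<^sub>v x) ` carrier_vec m" "m < n" "0 < m" by metis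
      have "good m (P * Q)" unfolding good_def
      proof (intro conjI ballI)
        show "inj_mat m (P * Q)" using Pn Q by (intro inj_mat_mult[of P N n]) auto
      next
        fix x :: "complex vec" assume "x \<in> carrier_vec m"
        then show "P * Q *\<^sub>v x \<in> U" using Pn Q(1) by simp
      next
        fix g and x :: "complex vec" assume g: "g \<in> G" and x: "x \<in> carrier_vec m"
        have Qx: "Q *\<^sub>v x \<in> carrier_vec n" using Q(1) x by simp
        have "\<rho> g *\<^sub>v (Q *\<^sub>v x) \<in> S" using S(2)[OF g] Q(3) x by blast
        then obtain y where y: "y \<in> carrier_vec m" "\<rho> g *\<^sub>v (Q *\<^sub>v x) = Q *\<^sub>v y" using Q(3) by auto
        have "\<Phi> g *\<^sub>v (P * Q *\<^sub>v x) = \<Phi> g *\<^sub>v (P *\<^sub>v (Q *\<^sub>v x))"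
          using assoc_mult_mat_vec[OF Pn(2) Q(1) x] by simp
        also have "\<dots> = (\<Phi> g * P) *\<^sub>v (Q *\<^sub>v x)"
          using assoc_mult_mat_vec[OF \<Phi>[OF g] Pn(2) Qx] by simp
        also have "\<dots> = P *\<^sub>v (\<rho> g *\<^sub>v (Q *\<^sub>v x))"
          unfolding \<rho>(2)[OF g] by (rule assoc_mult_mat_vec[OF Pn(2) \<rho>(1)[OF g] Qx])
        also have "\<dots> = P * Q *\<^sub>v y"
          unfolding y(2) using assoc_mult_mat_vec[OF Pn(2) Q(1) y(1)] by simp
        finally show "\<exists>y\<in>carrier_vec m. \<Phi> g *\<^sub>v (P * Q *\<^sub>v x) = P * Q *\<^sub>v y" using y(1) by blast
      qed (use Q Pn(2) in auto)
      then show False using min[OF Q(4)] by blast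
    qed
  qed
qed

lemma vec_subspace_kernel: "A \<in> carrier_mat m n \<Longrightarrow> vec_subspace n {x \<in> carrier_vec n. A *\<^sub>v x = 0\<^sub>v m}"
  by (auto simp: vec_subspace_def mult_add_distrib_mat_vec mult_mat_vec)

lemma vec_subspace_eigenspace:
  assumes "A \<in> carrier_mat n n" shows "vec_subspace n {x \<in> carrier_vec n. A *\<^sub>v x = c \<cdot>\<^sub>v x}"
proof -
  have "A *\<^sub>v (x + y) = c \<cdot>\<^sub>v (x + y)"
    if "x \<in> carrier_vec n" "y \<in> carrier_vec n" "A *\<^sub>v x = c \<cdot>\<^sub>v x" "A *\<^sub>v y = c \<cdot>\<^sub>v y" for x y
    using that assms by (simp add: mult_add_distrib_mat_vec smult_add_distrib_vec)
  moreover have "A *\<^sub>v (d \<cdot>\<^sub>v x) = c \<cdot>\<^sub>v (d \<cdot>\<^sub>v x)"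
    if "x \<in> carrier_vec n" "A *\<^sub>v x = c \<cdot>\<^sub>v x" for x d
    using that assms by (simp add: mult_mat_vec smult_smult_assoc mult.commute)
  ultimately show ?thesis using assms by (auto simp: vec_subspace_def)
qed

lemma irreducible_weyl_repD:
  assumes "irreducible_weyl_rep R n \<rho>"
  shows "0 < n" "w \<in> weyl_group R \<Longrightarrow> \<rho> w \<in> carrier_mat n n" "\<rho> id = 1\<^sub>m n"
    "w \<in> weyl_group R \<Longrightarrow> w' \<in> weyl_group R \<Longrightarrow> \<rho> (w \<circ> w') = \<rho> w * \<rho> w'"
    "vec_subspace n U \<Longrightarrow> (\<And>w u. w \<in> weyl_group R \<Longrightarrow> u \<in> U \<Longrightarrow> \<rho> w *\<^sub>v u \<in> U) \<Longrightarrow>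
       U = {0\<^sub>v n} \<or> U = carrier_vec n"
proof -
  show "0 < n" "w \<in> weyl_group R \<Longrightarrow> \<rho> w \<in> carrier_mat n n" "\<rho> id = 1\<^sub>m n"
    "w \<in> weyl_group R \<Longrightarrow> w' \<in> weyl_group R \<Longrightarrow> \<rho> (w \<circ> w') = \<rho> w * \<rho> w'"
    using assms by (simp_all add: irreducible_weyl_rep_def weyl_rep_def)
  assume "vec_subspace n U" "\<And>w u. w \<in> weyl_group R \<Longrightarrow> u \<in> U \<Longrightarrow> \<rho> w *\<^sub>v u \<in> U"
  then show "U = {0\<^sub>v n} \<or> U = carrier_vec n"
    using conjunct2[OF conjunct2[OF assms[unfolded irreducible_weyl_rep_def]], THEN spec[of _ U]]
    by (simp add: vec_subspace_def)
qed

section \<open>Schur's lemma and the comparison of characters\<close>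

definition intertwines :: "('a::euclidean_space \<Rightarrow> real) set \<Rightarrow> nat \<Rightarrow> (('a \<Rightarrow> 'a) \<Rightarrow> complex mat) \<Rightarrow>
    (('a \<Rightarrow> 'a) \<Rightarrow> complex mat) \<Rightarrow> complex mat \<Rightarrow> bool" where
  "intertwines R n \<rho> \<rho>' Y \<longleftrightarrow> Y \<in> carrier_mat n n \<and> (\<forall>w\<in>weyl_group R. \<rho> w * Y = Y * \<rho>' w)"

text \<open>The kernel of an intertwiner is stable under \<open>\<rho>'\<close>, hence zero or
  everything.\<close>

lemma schur_zero_or_inj:
  assumes "irreducible_weyl_rep R n \<rho>" "irreducible_weyl_rep R n \<rho>'" "intertwines R n \<rho> \<rho>' Y"
  shows "Y = 0\<^sub>m n n \<or> inj_mat n Y"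
proof -
  define U where "U = {x \<in> carrier_vec n. Y *\<^sub>v x = 0\<^sub>v n}"
  have Y: "Y \<in> carrier_mat n n" "\<And>w. w \<in> weyl_group R \<Longrightarrow> \<rho> w * Y = Y * \<rho>' w"
    using assms(3) by (auto simp: intertwines_def)
  have "U = {0\<^sub>v n} \<or> U = carrier_vec n"
  proof (rule irreducible_weyl_repD(5)[OF assms(2)])
    show "vec_subspace n U" unfolding U_def by (rule vec_subspace_kernel[OF Y(1)])
    fix w u assume w: "w \<in> weyl_group R" and "u \<in> U"
    then have u: "u \<in> carrier_vec n" "Y *\<^sub>v u = 0\<^sub>v n" by (auto simp: U_def)
    note c = irreducible_weyl_repD(2)[OF assms(1) w] irreducible_weyl_repD(2)[OF assms(2) w]
    have "Y *\<^sub>v (\<rho>' w *\<^sub>v u) = (\<rho> w * Y) *\<^sub>v u"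
      unfolding Y(2)[OF w] by (rule assoc_mult_mat_vec[OF Y(1) c(2) u(1), symmetric])
    also have "\<dots> = \<rho> w *\<^sub>v 0\<^sub>v n" using assoc_mult_mat_vec[OF c(1) Y(1) u(1)] u(2) by simp
    also have "\<dots> = 0\<^sub>v n" by (rule mult_zero_vec[OF c(1)])
    finally show "\<rho>' w *\<^sub>v u \<in> U" using c(2) u(1) by (simp add: U_def)
  qed
  then show ?thesis
  proof
    assume "U = {0\<^sub>v n}"
    then show ?thesis using Y(1) unfolding inj_mat_def U_def by auto
  next
    assume all: "U = carrier_vec n"
    have "Y = 0\<^sub>m n n"
    proof (rule eq_matI)
      fix i j assume ij: "i < dim_row (0\<^sub>m n n :: complex mat)" "j < dim_col (0\<^sub>m n n :: complex mat)"
      have "unit_vec n j \<in> U" using all by simp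
      then have "Y *\<^sub>v unit_vec n j = 0\<^sub>v n" unfolding U_def by blast
      then have "col Y j = 0\<^sub>v n" using mult_unit_vec_col[OF Y(1)] ij by simp
      then have "col Y j $ i = 0" using ij by simp
      then show "Y $$ (i, j) = 0\<^sub>m n n $$ (i, j)" using ij Y(1) by simp
    qed (use Y(1) in auto)
    then show ?thesis ..
  qed
qed

text \<open>Over the complex numbers \<open>Y\<close> has an eigenvalue, and the eigenspace is
  invariant, hence the whole space.\<close>

lemma schur_scalar:
  assumes "irreducible_weyl_rep R n \<rho>" "intertwines R n \<rho> \<rho> Y"
  obtains c where "Y = c \<cdot>\<^sub>m 1\<^sub>m n"
proof -
  have Y: "Y \<in> carrier_mat n n" "\<And>w. w \<in> weyl_group R \<Longrightarrow> \<rho> w * Y = Y * \<rho> w"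
    using assms(2) by (auto simp: intertwines_def)
  from spectrum_non_empty[OF Y(1)] irreducible_weyl_repD(1)[OF assms(1)] obtain c where "eigenvalue Y c"
    by (auto simp: spectrum_def)
  then obtain v where v: "v \<in> carrier_vec n" "v \<noteq> 0\<^sub>v n" "Y *\<^sub>v v = c \<cdot>\<^sub>v v"
    using Y(1) by (auto simp: eigenvalue_def eigenvector_def)
  define U where "U = {x \<in> carrier_vec n. Y *\<^sub>v x = c \<cdot>\<^sub>v x}"
  have "U = {0\<^sub>v n} \<or> U = carrier_vec n"
  proof (rule irreducible_weyl_repD(5)[OF assms(1)])
    show "vec_subspace n U" unfolding U_def by (rule vec_subspace_eigenspace[OF Y(1)])
    fix w u assume w: "w \<in> weyl_group R" and "u \<in> U"
    then have u: "u \<in> carrier_vec n" "Y *\<^sub>v u = c \<cdot>\<^sub>v u" by (auto simp: U_def)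
    note cw = irreducible_weyl_repD(2)[OF assms(1) w]
    have "Y *\<^sub>v (\<rho> w *\<^sub>v u) = (\<rho> w * Y) *\<^sub>v u"
      unfolding Y(2)[OF w] by (rule assoc_mult_mat_vec[OF Y(1) cw u(1), symmetric])
    also have "\<dots> = \<rho> w *\<^sub>v (c \<cdot>\<^sub>v u)" using assoc_mult_mat_vec[OF cw Y(1) u(1)] u(2) by simp
    also have "\<dots> = c \<cdot>\<^sub>v (\<rho> w *\<^sub>v u)" by (rule mult_mat_vec[OF cw u(1)])
    finally show "\<rho> w *\<^sub>v u \<in> U" using cw u(1) by (simp add: U_def)
  qed
  moreover have "v \<in> U" using v by (simp add: U_def)
  ultimately have all: "U = carrier_vec n" using v(2) by blast
  have "Y = c \<cdot>\<^sub>m 1\<^sub>m n"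
  proof (rule eq_matI)
    fix i j assume ij: "i < dim_row (c \<cdot>\<^sub>m 1\<^sub>m n)" "j < dim_col (c \<cdot>\<^sub>m 1\<^sub>m n)"
    have "unit_vec n j \<in> U" using all by simp
    then have "Y *\<^sub>v unit_vec n j = c \<cdot>\<^sub>v unit_vec n j" unfolding U_def by blast
    then have "col Y j = c \<cdot>\<^sub>v unit_vec n j" using mult_unit_vec_col[OF Y(1)] ij by simp
    then have "col Y j $ i = (c \<cdot>\<^sub>v unit_vec n j) $ i" by simp
    then show "Y $$ (i, j) = (c \<cdot>\<^sub>m 1\<^sub>m n) $$ (i, j)" using ij Y(1) by simp
  qed (use Y(1) in auto)
  then show thesis by (rule that)
qed

text \<open>The matrix is \<open>\<Sum>\<^sub>w \<rho>(w) E\<^sub>i\<^sub>j \<rho>'(w\<inverse>)\<close> for the matrix unit \<open>E\<^sub>i\<^sub>j\<close>.\<close>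

lemma averaged_intertwines:
  assumes R: "root_system R" and \<rho>: "irreducible_weyl_rep R n \<rho>" "irreducible_weyl_rep R n \<rho>'"
    and "i < n" "j < n"
  shows "intertwines R n \<rho> \<rho>'
    (mat n n (\<lambda>(a, b). \<Sum>w\<in>weyl_group R. \<rho> w $$ (a, i) * \<rho>' (inv_into UNIV w) $$ (j, b)))"
    (is "intertwines R n \<rho> \<rho>' ?Y")
  unfolding intertwines_def
proof (intro conjI ballI)
  let ?W = "weyl_group R"
  fix h assume h: "h \<in> ?W"
  note c = irreducible_weyl_repD(2)[OF \<rho>(1)] irreducible_weyl_repD(2)[OF \<rho>(2)]
  note inv = weyl_inv[OF R] and bij = weyl_bij[OF R]
  have invc: "inv_into UNIV (h \<circ> w) = inv_into UNIV w \<circ> inv_into UNIV h" if "w \<in> ?W" for w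
    using that h bij by (intro o_inv_distrib)
  have hh: "inv_into UNIV h \<circ> h = id" "h \<circ> inv_into UNIV h = id"
    using bij[OF h] by (auto simp: bij_def surj_iff)
  \<comment> \<open>Left translation by \<open>h\<close> permutes the group: it absorbs
    \<open>\<rho> h\<close> into the summation variable and releases \<open>\<rho>' h\<close> on the
    right.\<close>
  have reindex: "bij_betw (\<lambda>w. h \<circ> w) ?W ?W"
  proof (rule bij_betw_byWitness[where f' = "\<lambda>w. inv_into UNIV h \<circ> w"])
    show "\<forall>w\<in>?W. inv_into UNIV h \<circ> (h \<circ> w) = w" "\<forall>w\<in>?W. h \<circ> (inv_into UNIV h \<circ> w) = w"
      using hh by (simp_all add: o_assoc)
  qed (use h inv weyl_comp in auto)
  show "\<rho> h * ?Y = ?Y * \<rho>' h"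
  proof (rule eq_matI)
    fix a b assume "a < dim_row (?Y * \<rho>' h)" "b < dim_col (?Y * \<rho>' h)"
    then have a: "a < n" and b: "b < n" using c(2)[OF h] by auto
    have "(\<rho> h * ?Y) $$ (a, b) = (\<Sum>l<n. \<rho> h $$ (a, l) * (\<Sum>w\<in>?W. \<rho> w $$ (l, i) * \<rho>' (inv_into UNIV w) $$ (j, b)))"
      using a b c(1)[OF h] by (simp add: scalar_prod_def atLeast0LessThan)
    also have "\<dots> = (\<Sum>w\<in>?W. (\<Sum>l<n. \<rho> h $$ (a, l) * \<rho> w $$ (l, i)) * \<rho>' (inv_into UNIV w) $$ (j, b))"
      unfolding sum_distrib_left sum_distrib_right by (subst sum.swap) (simp add: mult.assoc)
    also have "\<dots> = (\<Sum>w\<in>?W. \<rho> (h \<circ> w) $$ (a, i) * \<rho>' (inv_into UNIV w) $$ (j, b))"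
    proof (rule sum.cong[OF refl])
      fix w assume w: "w \<in> ?W"
      have "\<rho> (h \<circ> w) $$ (a, i) = (\<Sum>l<n. \<rho> h $$ (a, l) * \<rho> w $$ (l, i))"
        unfolding irreducible_weyl_repD(4)[OF \<rho>(1) h w]
        using a \<open>i < n\<close> c(1)[OF h] c(1)[OF w] by (simp add: scalar_prod_def atLeast0LessThan)
      then show "(\<Sum>l<n. \<rho> h $$ (a, l) * \<rho> w $$ (l, i)) * \<rho>' (inv_into UNIV w) $$ (j, b) =
          \<rho> (h \<circ> w) $$ (a, i) * \<rho>' (inv_into UNIV w) $$ (j, b)" by simp
    qed
    also have "\<dots> = (\<Sum>w\<in>?W. \<rho> (h \<circ> w) $$ (a, i) * \<rho>' (inv_into UNIV (h \<circ> w) \<circ> h) $$ (j, b))"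
      using hh invc by (intro sum.cong refl) (simp add: comp_assoc)
    also have "\<dots> = (\<Sum>w\<in>?W. \<rho> w $$ (a, i) * \<rho>' (inv_into UNIV w \<circ> h) $$ (j, b))"
      by (rule sum.reindex_bij_betw[OF reindex])
    also have "\<dots> = (\<Sum>w\<in>?W. \<rho> w $$ (a, i) * (\<Sum>l<n. \<rho>' (inv_into UNIV w) $$ (j, l) * \<rho>' h $$ (l, b)))"
    proof (rule sum.cong[OF refl])
      fix w assume w: "w \<in> ?W"
      have "\<rho>' (inv_into UNIV w \<circ> h) $$ (j, b) = (\<Sum>l<n. \<rho>' (inv_into UNIV w) $$ (j, l) * \<rho>' h $$ (l, b))"
        unfolding irreducible_weyl_repD(4)[OF \<rho>(2) inv[OF w] h]
        using b \<open>j < n\<close> c(2)[OF h] c(2)[OF inv[OF w]] by (simp add: scalar_prod_def atLeast0LessThan)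
      then show "\<rho> w $$ (a, i) * \<rho>' (inv_into UNIV w \<circ> h) $$ (j, b) =
          \<rho> w $$ (a, i) * (\<Sum>l<n. \<rho>' (inv_into UNIV w) $$ (j, l) * \<rho>' h $$ (l, b))" by simp
    qed
    also have "\<dots> = (\<Sum>l<n. (\<Sum>w\<in>?W. \<rho> w $$ (a, i) * \<rho>' (inv_into UNIV w) $$ (j, l)) * \<rho>' h $$ (l, b))"
      unfolding sum_distrib_left sum_distrib_right by (subst sum.swap) (simp add: mult.assoc)
    also have "\<dots> = (?Y * \<rho>' h) $$ (a, b)"
      using a b c(2)[OF h] by (simp add: scalar_prod_def atLeast0LessThan)
    finally show "(\<rho> h * ?Y) $$ (a, b) = (?Y * \<rho>' h) $$ (a, b)" .
  qed (use c[OF h] in auto)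
qed simp

lemma character_product_sum:
  shows "(\<Sum>w\<in>G. (\<Sum>i<n. \<rho> w $$ (i, i)) * (\<Sum>j<n. \<rho>' (f w) $$ (j, j))) =
    (\<Sum>i<n. \<Sum>j<n. (\<Sum>w\<in>G. \<rho> w $$ (i, i) * (\<rho>' (f w) $$ (j, j) :: complex)))"
proof -
  have "(\<Sum>w\<in>G. (\<Sum>i<n. \<rho> w $$ (i, i)) * (\<Sum>j<n. \<rho>' (f w) $$ (j, j))) =
     (\<Sum>w\<in>G. \<Sum>i<n. \<Sum>j<n. \<rho> w $$ (i, i) * \<rho>' (f w) $$ (j, j))" by (simp add: sum_product)
  also have "\<dots> = (\<Sum>i<n. \<Sum>w\<in>G. \<Sum>j<n. \<rho> w $$ (i, i) * \<rho>' (f w) $$ (j, j))" by (rule sum.swap)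
  also have "\<dots> = (\<Sum>i<n. \<Sum>j<n. \<Sum>w\<in>G. \<rho> w $$ (i, i) * \<rho>' (f w) $$ (j, j))"
    by (rule sum.cong[OF refl], rule sum.swap)
  finally show ?thesis .
qed

text \<open>By Schur's lemma each averaged matrix unit E_ij is scalar, and its trace shows the
  scalar to be the group order over \<open>n\<close> for i = j and 0 otherwise; the (i, j) entries
  of these averages sum to the norm. Pairing each element with its inverse takes the place of
  complex conjugation.\<close>

lemma character_norm:
  assumes R: "root_system R" and \<rho>: "irreducible_weyl_rep R n \<rho>"
  shows "(\<Sum>w\<in>weyl_group R. (\<Sum>i<n. \<rho> w $$ (i, i)) * (\<Sum>j<n. \<rho> (inv_into UNIV w) $$ (j, j))) =
    of_nat (card (weyl_group R))"
proof -
  let ?W = "weyl_group R"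
  note c = irreducible_weyl_repD(2)[OF \<rho>]
  have entry: "(\<Sum>w\<in>?W. \<rho> w $$ (i, i) * \<rho> (inv_into UNIV w) $$ (j, j)) =
      (if i = j then of_nat (card ?W) / of_nat n else 0)" if ij: "i < n" "j < n" for i j
  proof -
    let ?Y = "mat n n (\<lambda>(a, b). \<Sum>w\<in>?W. \<rho> w $$ (a, i) * \<rho> (inv_into UNIV w) $$ (j, b))"
    obtain d where d: "?Y = d \<cdot>\<^sub>m 1\<^sub>m n"
      using schur_scalar[OF \<rho> averaged_intertwines[OF R \<rho> \<rho> ij]] .
    have Yab: "(\<Sum>w\<in>?W. \<rho> w $$ (a, i) * \<rho> (inv_into UNIV w) $$ (j, b)) = (if a = b then d else 0)"
      if "a < n" "b < n" for a b
      using arg_cong[OF d, of "\<lambda>X. X $$ (a, b)"] that by simp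
    \<comment> \<open>The trace of the scalar matrix, evaluated a second time by cyclicity: in each
      term the matrices of the inverse of \<open>w\<close> and of \<open>w\<close> multiply to the
      identity.\<close>
    have "of_nat n * d = (\<Sum>a<n. \<Sum>w\<in>?W. \<rho> w $$ (a, i) * \<rho> (inv_into UNIV w) $$ (j, a))"
      using Yab by simp
    also have "\<dots> = (\<Sum>w\<in>?W. \<Sum>a<n. \<rho> (inv_into UNIV w) $$ (j, a) * \<rho> w $$ (a, i))"
      by (subst sum.swap) (simp add: mult.commute)
    also have "\<dots> = (\<Sum>w\<in>?W. if i = j then 1 else 0)"
    proof (rule sum.cong[OF refl])
      fix w assume w: "w \<in> ?W"
      have iw: "inv_into UNIV w \<in> ?W" by (rule weyl_inv[OF R w])
      have "inv_into UNIV w \<circ> w = id" using weyl_bij[OF R w] by (auto simp: bij_def)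
      then have "\<rho> (inv_into UNIV w) * \<rho> w = 1\<^sub>m n"
        using irreducible_weyl_repD(3,4)[OF \<rho>] iw w by metis
      then have "(\<rho> (inv_into UNIV w) * \<rho> w) $$ (j, i) = (if i = j then 1 else 0)" using ij by auto
      then show "(\<Sum>a<n. \<rho> (inv_into UNIV w) $$ (j, a) * \<rho> w $$ (a, i)) = (if i = j then 1 else 0)"
        using ij c[OF w] c[OF iw] by (simp add: scalar_prod_def atLeast0LessThan)
    qed
    finally have "of_nat n * d = (if i = j then of_nat (card ?W) else 0)" by simp
    moreover have "(of_nat n :: complex) \<noteq> 0" using irreducible_weyl_repD(1)[OF \<rho>] by simp
    ultimately have "i = j \<Longrightarrow> d = of_nat (card ?W) / of_nat n" by (simp add: field_simps)
    then show ?thesis using Yab[OF ij] by simp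
  qed
  have "(\<Sum>w\<in>?W. (\<Sum>i<n. \<rho> w $$ (i, i)) * (\<Sum>j<n. \<rho> (inv_into UNIV w) $$ (j, j))) =
      (\<Sum>i<n. \<Sum>j<n. if i = j then of_nat (card ?W) / of_nat n else 0)"
    unfolding character_product_sum using entry by simp
  also have "\<dots> = of_nat (card ?W)" using irreducible_weyl_repD(1)[OF \<rho>] by simp
  finally show ?thesis .
qed

text \<open>The value of a character at the identity is its degree, and \<open>of_nat\<close> is
  injective into the complex numbers.\<close>

lemma equal_characters_degree:
  assumes "irreducible_weyl_rep R n \<rho>" "irreducible_weyl_rep R n' \<rho>'"
    "weyl_character R n \<rho> = weyl_character R n' \<rho>'"
  shows "n' = n"
proof -
  have "weyl_character R n \<rho> id = of_nat n" "weyl_character R n' \<rho>' id = of_nat n'"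
    using irreducible_weyl_repD(3)[OF assms(1)] irreducible_weyl_repD(3)[OF assms(2)] weyl_id[of R]
    by (simp_all add: weyl_character_def)
  then have "(of_nat n' :: complex) = of_nat n" using assms(3) by metis
  then show ?thesis by simp
qed

text \<open>Without an injective intertwiner all averaged matrix units vanish and the characters are
  orthogonal; being equal, they pair to the group order instead. This makes the choice in
  \<open>rep_of_character\<close> harmless.\<close>

lemma equal_characters_isomorphic:
  assumes R: "root_system R" and \<rho>: "irreducible_weyl_rep R n \<rho>" "irreducible_weyl_rep R n \<rho>'"
    and eq: "weyl_character R n \<rho> = weyl_character R n \<rho>'"
  obtains Y where "intertwines R n \<rho> \<rho>' Y" "inj_mat n Y"
proof -
  let ?W = "weyl_group R"
  have char: "(\<Sum>i<n. \<rho> w $$ (i, i)) = (\<Sum>i<n. \<rho>' w $$ (i, i))" if "w \<in> ?W" for w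
    using fun_cong[OF eq, of w] that by (simp add: weyl_character_def)
  have "\<exists>Y. intertwines R n \<rho> \<rho>' Y \<and> inj_mat n Y"
  proof (rule ccontr)
    assume "\<nexists>Y. intertwines R n \<rho> \<rho>' Y \<and> inj_mat n Y"
    then have zero: "Y = 0\<^sub>m n n" if "intertwines R n \<rho> \<rho>' Y" for Y
      using schur_zero_or_inj[OF \<rho> that] that by blast
    have "(\<Sum>w\<in>?W. \<rho> w $$ (i, i) * \<rho>' (inv_into UNIV w) $$ (j, j)) = 0" if ij: "i < n" "j < n" for i j
      using arg_cong[OF zero[OF averaged_intertwines[OF R \<rho> ij]], of "\<lambda>X. X $$ (i, j)"] ij by simp
    then have "(\<Sum>w\<in>?W. (\<Sum>i<n. \<rho> w $$ (i, i)) * (\<Sum>j<n. \<rho>' (inv_into UNIV w) $$ (j, j))) = 0"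
      unfolding character_product_sum by simp
    moreover have "(\<Sum>w\<in>?W. (\<Sum>i<n. \<rho> w $$ (i, i)) * (\<Sum>j<n. \<rho>' (inv_into UNIV w) $$ (j, j))) =
      (\<Sum>w\<in>?W. (\<Sum>i<n. \<rho> w $$ (i, i)) * (\<Sum>j<n. \<rho> (inv_into UNIV w) $$ (j, j)))"
      using char weyl_inv[OF R] by (intro sum.cong refl) simp
    ultimately have "card ?W = 0" using character_norm[OF R \<rho>(1)] by simp
    then show False using finite_weyl_group[OF R] weyl_id[of R] by auto
  qed
  then show thesis using that by blast
qed


section \<open>Modules generated by a lowest weight space\<close>

locale H_module = dunkl_setup R Rp k + L: left_module "cherednik_algebra R Rp k" M
  for R Rp :: "('a::euclidean_space \<Rightarrow> real) set" and k and M :: "('a operator, 'm) module"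
begin

abbreviation sc :: "complex \<Rightarrow> 'm \<Rightarrow> 'm" where "sc c x \<equiv> scalar_op c \<odot>\<^bsub>M\<^esub> x"

lemma act_add: "a \<in> carrier H \<Longrightarrow> b \<in> carrier H \<Longrightarrow> x \<in> carrier M \<Longrightarrow>
    (a \<oplus>\<^bsub>end_ring\<^esub> b) \<odot>\<^bsub>M\<^esub> x = a \<odot>\<^bsub>M\<^esub> x \<oplus>\<^bsub>M\<^esub> b \<odot>\<^bsub>M\<^esub> x"
  using L.smult_l_distr[of a b x] by simp

lemma act_mult: "a \<in> carrier H \<Longrightarrow> b \<in> carrier H \<Longrightarrow> x \<in> carrier M \<Longrightarrow>
    (a \<otimes>\<^bsub>end_ring\<^esub> b) \<odot>\<^bsub>M\<^esub> x = a \<odot>\<^bsub>M\<^esub> (b \<odot>\<^bsub>M\<^esub> x)"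
  using L.smult_assoc[of a b x] by simp

lemma act_one: "x \<in> carrier M \<Longrightarrow> \<one>\<^bsub>end_ring\<^esub> \<odot>\<^bsub>M\<^esub> x = x"
  using L.smult_one[of x] by simp

sublocale C: complex_space M sc
proof (unfold_locales)
  fix x c d assume "x \<in> carrier M"
  then show "sc c x \<in> carrier M" "sc (c + d) x = sc c x \<oplus>\<^bsub>M\<^esub> sc d x" "sc (c * d) x = sc c (sc d x)"
    "sc 1 x = x"
    by (simp_all add: generators_in_H L.smult_closed scalar_op_add scalar_op_mult scalar_op_one act_add act_mult act_one)
qed (simp add: generators_in_H L.smult_r_distr)

lemma act_scalar_commute:
  assumes "a \<in> carrier H" "x \<in> carrier M" shows "a \<odot>\<^bsub>M\<^esub> sc c x = sc c (a \<odot>\<^bsub>M\<^esub> x)"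
proof -
  have "a \<otimes>\<^bsub>end_ring\<^esub> scalar_op c = scalar_op c \<otimes>\<^bsub>end_ring\<^esub> a"
    using scalar_op_commute[of a c] assms(1) H_subset by auto
  then show ?thesis using act_mult assms generators_in_H(1) by metis
qed

lemma minus_scalar: "x \<in> carrier M \<Longrightarrow> \<ominus>\<^bsub>M\<^esub> x = sc (-1) x"
  using C.s_add_left[of x "-1" 1] C.s_one C.s_zero_left C.s_closed by (metis L.M.minus_equality add.left_inverse)

lemma generate_preserves:
  assumes "G \<subseteq> carrier H" "X \<subseteq> carrier M"
    and "\<And>x y. x \<in> X \<Longrightarrow> y \<in> X \<Longrightarrow> x \<oplus>\<^bsub>M\<^esub> y \<in> X" "\<And>c x. x \<in> X \<Longrightarrow> sc c x \<in> X"
    and "\<And>g x. g \<in> G \<Longrightarrow> x \<in> X \<Longrightarrow> g \<odot>\<^bsub>M\<^esub> x \<in> X" "a \<in> generate_ring end_ring G" "x \<in> X"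
  shows "a \<odot>\<^bsub>M\<^esub> x \<in> X"
proof (rule E.generate_ring_preserves[OF subring_H _ assms(1)])
  have "H = end_ring\<lparr>carrier := carrier H\<rparr>" by (simp add: H_eq)
  then show "left_module (end_ring\<lparr>carrier := carrier H\<rparr>) M" using L.left_module_axioms by metis
  fix x assume "x \<in> X"
  then show "\<ominus>\<^bsub>M\<^esub> x \<in> X" using assms(2,4) minus_scalar by (metis subsetD)
qed (use assms in auto)

end

text \<open>Common to the given simple module and to the Verma module: an equivariant linear map
  into vectors killed by the Dunkl operators, all of Euler eigenvalue \<mu>.
  \<open>lowest_weight\<close> adds that the image generates, \<open>embedded_rep\<close> that the
  map is injective.\<close>

locale weight_space = H_module R Rp k M
  for R Rp :: "('a::euclidean_space \<Rightarrow> real) set" and k and M :: "('a operator, 'm) module" +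
  fixes n :: nat and \<rho> :: "('a \<Rightarrow> 'a) \<Rightarrow> complex mat" and t :: "complex vec \<Rightarrow> 'm" and \<mu> :: complex
  assumes rep: "irreducible_weyl_rep R n \<rho>"
    and t_closed: "u \<in> carrier_vec n \<Longrightarrow> t u \<in> carrier M"
    and t_add: "u \<in> carrier_vec n \<Longrightarrow> v \<in> carrier_vec n \<Longrightarrow> t (u + v) = t u \<oplus>\<^bsub>M\<^esub> t v"
    and t_scalar: "u \<in> carrier_vec n \<Longrightarrow> t (c \<cdot>\<^sub>v u) = sc c (t u)"
    and t_weyl: "w \<in> W \<Longrightarrow> u \<in> carrier_vec n \<Longrightarrow> t (\<rho> w *\<^sub>v u) = weyl_op w \<odot>\<^bsub>M\<^esub> t u"
    and t_dunkl: "u \<in> carrier_vec n \<Longrightarrow> T y \<odot>\<^bsub>M\<^esub> t u = \<zero>\<^bsub>M\<^esub>"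
    and t_euler: "u \<in> carrier_vec n \<Longrightarrow> euler_op \<odot>\<^bsub>M\<^esub> t u = sc \<mu> (t u)"
begin

lemma t_zero: "t (0\<^sub>v n) = \<zero>\<^bsub>M\<^esub>"
proof -
  have "0 \<cdot>\<^sub>v 0\<^sub>v n = (0\<^sub>v n :: complex vec)" by (intro eq_vecI) auto
  then have "t (0\<^sub>v n) = sc 0 (t (0\<^sub>v n))" using t_scalar[of "0\<^sub>v n" 0] by simp
  then show ?thesis using C.s_zero_left[OF t_closed[of "0\<^sub>v n"]] by simp
qed

end

locale lowest_weight = weight_space R Rp k M n \<rho> t \<mu>
  for R Rp :: "('a::euclidean_space \<Rightarrow> real) set" and k and M :: "('a operator, 'm) module"
    and n \<rho> t \<mu> +
  assumes t_generates: "Module.submodule N H M \<Longrightarrow> t ` carrier_vec n \<subseteq> N \<Longrightarrow> N = carrier M"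
begin

text \<open>Degrees are spans with no directness built in; the Euler eigenvalues of
  \<open>graded_euler\<close> separate them. Scalars are absorbed by the base vectors.\<close>

inductive graded :: "nat \<Rightarrow> 'm \<Rightarrow> bool" where
  graded_base: "u \<in> carrier_vec n \<Longrightarrow> graded 0 (t u)"
| graded_mult: "graded d m \<Longrightarrow> linear x \<Longrightarrow> graded (Suc d) (mult_op x \<odot>\<^bsub>M\<^esub> m)"
| graded_add: "graded d a \<Longrightarrow> graded d b \<Longrightarrow> graded d (a \<oplus>\<^bsub>M\<^esub> b)"

text \<open>\<open>decomp d a m\<close>: \<open>a\<close> is a sum of terms of degrees \<open>0, \<dots>, d\<close> whose term of degree \<open>0\<close> is \<open>m\<close>.\<close>

inductive decomp :: "nat \<Rightarrow> 'm \<Rightarrow> 'm \<Rightarrow> bool" where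
  decomp_base: "graded 0 m \<Longrightarrow> decomp 0 m m"
| decomp_step: "decomp d a m \<Longrightarrow> graded (Suc d) b \<Longrightarrow> decomp (Suc d) (a \<oplus>\<^bsub>M\<^esub> b) m"

section \<open>Action of the generators on graded elements\<close>

lemma graded_closed: "graded d m \<Longrightarrow> m \<in> carrier M"
  by (induction rule: graded.induct) (simp_all add: t_closed L.smult_closed generators_in_H)

lemma graded_zero: "graded d \<zero>\<^bsub>M\<^esub>"
proof (induction d)
  case 0
  then show ?case using graded_base[of "0\<^sub>v n"] t_zero by simp
next
  case (Suc d)
  have "linear (\<lambda>_::'a. 0::complex)" by (simp add: module_hom_zero)
  from graded_mult[OF Suc this] show ?case
    using L.smult_r_zero[OF generators_in_H(3)[OF \<open>linear (\<lambda>_. 0)\<close>]] by simp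
qed

lemma graded_0D: "graded 0 m \<Longrightarrow> \<exists>u\<in>carrier_vec n. m = t u"
proof (induction "0::nat" m rule: graded.induct)
  case (graded_add a b)
  then obtain u v where "u \<in> carrier_vec n" "v \<in> carrier_vec n" "a = t u" "b = t v" by blast
  then show ?case by (intro bexI[of _ "u + v"]) (auto simp: t_add)
qed blast

lemma graded_scalar: "graded d m \<Longrightarrow> graded d (sc c m)"
proof (induction rule: graded.induct)
  case (graded_base u)
  then show ?case using graded.graded_base[of "c \<cdot>\<^sub>v u"] t_scalar by simp
next
  case (graded_mult d m x)
  have "mult_op x \<odot>\<^bsub>M\<^esub> sc c m = sc c (mult_op x \<odot>\<^bsub>M\<^esub> m)"
    using graded_mult graded_closed generators_in_H by (intro act_scalar_commute) auto
  then show ?case using graded.graded_mult[OF graded_mult(3,2)] by simp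
next
  case (graded_add d a b)
  then show ?case using graded_closed C.s_add_right graded.graded_add by metis
qed

text \<open>A group element passes a linear form by replacing it with its image, so the number of
  factors is unchanged.\<close>

lemma graded_weyl:
  assumes "w \<in> W" shows "graded d m \<Longrightarrow> graded d (weyl_op w \<odot>\<^bsub>M\<^esub> m)"
proof (induction rule: graded.induct)
  case (graded_base u)
  then show ?case
    using graded.graded_base[of "\<rho> w *\<^sub>v u"] t_weyl[OF assms] irreducible_weyl_repD(2)[OF rep assms] by simp
next
  case (graded_mult d m x)
  note mc = graded_closed[OF graded_mult(1)] and x = weyl_mult_op[OF assms graded_mult(2)]
  have "weyl_op w \<odot>\<^bsub>M\<^esub> (mult_op x \<odot>\<^bsub>M\<^esub> m) = (weyl_op w \<otimes>\<^bsub>end_ring\<^esub> mult_op x) \<odot>\<^bsub>M\<^esub> m"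
    by (rule act_mult[symmetric]) (use assms graded_mult(2) mc generators_in_H in auto)
  also have "\<dots> = mult_op (x \<circ> inv_into UNIV w) \<odot>\<^bsub>M\<^esub> (weyl_op w \<odot>\<^bsub>M\<^esub> m)"
    unfolding x(2) by (rule act_mult) (use assms x(1) mc generators_in_H in auto)
  finally show ?case using graded.graded_mult[OF graded_mult(3) x(1)] by simp
next
  case (graded_add d a b)
  then show ?case
    using graded_closed L.smult_r_distr[OF generators_in_H(2)[OF assms]] graded.graded_add by metis
qed

lemma graded_group_algebra:
  assumes "a \<in> group_algebra" "graded d m" shows "graded d (a \<odot>\<^bsub>M\<^esub> m)"
proof -
  have "a \<odot>\<^bsub>M\<^esub> m \<in> {m. graded d m}"
  proof (rule generate_preserves[where G = "range scalar_op \<union> weyl_op ` W"])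
    show "a \<in> generate_ring end_ring (range scalar_op \<union> weyl_op ` W)" using assms(1) by (simp add: group_algebra_def)
  qed (use assms(2) graded_closed graded_add graded_scalar graded_weyl generators_in_H in auto)
  then show ?thesis by simp
qed

text \<open>Commuting \<open>T y\<close> past a linear form leaves the bracket, which keeps the
  degree of the remaining factor; inductively the degree drops by one. The case split lets a single
  induction cover degree 0, where the result is zero.\<close>

lemma graded_dunkl: "graded d m \<Longrightarrow> (case d of 0 \<Rightarrow> T y \<odot>\<^bsub>M\<^esub> m = \<zero>\<^bsub>M\<^esub> | Suc e \<Rightarrow> graded e (T y \<odot>\<^bsub>M\<^esub> m))"
proof (induction rule: graded.induct)
  case (graded_base u)
  then show ?case by (simp add: t_dunkl)
next
  case (graded_mult d m x)
  note mc = graded_closed[OF graded_mult(1)]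
  have br: "bracket_op y x \<in> group_algebra" by (rule bracket_op_group_algebra)
  then have brH: "bracket_op y x \<in> carrier H" using group_algebra_subset_H by blast
  note gen = generators_in_H(3)[OF graded_mult(2)] generators_in_H(4)
  have gH: "mult_op x \<otimes>\<^bsub>end_ring\<^esub> T y \<in> carrier H" using subringE(6)[OF subring_H] gen by metis
  have "T y \<odot>\<^bsub>M\<^esub> (mult_op x \<odot>\<^bsub>M\<^esub> m) = (T y \<otimes>\<^bsub>end_ring\<^esub> mult_op x) \<odot>\<^bsub>M\<^esub> m"
    by (rule act_mult[symmetric, OF gen(2,1) mc])
  also have "\<dots> = mult_op x \<odot>\<^bsub>M\<^esub> (T y \<odot>\<^bsub>M\<^esub> m) \<oplus>\<^bsub>M\<^esub> bracket_op y x \<odot>\<^bsub>M\<^esub> m"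
    unfolding dunkl_mult_op[OF graded_mult(2)] act_add[OF gH brH mc] act_mult[OF gen mc] ..
  finally have eq: "T y \<odot>\<^bsub>M\<^esub> (mult_op x \<odot>\<^bsub>M\<^esub> m) =
      mult_op x \<odot>\<^bsub>M\<^esub> (T y \<odot>\<^bsub>M\<^esub> m) \<oplus>\<^bsub>M\<^esub> bracket_op y x \<odot>\<^bsub>M\<^esub> m" .
  have b: "graded d (bracket_op y x \<odot>\<^bsub>M\<^esub> m)" by (rule graded_group_algebra[OF br graded_mult(1)])
  show ?case
  proof (cases d)
    case 0
    then have "T y \<odot>\<^bsub>M\<^esub> m = \<zero>\<^bsub>M\<^esub>" using graded_mult(3) by simp
    then show ?thesis using 0 b graded_closed[OF b] by (simp add: eq L.smult_r_zero[OF gen(1)])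
  next
    case (Suc e)
    then have "graded d (mult_op x \<odot>\<^bsub>M\<^esub> (T y \<odot>\<^bsub>M\<^esub> m))"
      using graded_mult(2,3) graded.graded_mult by simp
    then show ?thesis using b by (simp add: eq graded_add)
  qed
next
  case (graded_add d a b)
  have "T y \<odot>\<^bsub>M\<^esub> (a \<oplus>\<^bsub>M\<^esub> b) = T y \<odot>\<^bsub>M\<^esub> a \<oplus>\<^bsub>M\<^esub> T y \<odot>\<^bsub>M\<^esub> b"
    using graded_add graded_closed generators_in_H by (intro L.smult_r_distr) auto
  then show ?case using graded_add by (cases d) (auto intro: graded.graded_add)
qed

lemma graded_euler: "graded d m \<Longrightarrow> euler_op \<odot>\<^bsub>M\<^esub> m = sc (\<mu> + of_nat d) m"
proof (induction rule: graded.induct)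
  case (graded_base u)
  then show ?case by (simp add: t_euler)
next
  case (graded_mult d m x)
  note mc = graded_closed[OF graded_mult(1)]
  note gen = generators_in_H(3)[OF graded_mult(2)]
  have gH: "mult_op x \<otimes>\<^bsub>end_ring\<^esub> euler_op \<in> carrier H"
    using subringE(6)[OF subring_H gen euler_op_H] .
  have xm: "mult_op x \<odot>\<^bsub>M\<^esub> m \<in> carrier M" by (rule L.smult_closed[OF gen mc])
  have "euler_op \<odot>\<^bsub>M\<^esub> (mult_op x \<odot>\<^bsub>M\<^esub> m) = (euler_op \<otimes>\<^bsub>end_ring\<^esub> mult_op x) \<odot>\<^bsub>M\<^esub> m"
    by (rule act_mult[symmetric, OF euler_op_H gen mc])
  also have "\<dots> = mult_op x \<odot>\<^bsub>M\<^esub> (euler_op \<odot>\<^bsub>M\<^esub> m) \<oplus>\<^bsub>M\<^esub> mult_op x \<odot>\<^bsub>M\<^esub> m"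
    unfolding euler_mult_op[OF graded_mult(2)] act_add[OF gH gen mc] act_mult[OF gen euler_op_H mc] ..
  also have "\<dots> = sc (\<mu> + of_nat d) (mult_op x \<odot>\<^bsub>M\<^esub> m) \<oplus>\<^bsub>M\<^esub> sc 1 (mult_op x \<odot>\<^bsub>M\<^esub> m)"
    unfolding graded_mult(3) act_scalar_commute[OF gen mc] C.s_one[OF xm] ..
  also have "\<dots> = sc (\<mu> + of_nat (Suc d)) (mult_op x \<odot>\<^bsub>M\<^esub> m)"
    unfolding C.s_add_left[OF xm, symmetric] by (simp add: add_ac)
  finally show ?case .
next
  case (graded_add d a b)
  note c = graded_closed[OF graded_add(1)] graded_closed[OF graded_add(2)]
  show ?case unfolding L.smult_r_distr[OF euler_op_H c] graded_add(3,4) C.s_add_right[OF c] ..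
qed

section \<open>Leading terms of elements of the module\<close>

lemma decomp_closed: "decomp d a m \<Longrightarrow> a \<in> carrier M"
  by (induction rule: decomp.induct) (use graded_closed in auto)

lemma decomp_leading: "decomp d a m \<Longrightarrow> graded 0 m"
  by (induction rule: decomp.induct)

text \<open>Padding by a zero top term; it brings two elements to a common number of terms before
  they are added.\<close>

lemma decomp_Suc: "decomp d a m \<Longrightarrow> decomp (Suc d) a m"
  using decomp_step[OF _ graded_zero] decomp_closed L.M.r_zero by metis

lemma decomp_le: "decomp d a m \<Longrightarrow> d \<le> e \<Longrightarrow> decomp e a m"
  by (rotate_tac, induction rule: dec_induct) (auto intro: decomp_Suc)

lemma decomp_add: "decomp d a m \<Longrightarrow> decomp d a' m' \<Longrightarrow> decomp d (a \<oplus>\<^bsub>M\<^esub> a') (m \<oplus>\<^bsub>M\<^esub> m')"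
proof (induction arbitrary: a' m' rule: decomp.induct)
  case (decomp_base m)
  from decomp_base(2,1) show ?case by cases (auto intro: decomp.decomp_base graded_add)
next
  case (decomp_step d a m b)
  from decomp_step.prems show ?case
  proof cases
    case (decomp_step a2 b2)
    have c: "a \<in> carrier M" "a2 \<in> carrier M" "b \<in> carrier M" "b2 \<in> carrier M"
      using decomp_closed graded_closed \<open>decomp d a m\<close> \<open>graded (Suc d) b\<close> decomp_step by blast+
    have "decomp (Suc d) ((a \<oplus>\<^bsub>M\<^esub> a2) \<oplus>\<^bsub>M\<^esub> (b \<oplus>\<^bsub>M\<^esub> b2)) (m \<oplus>\<^bsub>M\<^esub> m')"
      using decomp_step \<open>graded (Suc d) b\<close> decomp_step.IH by (intro decomp.decomp_step graded_add) auto
    moreover have "(a \<oplus>\<^bsub>M\<^esub> a2) \<oplus>\<^bsub>M\<^esub> (b \<oplus>\<^bsub>M\<^esub> b2) = (a \<oplus>\<^bsub>M\<^esub> b) \<oplus>\<^bsub>M\<^esub> (a2 \<oplus>\<^bsub>M\<^esub> b2)"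
      using c by (simp add: L.M.a_ac)
    ultimately show ?thesis using decomp_step(1) by simp
  qed
qed

text \<open>Serves scalars, group elements and later the shifted Euler field, whose effect on the
  leading term must be known exactly; hence the element and its leading term are transformed
  together.\<close>

lemma decomp_degree_preserving:
  assumes a: "a \<in> carrier H" and gr: "\<And>d m. graded d m \<Longrightarrow> graded d (a \<odot>\<^bsub>M\<^esub> m)"
  shows "decomp d x m \<Longrightarrow> decomp d (a \<odot>\<^bsub>M\<^esub> x) (a \<odot>\<^bsub>M\<^esub> m)"
proof (induction rule: decomp.induct)
  case (decomp_base m)
  then show ?case by (intro decomp.decomp_base gr)
next
  case (decomp_step d x m b)
  have "a \<odot>\<^bsub>M\<^esub> (x \<oplus>\<^bsub>M\<^esub> b) = a \<odot>\<^bsub>M\<^esub> x \<oplus>\<^bsub>M\<^esub> a \<odot>\<^bsub>M\<^esub> b"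
    using decomp_step decomp_closed graded_closed a by (intro L.smult_r_distr) auto
  then show ?case using decomp.decomp_step[OF decomp_step.IH gr[OF decomp_step(2)]] by simp
qed

lemma decomp_scalar: "decomp d x m \<Longrightarrow> decomp d (sc c x) (sc c m)"
  by (rule decomp_degree_preserving) (auto intro: generators_in_H graded_scalar)

lemma decomp_mult:
  assumes "linear x" shows "decomp d a m \<Longrightarrow> decomp (Suc d) (mult_op x \<odot>\<^bsub>M\<^esub> a) \<zero>\<^bsub>M\<^esub>"
proof (induction rule: decomp.induct)
  case (decomp_base m)
  have "decomp (Suc 0) (\<zero>\<^bsub>M\<^esub> \<oplus>\<^bsub>M\<^esub> mult_op x \<odot>\<^bsub>M\<^esub> m) \<zero>\<^bsub>M\<^esub>"
    using decomp_base assms by (intro decomp_step decomp.decomp_base graded_zero graded_mult)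
  then show ?case
    using graded_closed[OF decomp_base] L.smult_closed[OF generators_in_H(3)[OF assms]] by simp
next
  case (decomp_step d a m b)
  have "mult_op x \<odot>\<^bsub>M\<^esub> (a \<oplus>\<^bsub>M\<^esub> b) = mult_op x \<odot>\<^bsub>M\<^esub> a \<oplus>\<^bsub>M\<^esub> mult_op x \<odot>\<^bsub>M\<^esub> b"
    using decomp_step decomp_closed graded_closed generators_in_H assms by (intro L.smult_r_distr) auto
  then show ?case using decomp.decomp_step[OF decomp_step.IH graded_mult[OF decomp_step(2) assms]] by simp
qed

text \<open>For \<open>d = 0\<close> the added term merges with the leading one, so the new leading
  term is only asserted to exist.\<close>

lemma decomp_add_graded:
  assumes "decomp d a m" "graded d b" shows "\<exists>m'. decomp d (a \<oplus>\<^bsub>M\<^esub> b) m'"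
  using assms
proof cases
  case decomp_base
  then show ?thesis using assms(2) decomp.decomp_base graded_add by blast
next
  case (decomp_step e a2 b2)
  have c: "a2 \<in> carrier M" "b \<in> carrier M" "b2 \<in> carrier M"
    using decomp_closed graded_closed decomp_step assms by blast+
  have "decomp d (a2 \<oplus>\<^bsub>M\<^esub> (b2 \<oplus>\<^bsub>M\<^esub> b)) m"
    using decomp_step assms(2) by (auto intro!: decomp.decomp_step graded_add)
  then show ?thesis using decomp_step c by (auto simp: L.M.a_assoc)
qed

lemma decomp_dunkl: "decomp d a m \<Longrightarrow> \<exists>m'. decomp d (T y \<odot>\<^bsub>M\<^esub> a) m'"
proof (induction rule: decomp.induct)
  case (decomp_base m)
  then have "T y \<odot>\<^bsub>M\<^esub> m = \<zero>\<^bsub>M\<^esub>" using graded_dunkl[of 0 m y] by simp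
  then show ?case using decomp.decomp_base[OF graded_zero] by auto
next
  case (decomp_step d a m b)
  have "T y \<odot>\<^bsub>M\<^esub> (a \<oplus>\<^bsub>M\<^esub> b) = T y \<odot>\<^bsub>M\<^esub> a \<oplus>\<^bsub>M\<^esub> T y \<odot>\<^bsub>M\<^esub> b"
    using decomp_step decomp_closed graded_closed generators_in_H by (intro L.smult_r_distr) auto
  moreover have "graded d (T y \<odot>\<^bsub>M\<^esub> b)" using graded_dunkl[OF decomp_step(2)] by simp
  ultimately show ?case using decomp_add_graded decomp_step.IH decomp_Suc by metis
qed

text \<open>The decomposable elements contain the generating space and are stable under each kind of
  generator of the algebra, so they form a submodule that is everything. This takes the role of the
  factorisation M = P \<otimes> V_\<chi>.\<close>

lemma decomp_exists:
  assumes "x \<in> carrier M" shows "\<exists>d m. decomp d x m"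
proof -
  define X where "X = {x. \<exists>d m. decomp d x m}"
  have XI: "decomp d x m \<Longrightarrow> x \<in> X" for d x m by (auto simp: X_def)
  have Xc: "X \<subseteq> carrier M" using decomp_closed by (auto simp: X_def)
  have base: "t u \<in> X" if "u \<in> carrier_vec n" for u
    using that by (intro XI[OF decomp_base] graded_base)
  have add: "x \<oplus>\<^bsub>M\<^esub> y \<in> X" if "x \<in> X" "y \<in> X" for x y
  proof -
    from that obtain d m e m' where "decomp d x m" "decomp e y m'" unfolding X_def by blast
    then have "decomp (max d e) x m" "decomp (max d e) y m'" by (auto intro: decomp_le)
    then show ?thesis using decomp_add XI by blast
  qed
  have gen: "g \<odot>\<^bsub>M\<^esub> x \<in> X" if g: "g \<in> generators" and x: "x \<in> X" for g x
  proof -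
    from x obtain d m where x: "decomp d x m" unfolding X_def by blast
    from g consider c where "g = scalar_op c" | w where "w \<in> W" "g = weyl_op w"
      | z where "linear z" "g = mult_op z" | y where "g = T y"
      unfolding generators_def by blast
    then show ?thesis
    proof cases
      case 1
      then show ?thesis using XI[OF decomp_scalar[OF x]] by simp
    next
      case 2
      then show ?thesis
        using XI[OF decomp_degree_preserving[OF generators_in_H(2)[OF 2(1)] graded_weyl[OF 2(1)] x]] 2(2) by simp
    next
      case 3
      then show ?thesis using XI[OF decomp_mult[OF 3(1) x]] by simp
    next
      case 4
      then show ?thesis using XI decomp_dunkl[OF x] by blast
    qed
  qed
  have "Module.submodule X H M"
  proof (rule L.submodule_intro[OF Xc])
    show "\<zero>\<^bsub>M\<^esub> \<in> X" using XI[OF decomp_base[OF graded_zero]] .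
    fix a x assume a: "a \<in> carrier H" and x: "x \<in> X"
    show "a \<odot>\<^bsub>M\<^esub> x \<in> X"
    proof (rule generate_preserves[OF _ Xc add _ gen a[unfolded H_carrier] x])
      show "generators \<subseteq> carrier H" using generator_in_H by (rule subsetI)
      fix c y assume "y \<in> X"
      then show "sc c y \<in> X" by (intro gen) (simp_all add: generators_def)
    qed
  qed (rule add)
  then have "X = carrier M" using base by (intro t_generates) auto
  then show ?thesis using assms by (auto simp: X_def)
qed

text \<open>Applying \<open>E - (\<mu> + d)\<close> for the top degree \<open>d\<close> removes the top term and rescales the leading one.\<close>

lemma decomp_leading_in_submodule:
  assumes "Module.submodule N H M"
  shows "decomp d a m \<Longrightarrow> a \<in> N \<Longrightarrow> m \<in> N"
proof (induction d arbitrary: a m)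
  case 0
  from 0(1) show ?case by cases (use 0(2) in auto)
next
  case (Suc d)
  define z :: "'a operator" where "z = euler_op \<oplus>\<^bsub>end_ring\<^esub> scalar_op (- (\<mu> + of_nat (Suc d)))"
  have zH: "z \<in> carrier H" unfolding z_def using subringE(7)[OF subring_H euler_op_H generators_in_H(1)] .
  have zg: "z \<odot>\<^bsub>M\<^esub> x = sc (of_nat e - of_nat (Suc d)) x" if "graded e x" for e x
  proof -
    note xc = graded_closed[OF that]
    have "z \<odot>\<^bsub>M\<^esub> x = sc (\<mu> + of_nat e) x \<oplus>\<^bsub>M\<^esub> sc (- (\<mu> + of_nat (Suc d))) x"
      unfolding z_def act_add[OF euler_op_H generators_in_H(1) xc] graded_euler[OF that] ..
    moreover have "(\<mu> + of_nat e) + (- (\<mu> + of_nat (Suc d))) = of_nat e - of_nat (Suc d)" by (simp add: algebra_simps)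
    ultimately show ?thesis unfolding C.s_add_left[OF xc, symmetric] by metis
  qed
  from Suc(2) obtain a' b where ab: "a = a' \<oplus>\<^bsub>M\<^esub> b" "decomp d a' m" "graded (Suc d) b" by cases
  note c = decomp_closed[OF ab(2)] graded_closed[OF ab(3)]
  have "z \<odot>\<^bsub>M\<^esub> a = z \<odot>\<^bsub>M\<^esub> a' \<oplus>\<^bsub>M\<^esub> z \<odot>\<^bsub>M\<^esub> b" unfolding ab(1) by (rule L.smult_r_distr[OF zH c])
  also have "z \<odot>\<^bsub>M\<^esub> b = \<zero>\<^bsub>M\<^esub>" using zg[OF ab(3)] C.s_zero_left[OF c(2)] by simp
  finally have "z \<odot>\<^bsub>M\<^esub> a = z \<odot>\<^bsub>M\<^esub> a'" using L.smult_closed[OF zH c(1)] by simp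
  then have "z \<odot>\<^bsub>M\<^esub> a' \<in> N" using submoduleD(5)[OF assms zH Suc(3)] by simp
  moreover have "decomp d (z \<odot>\<^bsub>M\<^esub> a') (z \<odot>\<^bsub>M\<^esub> m)"
    by (rule decomp_degree_preserving[OF zH _ ab(2)]) (simp add: zg graded_scalar)
  ultimately have "z \<odot>\<^bsub>M\<^esub> m \<in> N" using Suc.IH by blast
  then have "sc (- of_nat (Suc d)) m \<in> N" using zg[OF decomp_leading[OF ab(2)]] by simp
  \<comment> \<open>The leading term has been scaled by -(d + 1), which is invertible, so the factor
    can be removed inside \<open>N\<close>.\<close>
  then have "sc (inverse (- of_nat (Suc d))) (sc (- of_nat (Suc d)) m) \<in> N"
    by (rule submoduleD(5)[OF assms generators_in_H(1)])
  moreover have "inverse (- of_nat (Suc d)) * (- of_nat (Suc d)) = (1::complex)"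
    by (intro left_inverse) (simp add: add_eq_0_iff del: of_nat_Suc)
  ultimately show ?case
    using C.s_mult[OF graded_closed[OF decomp_leading[OF ab(2)]]] C.s_one[OF graded_closed[OF decomp_leading[OF ab(2)]]]
    by metis
qed

text \<open>The vectors that \<open>t\<close> maps into \<open>N\<close> form an invariant subspace,
  which by irreducibility is everything as soon as it is nonzero.\<close>

lemma lowest_weight_vector_generates:
  assumes N: "Module.submodule N H M" and u: "u \<in> carrier_vec n" "u \<noteq> 0\<^sub>v n" "t u \<in> N"
  shows "N = carrier M"
proof (rule t_generates[OF N])
  define S where "S = {v \<in> carrier_vec n. t v \<in> N}"
  note Nd = submoduleD[OF N]
  have "S = {0\<^sub>v n} \<or> S = carrier_vec n"
  proof (rule irreducible_weyl_repD(5)[OF rep])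
    show "vec_subspace n S" unfolding vec_subspace_def S_def
      using Nd(2,3,5) generators_in_H t_zero by (auto simp: t_add t_scalar)
    fix w v assume w: "w \<in> W" and "v \<in> S"
    then show "\<rho> w *\<^sub>v v \<in> S"
      using Nd(5)[OF generators_in_H(2)[OF w]] t_weyl[OF w] irreducible_weyl_repD(2)[OF rep w]
      by (auto simp: S_def)
  qed
  moreover have "u \<in> S" using u by (simp add: S_def)
  ultimately have "S = carrier_vec n" using u(2) by blast
  then show "t ` carrier_vec n \<subseteq> N" by (auto simp: S_def)
qed

text \<open>The kernel of \<open>h\<close> is the candidate: \<open>not_below\<close> shows that a
  submodule not inside it is everything, which gives maximality and uniqueness at once, and the
  quotient by it is \<open>V\<close> because \<open>h\<close> is onto.\<close>

lemma unique_maximal_submodule: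
  assumes V: "irreducible_module H V"
    and hom: "\<And>x. x \<in> carrier M \<Longrightarrow> h x \<in> carrier V"
      "\<And>x y. x \<in> carrier M \<Longrightarrow> y \<in> carrier M \<Longrightarrow> h (x \<oplus>\<^bsub>M\<^esub> y) = h x \<oplus>\<^bsub>V\<^esub> h y"
      "\<And>a x. a \<in> carrier H \<Longrightarrow> x \<in> carrier M \<Longrightarrow> h (a \<odot>\<^bsub>M\<^esub> x) = a \<odot>\<^bsub>V\<^esub> h x"
    and inj: "\<And>u. u \<in> carrier_vec n \<Longrightarrow> h (t u) = \<zero>\<^bsub>V\<^esub> \<Longrightarrow> u = 0\<^sub>v n"
  shows "module_isomorphic H V (quotient_module M (THE N. maximal_submodule H M N))"
proof -
  interpret V: left_module H V using V by (simp add: irreducible_module_def)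
  have simple: "N = {\<zero>\<^bsub>V\<^esub>} \<or> N = carrier V" if "Module.submodule N H V" for N
    using V that by (simp add: irreducible_module_def)
  define K where "K = {x \<in> carrier M. h x = \<zero>\<^bsub>V\<^esub>}"
  have h0: "h \<zero>\<^bsub>M\<^esub> = \<zero>\<^bsub>V\<^esub>"
    using hom(2)[of "\<zero>\<^bsub>M\<^esub>" "\<zero>\<^bsub>M\<^esub>"] hom(1)[of "\<zero>\<^bsub>M\<^esub>"] by (metis L.M.r_zero L.M.zero_closed V.M.add.l_cancel_one)
  have hminus: "h (\<ominus>\<^bsub>M\<^esub> x) = \<ominus>\<^bsub>V\<^esub> h x" if "x \<in> carrier M" for x
    using hom(2)[of "\<ominus>\<^bsub>M\<^esub> x" x] hom(1) that h0 by (metis L.M.a_inv_closed L.M.l_neg V.M.minus_equality)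
  have K: "Module.submodule K H M"
    by (rule L.submodule_intro) (auto simp: K_def h0 hom V.smult_r_zero L.smult_closed)
  define u0 where "u0 = (unit_vec n 0 :: complex vec)"
  have u0: "u0 \<in> carrier_vec n" "u0 \<noteq> 0\<^sub>v n"
    using irreducible_weyl_repD(1)[OF rep] by (auto simp: u0_def)
  have K_proper: "K \<noteq> carrier M" using inj[OF u0(1)] u0 t_closed[OF u0(1)] by (auto simp: K_def)
  have image: "Module.submodule (h ` N) H V" if "Module.submodule N H M" for N
  proof (rule V.submodule_intro)
    note Nd = submoduleD[OF that]
    show "h ` N \<subseteq> carrier V" using Nd(1) hom(1) by blast
    show "\<zero>\<^bsub>V\<^esub> \<in> h ` N" using Nd(2) h0 by (metis imageI)
    show "x \<oplus>\<^bsub>V\<^esub> y \<in> h ` N" if "x \<in> h ` N" "y \<in> h ` N" for x y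
    proof -
      from that obtain a b where ab: "a \<in> N" "b \<in> N" "x = h a" "y = h b" by blast
      show ?thesis unfolding ab(3,4) hom(2)[OF subsetD[OF Nd(1) ab(1)] subsetD[OF Nd(1) ab(2)], symmetric]
        by (rule imageI[OF Nd(3)[OF ab(1,2)]])
    qed
    show "a \<odot>\<^bsub>V\<^esub> x \<in> h ` N" if "a \<in> carrier H" "x \<in> h ` N" for a x
    proof -
      from that obtain b where b: "b \<in> N" "x = h b" by blast
      show ?thesis unfolding b(2) hom(3)[OF that(1) subsetD[OF Nd(1) b(1)], symmetric]
        by (rule imageI[OF Nd(5)[OF that(1) b(1)]])
    qed
  qed
  have onto: "h ` N = carrier V" if N: "Module.submodule N H M" and nK: "\<not> N \<subseteq> K" for N
  proof -
    obtain x where x: "x \<in> N" "x \<notin> K" using nK by blast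
    then have "h x \<noteq> \<zero>\<^bsub>V\<^esub>" using submoduleD(1)[OF N] by (auto simp: K_def)
    then show ?thesis using simple[OF image[OF N]] x(1) by blast
  qed
  have not_below: "N = carrier M" if N: "Module.submodule N H M" and nK: "\<not> N \<subseteq> K" for N
  proof -
    have "h (t u0) \<in> h ` N" using onto[OF that] hom(1) t_closed[OF u0(1)] by simp
    then obtain a where a: "a \<in> N" "h a = h (t u0)" by auto
    have ac: "a \<in> carrier M" using a(1) submoduleD(1)[OF N] by blast
    note tc = t_closed[OF u0(1)]
    define x where "x = a \<oplus>\<^bsub>M\<^esub> (\<ominus>\<^bsub>M\<^esub> t u0)"
    have xc: "x \<in> carrier M" using ac tc by (simp add: x_def)
    have "h x = \<zero>\<^bsub>V\<^esub>" using ac tc hom(1)[OF tc] by (simp add: x_def hom(2) hminus a(2) V.M.r_neg)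
    then have xK: "x \<in> K" using xc by (simp add: K_def)
    obtain d m where dm: "decomp d x m" using decomp_exists[OF xc] by blast
    have "m \<in> K" by (rule decomp_leading_in_submodule[OF K dm xK])
    moreover obtain v where v: "v \<in> carrier_vec n" "m = t v" using graded_0D[OF decomp_leading[OF dm]] by blast
    ultimately have "v = 0\<^sub>v n" using inj by (simp add: K_def)
    then have m0: "m = \<zero>\<^bsub>M\<^esub>" using v t_zero by simp
    have "decomp d (t u0) (t u0)" using decomp_le[OF decomp_base[OF graded_base[OF u0(1)]]] by simp
    from decomp_add[OF this dm] have "decomp d (t u0 \<oplus>\<^bsub>M\<^esub> x) (t u0)" using m0 tc by simp
    moreover have "t u0 \<oplus>\<^bsub>M\<^esub> x = a"
      unfolding x_def using ac tc by (metis L.M.a_inv_closed L.M.a_lcomm L.M.r_neg L.M.r_zero)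
    ultimately have "t u0 \<in> N" using decomp_leading_in_submodule[OF N] a(1) by simp
    then show ?thesis using lowest_weight_vector_generates[OF N u0] by blast
  qed
  have max: "maximal_submodule H M K"
    unfolding maximal_submodule_def using K K_proper not_below by blast
  have "(THE N. maximal_submodule H M N) = K"
  proof (rule the_equality)
    show "maximal_submodule H M K" by (rule max)
    fix N assume N: "maximal_submodule H M N"
    then have "N \<subseteq> K" using not_below unfolding maximal_submodule_def by blast
    then show "N = K" using N K K_proper unfolding maximal_submodule_def by blast
  qed
  moreover have "h ` carrier M = carrier V"
  proof (rule onto)
    show "Module.submodule (carrier M) H M" by (rule L.submodule_intro) (auto simp: L.smult_closed)
    show "\<not> carrier M \<subseteq> K" using K_proper submoduleD(1)[OF K] by blast
  qed
  ultimately show ?thesis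
    using module_isomorphic_quotient[OF L.left_module_axioms V.left_module_axioms hom _ K K_def] by simp
qed

end


section \<open>The lowest weight space of a finite-dimensional simple module\<close>

text \<open>The columns are the images of the unit vectors; the identity is proved for vectors
  supported on the first \<open>k\<close> coordinates, by induction on \<open>k\<close>.\<close>

lemma linear_map_matrix:
  fixes g :: "complex vec \<Rightarrow> complex vec"
  assumes closed: "\<And>x. x \<in> carrier_vec N \<Longrightarrow> g x \<in> carrier_vec m"
    and add: "\<And>x y. x \<in> carrier_vec N \<Longrightarrow> y \<in> carrier_vec N \<Longrightarrow> g (x + y) = g x + g y"
    and scale: "\<And>c x. x \<in> carrier_vec N \<Longrightarrow> g (c \<cdot>\<^sub>v x) = c \<cdot>\<^sub>v g x"
  shows "\<exists>A\<in>carrier_mat m N. \<forall>x\<in>carrier_vec N. g x = A *\<^sub>v x"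
proof -
  define A where "A = mat m N (\<lambda>(i, j). g (unit_vec N j) $ i)"
  have A: "A \<in> carrier_mat m N" by (simp add: A_def)
  have "g x = A *\<^sub>v x" if "x \<in> carrier_vec N" "\<And>i. k \<le> i \<Longrightarrow> i < N \<Longrightarrow> x $ i = 0" "k \<le> N" for k x
    using that
  proof (induction k arbitrary: x)
    case 0
    have "x = 0 \<cdot>\<^sub>v 0\<^sub>v N" using 0 by (intro eq_vecI) auto
    then have x: "x = 0\<^sub>v N" and "g x = 0 \<cdot>\<^sub>v g (0\<^sub>v N)" using scale[of "0\<^sub>v N" 0] by auto
    moreover have "0 \<cdot>\<^sub>v g (0\<^sub>v N) = 0\<^sub>v m" using closed[of "0\<^sub>v N"] by (intro eq_vecI) auto
    ultimately have "g x = 0\<^sub>v m" by metis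
    then show ?case unfolding x using mult_zero_vec[OF A] by simp
  next
    case (Suc k)
    define y where "y = vec N (\<lambda>i. if i = k then 0 else x $ i)"
    have k: "k < N" using Suc.prems by simp
    have yc: "y \<in> carrier_vec N" by (simp add: y_def)
    have uc: "unit_vec N k \<in> carrier_vec N" by simp
    have x: "x = y + x $ k \<cdot>\<^sub>v unit_vec N k"
      using Suc.prems(1) k by (intro eq_vecI) (auto simp: y_def)
    have "g y = A *\<^sub>v y" using Suc.prems k by (intro Suc.IH yc) (auto simp: y_def)
    moreover have "g (unit_vec N k) = A *\<^sub>v unit_vec N k"
      unfolding mult_unit_vec_col[OF A k] using closed[OF uc] k by (intro eq_vecI) (auto simp: A_def)
    ultimately have "g (y + x $ k \<cdot>\<^sub>v unit_vec N k) = A *\<^sub>v (y + x $ k \<cdot>\<^sub>v unit_vec N k)"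
      using add[OF yc, of "x $ k \<cdot>\<^sub>v unit_vec N k"] scale[OF uc] mult_add_distrib_mat_vec[OF A yc, of "x $ k \<cdot>\<^sub>v unit_vec N k"]
        mult_mat_vec[OF A uc] by simp
    then show ?case using x by simp
  qed
  from this[of _ N] show ?thesis using A by auto
qed

locale embedded_rep = weight_space R Rp k M n \<rho> t \<mu>
  for R Rp :: "('a::euclidean_space \<Rightarrow> real) set" and k and M :: "('a operator, 'm) module"
    and n \<rho> t \<mu> +
  assumes t_kernel: "u \<in> carrier_vec n \<Longrightarrow> t u = \<zero>\<^bsub>M\<^esub> \<Longrightarrow> u = 0\<^sub>v n"

text \<open>Since \<open>[E, T\<^sub>y] = - T\<^sub>y\<close>, each \<open>T\<^sub>y\<close> kills an eigenspace of the Euler operator \<open>E\<close> whose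
  eigenvalue \<open>\<mu>\<close> is such that \<open>\<mu> - 1\<close> is no eigenvalue.\<close>

lemma (in H_module) embedded_rep_exists:
  assumes irr: "irreducible_module H M" and fd: "finite_dim_module M"
  shows "\<exists>n \<rho> t \<mu>. embedded_rep R Rp k M n \<rho> t \<mu>"
proof -
  obtain B0 where B0: "finite B0" "B0 \<subseteq> carrier M" "\<And>v. v \<in> carrier M \<Longrightarrow> \<exists>c. v = (\<Oplus>\<^bsub>M\<^esub>b\<in>B0. sc (c b) b)"
    using fd unfolding finite_dim_module_def by blast
  obtain N \<psi> where bij: "bij_betw \<psi> (carrier_vec N) (carrier M)"
    and \<psi>_add: "\<And>x y. x \<in> carrier_vec N \<Longrightarrow> y \<in> carrier_vec N \<Longrightarrow> \<psi> (x + y) = \<psi> x \<oplus>\<^bsub>M\<^esub> \<psi> y"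
    and \<psi>_scale: "\<And>c x. x \<in> carrier_vec N \<Longrightarrow> \<psi> (c \<cdot>\<^sub>v x) = sc c (\<psi> x)"
    by (rule C.coordinates[OF B0], assumption, rule that, assumption, simp, simp)
  have \<psi>c: "\<psi> x \<in> carrier M" if "x \<in> carrier_vec N" for x using bij that by (auto simp: bij_betw_def)
  have \<psi>_inj: "x = y" if "\<psi> x = \<psi> y" "x \<in> carrier_vec N" "y \<in> carrier_vec N" for x y
    using bij that by (auto simp: bij_betw_def inj_on_def)
  have \<psi>_surj: "\<exists>x\<in>carrier_vec N. v = \<psi> x" if "v \<in> carrier M" for v
  proof -
    have "v \<in> \<psi> ` carrier_vec N" using bij that by (simp add: bij_betw_def)
    then show ?thesis by (rule imageE) (rule bexI)
  qed
  have \<psi>0: "\<psi> (0\<^sub>v N) = \<zero>\<^bsub>M\<^esub>"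
  proof -
    have "0 \<cdot>\<^sub>v 0\<^sub>v N = (0\<^sub>v N :: complex vec)" by (intro eq_vecI) auto
    then have "\<psi> (0\<^sub>v N) = sc 0 (\<psi> (0\<^sub>v N))" using \<psi>_scale[of "0\<^sub>v N" 0] by simp
    then show ?thesis using C.s_zero_left[OF \<psi>c[of "0\<^sub>v N"]] by simp
  qed
  have "\<exists>A\<in>carrier_mat N N. \<forall>x\<in>carrier_vec N. \<psi> (A *\<^sub>v x) = a \<odot>\<^bsub>M\<^esub> \<psi> x" if a: "a \<in> carrier H" for a
  proof -
    have "\<exists>z\<in>carrier_vec N. \<psi> z = a \<odot>\<^bsub>M\<^esub> \<psi> x" if "x \<in> carrier_vec N" for x
      using \<psi>_surj[OF L.smult_closed[OF a \<psi>c[OF that]]] by metis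
    then obtain g where g: "\<And>x. x \<in> carrier_vec N \<Longrightarrow> g x \<in> carrier_vec N"
      "\<And>x. x \<in> carrier_vec N \<Longrightarrow> \<psi> (g x) = a \<odot>\<^bsub>M\<^esub> \<psi> x" by metis
    have "\<exists>A\<in>carrier_mat N N. \<forall>x\<in>carrier_vec N. g x = A *\<^sub>v x"
    proof (rule linear_map_matrix[OF g(1)])
      fix x y :: "complex vec" assume x: "x \<in> carrier_vec N" and y: "y \<in> carrier_vec N"
      have "\<psi> (g (x + y)) = \<psi> (g x + g y)"
        using x y g by (simp add: \<psi>_add L.smult_r_distr[OF a \<psi>c \<psi>c])
      then show "g (x + y) = g x + g y" by (rule \<psi>_inj) (use x y g in auto)
    next
      fix c and x :: "complex vec" assume x: "x \<in> carrier_vec N"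
      have "\<psi> (g (c \<cdot>\<^sub>v x)) = \<psi> (c \<cdot>\<^sub>v g x)"
        using x g by (simp add: \<psi>_scale act_scalar_commute[OF a \<psi>c])
      then show "g (c \<cdot>\<^sub>v x) = c \<cdot>\<^sub>v g x" by (rule \<psi>_inj) (use x g in auto)
    qed
    then show ?thesis using g(2) by metis
  qed
  then obtain \<Phi> where \<Phi>: "\<And>a. a \<in> carrier H \<Longrightarrow> \<Phi> a \<in> carrier_mat N N"
    "\<And>a x. a \<in> carrier H \<Longrightarrow> x \<in> carrier_vec N \<Longrightarrow> \<psi> (\<Phi> a *\<^sub>v x) = a \<odot>\<^bsub>M\<^esub> \<psi> x" by metis
  note E = \<Phi>(1)[OF euler_op_H]
  \<comment> \<open>Nonemptiness of the spectrum requires positive dimension, which is the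
    nontriviality of an irreducible module.\<close>
  have "N \<noteq> 0"
  proof
    assume N: "N = 0"
    have "v = \<zero>\<^bsub>M\<^esub>" if v: "v \<in> carrier M" for v
    proof -
      obtain x where x: "x \<in> carrier_vec N" "v = \<psi> x" using \<psi>_surj[OF v] by blast
      have "x = 0\<^sub>v N" using x(1) N by (intro eq_vecI) auto
      then show ?thesis using x(2) \<psi>0 by simp
    qed
    then have "carrier M = {\<zero>\<^bsub>M\<^esub>}" using L.M.zero_closed by auto
    then show False using irr by (simp add: irreducible_module_def)
  qed
  then have sp: "finite (spectrum (\<Phi> euler_op))" "spectrum (\<Phi> euler_op) \<noteq> {}"
    using card_finite_spectrum(1)[OF E] spectrum_non_empty[OF E] by auto
  \<comment> \<open>Minimal real part among the finitely many eigenvalues guarantees that \<mu> - 1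
    is not one of them.\<close>
  define \<mu> where "\<mu> = arg_min_on Re (spectrum (\<Phi> euler_op))"
  have \<mu>: "\<mu> \<in> spectrum (\<Phi> euler_op)" unfolding \<mu>_def by (rule arg_min_if_finite(1)[OF sp])
  have \<mu>1: "\<mu> - 1 \<notin> spectrum (\<Phi> euler_op)"
    using arg_min_if_finite(2)[OF sp, of Re] unfolding \<mu>_def[symmetric] by auto
  define U where "U = {x \<in> carrier_vec N. \<Phi> euler_op *\<^sub>v x = \<mu> \<cdot>\<^sub>v x}"
  have U: "vec_subspace N U" unfolding U_def by (rule vec_subspace_eigenspace[OF E])
  have U_iff: "x \<in> U \<longleftrightarrow> euler_op \<odot>\<^bsub>M\<^esub> \<psi> x = sc \<mu> (\<psi> x)" if x: "x \<in> carrier_vec N" for x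
  proof -
    have "x \<in> U \<longleftrightarrow> \<psi> (\<Phi> euler_op *\<^sub>v x) = \<psi> (\<mu> \<cdot>\<^sub>v x)"
      unfolding U_def using x E \<psi>_inj[of "\<Phi> euler_op *\<^sub>v x" "\<mu> \<cdot>\<^sub>v x"] by auto
    then show ?thesis using \<Phi>(2)[OF euler_op_H x] \<psi>_scale[OF x] by simp
  qed
  have U_dunkl: "T y \<odot>\<^bsub>M\<^esub> \<psi> x = \<zero>\<^bsub>M\<^esub>" if "x \<in> U" for x y
  proof -
    have x: "x \<in> carrier_vec N" using that by (simp add: U_def)
    note TH = generators_in_H(4)[of y]
    define w where "w = T y \<odot>\<^bsub>M\<^esub> \<psi> x"
    have wc: "w \<in> carrier M" unfolding w_def by (rule L.smult_closed[OF TH \<psi>c[OF x]])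
    have ETH: "euler_op \<otimes>\<^bsub>end_ring\<^esub> T y \<in> carrier H" by (rule subringE(6)[OF subring_H euler_op_H TH])
    \<comment> \<open>Both ends of this chain carry an extra summand \<open>w\<close>; cancelling it
      shows that \<open>w\<close> satisfies the eigenvalue equation for \<mu> - 1 and therefore
      vanishes.\<close>
    have "euler_op \<odot>\<^bsub>M\<^esub> w \<oplus>\<^bsub>M\<^esub> w = ((euler_op \<otimes>\<^bsub>end_ring\<^esub> T y) \<oplus>\<^bsub>end_ring\<^esub> T y) \<odot>\<^bsub>M\<^esub> \<psi> x"
      unfolding act_add[OF ETH TH \<psi>c[OF x]] act_mult[OF euler_op_H TH \<psi>c[OF x]] w_def ..
    also have "\<dots> = T y \<odot>\<^bsub>M\<^esub> sc \<mu> (\<psi> x)"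
      unfolding euler_dunkl_op act_mult[OF TH euler_op_H \<psi>c[OF x]] using that U_iff[OF x] by simp
    also have "\<dots> = sc \<mu> w" unfolding w_def by (rule act_scalar_commute[OF TH \<psi>c[OF x]])
    also have "\<dots> = sc (\<mu> - 1) w \<oplus>\<^bsub>M\<^esub> sc 1 w" unfolding C.s_add_left[OF wc, symmetric] by simp
    also have "\<dots> = sc (\<mu> - 1) w \<oplus>\<^bsub>M\<^esub> w" unfolding C.s_one[OF wc] ..
    finally have "euler_op \<odot>\<^bsub>M\<^esub> w = sc (\<mu> - 1) w"
      using L.smult_closed[OF euler_op_H wc] C.s_closed[OF wc] wc by (simp add: L.M.add.right_cancel)
    moreover obtain z where z: "z \<in> carrier_vec N" "w = \<psi> z" using \<psi>_surj[OF wc] by blast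
    ultimately have "\<psi> (\<Phi> euler_op *\<^sub>v z) = \<psi> ((\<mu> - 1) \<cdot>\<^sub>v z)"
      using \<Phi>(2)[OF euler_op_H z(1)] \<psi>_scale[OF z(1)] by simp
    then have "\<Phi> euler_op *\<^sub>v z = (\<mu> - 1) \<cdot>\<^sub>v z" by (rule \<psi>_inj) (use z(1) E in auto)
    then have "z = 0\<^sub>v N"
      using \<mu>1 z(1) E unfolding spectrum_def eigenvalue_def eigenvector_def by auto
    then show ?thesis using z(2) \<psi>0 w_def by simp
  qed
  have "U \<noteq> {0\<^sub>v N}"
  proof -
    obtain v where "v \<in> carrier_vec N" "v \<noteq> 0\<^sub>v N" "\<Phi> euler_op *\<^sub>v v = \<mu> \<cdot>\<^sub>v v"
      using \<mu> E unfolding spectrum_def eigenvalue_def eigenvector_def by auto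
    then have "v \<in> U" "v \<noteq> 0\<^sub>v N" by (auto simp: U_def)
    then show ?thesis by blast
  qed
  note weylH = generators_in_H(2)
  have U_weyl: "\<Phi> (weyl_op w) *\<^sub>v x \<in> U" if w: "w \<in> W" and xU: "x \<in> U" for w x
  proof -
    have x: "x \<in> carrier_vec N" using xU by (simp add: U_def)
    have c: "\<Phi> (weyl_op w) *\<^sub>v x \<in> carrier_vec N" using \<Phi>(1)[OF weylH[OF w]] x by simp
    have "euler_op \<odot>\<^bsub>M\<^esub> (weyl_op w \<odot>\<^bsub>M\<^esub> \<psi> x) = weyl_op w \<odot>\<^bsub>M\<^esub> (euler_op \<odot>\<^bsub>M\<^esub> \<psi> x)"
      using act_mult[OF euler_op_H weylH[OF w] \<psi>c[OF x]] act_mult[OF weylH[OF w] euler_op_H \<psi>c[OF x]]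
      unfolding euler_weyl_op[OF w] by simp
    also have "\<dots> = sc \<mu> (weyl_op w \<odot>\<^bsub>M\<^esub> \<psi> x)"
      using xU U_iff[OF x] act_scalar_commute[OF weylH[OF w] \<psi>c[OF x]] by simp
    finally show ?thesis unfolding U_iff[OF c] \<Phi>(2)[OF weylH[OF w] x] .
  qed
  show ?thesis
  proof (rule vec_subspace_irreducible_subrep[of W "\<lambda>w. \<Phi> (weyl_op w)" N U])
    show "vec_subspace N U" "U \<noteq> {0\<^sub>v N}" by fact+
    show "\<Phi> (weyl_op w) \<in> carrier_mat N N" if "w \<in> W" for w by (rule \<Phi>(1)[OF weylH[OF that]])
    show "\<Phi> (weyl_op w) *\<^sub>v x \<in> U" if "w \<in> W" "x \<in> U" for w x by (rule U_weyl[OF that])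
    fix n P and \<rho> :: "('a \<Rightarrow> 'a) \<Rightarrow> complex mat"
    assume n: "0 < n" and P: "P \<in> carrier_mat N n" "inj_mat n P"
      "\<And>x. x \<in> carrier_vec n \<Longrightarrow> P *\<^sub>v x \<in> U"
      and \<rho>: "\<And>w. w \<in> W \<Longrightarrow> \<rho> w \<in> carrier_mat n n" "\<And>w. w \<in> W \<Longrightarrow> \<Phi> (weyl_op w) * P = P * \<rho> w"
      and irred: "\<And>S. vec_subspace n S \<Longrightarrow> (\<And>w u. w \<in> W \<Longrightarrow> u \<in> S \<Longrightarrow> \<rho> w *\<^sub>v u \<in> S) \<Longrightarrow>
         S = {0\<^sub>v n} \<or> S = carrier_vec n"
    define t where "t x = \<psi> (P *\<^sub>v x)" for x
    have Pc: "P *\<^sub>v x \<in> carrier_vec N" if "x \<in> carrier_vec n" for x using P(1) that by simp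
    have t_inj: "x = y" if "t x = t y" "x \<in> carrier_vec n" "y \<in> carrier_vec n" for x y
      using \<psi>_inj[OF that(1)[unfolded t_def] Pc[OF that(2)] Pc[OF that(3)]] inj_mat_eqD[OF P(1,2) that(2,3)] by simp
    have t_weyl: "t (\<rho> w *\<^sub>v u) = weyl_op w \<odot>\<^bsub>M\<^esub> t u" if w: "w \<in> W" and u: "u \<in> carrier_vec n" for w u
    proof -
      have "P *\<^sub>v (\<rho> w *\<^sub>v u) = \<Phi> (weyl_op w) *\<^sub>v (P *\<^sub>v u)"
        using assoc_mult_mat_vec[OF P(1) \<rho>(1)[OF w] u] assoc_mult_mat_vec[OF \<Phi>(1)[OF weylH[OF w]] P(1) u] \<rho>(2)[OF w] by simp
      then show ?thesis unfolding t_def using \<Phi>(2)[OF weylH[OF w] Pc[OF u]] by simp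
    qed
    have tc: "t u \<in> carrier M" if "u \<in> carrier_vec n" for u unfolding t_def by (rule \<psi>c[OF Pc[OF that]])
    have mat_eqI: "X = Y" if "X \<in> carrier_mat n n" "Y \<in> carrier_mat n n"
      "\<And>u. u \<in> carrier_vec n \<Longrightarrow> t (X *\<^sub>v u) = t (Y *\<^sub>v u)" for X Y
    proof (rule mat_col_eqI)
      fix j assume "j < dim_col Y"
      then have j: "j < n" using that(2) by simp
      have "X *\<^sub>v unit_vec n j = Y *\<^sub>v unit_vec n j" by (rule t_inj[OF that(3)]) (use that in auto)
      then show "col X j = col Y j" using mult_unit_vec_col[OF that(1) j] mult_unit_vec_col[OF that(2) j] by simp
    qed (use that(1,2) in auto)
    \<comment> \<open>\<open>\<rho>\<close> arose from factoring matrices, one group element at a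
      time. That it is a homomorphism is checked after applying the injective \<open>t\<close>,
      where it becomes the composition law of the operators.\<close>
    have rep: "irreducible_weyl_rep R n \<rho>"
      unfolding irreducible_weyl_rep_def weyl_rep_def
    proof (intro conjI ballI allI impI)
      show "\<rho> id = 1\<^sub>m n"
      proof (rule mat_eqI)
        fix u :: "complex vec" assume u: "u \<in> carrier_vec n"
        show "t (\<rho> id *\<^sub>v u) = t (1\<^sub>m n *\<^sub>v u)"
          using t_weyl[OF weyl_id u] u act_one[OF tc[OF u]] by (simp add: weyl_op_id)
      qed (use \<rho>(1)[OF weyl_id] in auto)
      fix w w' assume w: "w \<in> W" "w' \<in> W"
      show "\<rho> (w \<circ> w') = \<rho> w * \<rho> w'"
      proof (rule mat_eqI)
        fix u :: "complex vec" assume u: "u \<in> carrier_vec n"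
        have "t (\<rho> (w \<circ> w') *\<^sub>v u) = weyl_op w \<odot>\<^bsub>M\<^esub> (weyl_op w' \<odot>\<^bsub>M\<^esub> t u)"
          unfolding t_weyl[OF weyl_comp[OF w] u] weyl_op_comp[OF w]
          by (rule act_mult[OF weylH[OF w(1)] weylH[OF w(2)] tc[OF u]])
        also have "\<dots> = t (\<rho> w *\<^sub>v (\<rho> w' *\<^sub>v u))"
          using t_weyl[OF w(2) u] t_weyl[OF w(1), of "\<rho> w' *\<^sub>v u"] \<rho>(1)[OF w(2)] u by simp
        finally show "t (\<rho> (w \<circ> w') *\<^sub>v u) = t (\<rho> w * \<rho> w' *\<^sub>v u)"
          using assoc_mult_mat_vec[OF \<rho>(1)[OF w(1)] \<rho>(1)[OF w(2)] u] by simp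
      qed (use \<rho>(1)[OF weyl_comp[OF w]] \<rho>(1)[OF w(1)] \<rho>(1)[OF w(2)] in auto)
    next
      fix S assume "S \<subseteq> carrier_vec n \<and> 0\<^sub>v n \<in> S \<and> (\<forall>u\<in>S. \<forall>v\<in>S. u + v \<in> S) \<and>
        (\<forall>c. \<forall>u\<in>S. c \<cdot>\<^sub>v u \<in> S) \<and> (\<forall>w\<in>W. \<forall>u\<in>S. \<rho> w *\<^sub>v u \<in> S)"
      then show "S = {0\<^sub>v n} \<or> S = carrier_vec n" by (intro irred) (simp_all add: vec_subspace_def)
    qed (use n \<rho>(1) in auto)
    have "embedded_rep R Rp k M n \<rho> t \<mu>"
    proof (unfold_locales)
      fix u v :: "complex vec" assume u: "u \<in> carrier_vec n" and v: "v \<in> carrier_vec n"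
      show "t (u + v) = t u \<oplus>\<^bsub>M\<^esub> t v"
        unfolding t_def mult_add_distrib_mat_vec[OF P(1) u v] by (rule \<psi>_add[OF Pc[OF u] Pc[OF v]])
    next
      fix c and u :: "complex vec" assume u: "u \<in> carrier_vec n"
      show "t (c \<cdot>\<^sub>v u) = sc c (t u)" unfolding t_def mult_mat_vec[OF P(1) u] by (rule \<psi>_scale[OF Pc[OF u]])
      show "T y \<odot>\<^bsub>M\<^esub> t u = \<zero>\<^bsub>M\<^esub>" for y unfolding t_def by (rule U_dunkl[OF P(3)[OF u]])
      show "euler_op \<odot>\<^bsub>M\<^esub> t u = sc \<mu> (t u)" unfolding t_def using U_iff[OF Pc[OF u]] P(3)[OF u] by simp
      assume "t u = \<zero>\<^bsub>M\<^esub>"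
      then have "t u = t (0\<^sub>v n)" unfolding t_def using mult_zero_vec[OF P(1)] \<psi>0 by simp
      then show "u = 0\<^sub>v n" by (rule t_inj) (use u in auto)
    qed (use rep tc t_weyl in auto)
    then show ?thesis by blast
  qed
qed

section \<open>Passing to the representation chosen for the character\<close>

context embedded_rep
begin

lemma t_inj:
  assumes "u \<in> carrier_vec n" "v \<in> carrier_vec n" "t u = t v" shows "u = v"
proof -
  have "t (u + (-1) \<cdot>\<^sub>v v) = \<zero>\<^bsub>M\<^esub>"
    using assms L.M.r_neg[OF t_closed[OF assms(2)]] unfolding minus_scalar[OF t_closed[OF assms(2)]]
    by (simp add: t_add t_scalar)
  then have z: "u + (-1) \<cdot>\<^sub>v v = 0\<^sub>v n" using assms by (intro t_kernel) auto
  show ?thesis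
  proof (rule eq_vecI)
    fix i assume i: "i < dim_vec v"
    then have "(u + (-1) \<cdot>\<^sub>v v) $ i = 0" unfolding z using assms(2) by simp
    then show "u $ i = v $ i" using i assms by simp
  qed (use assms in simp)
qed

lemma mat_eqI_t:
  assumes "X \<in> carrier_mat n n" "Y \<in> carrier_mat n n"
    "\<And>u. u \<in> carrier_vec n \<Longrightarrow> t (X *\<^sub>v u) = t (Y *\<^sub>v u)"
  shows "X = Y"
proof (rule mat_col_eqI)
  fix j assume "j < dim_col Y"
  then have j: "j < n" using assms(2) by simp
  have "X *\<^sub>v unit_vec n j = Y *\<^sub>v unit_vec n j" by (rule t_inj[OF _ _ assms(3)]) (use assms in auto)
  then show "col X j = col Y j" using mult_unit_vec_col[OF assms(1) j] mult_unit_vec_col[OF assms(2) j] by simp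
qed (use assms(1,2) in auto)

text \<open>Composing with an injective intertwiner replaces \<open>\<rho>\<close> by an isomorphic
  representation while the vectors used still come from the image of \<open>t\<close>, so \<mu> and
  the vanishing under Dunkl operators persist.\<close>

lemma change_basis:
  assumes "irreducible_weyl_rep R n \<sigma>" "intertwines R n \<rho> \<sigma> Y" "inj_mat n Y"
  shows "embedded_rep R Rp k M n \<sigma> (\<lambda>u. t (Y *\<^sub>v u)) \<mu>"
proof -
  have Y: "Y \<in> carrier_mat n n" "\<And>w. w \<in> W \<Longrightarrow> \<rho> w * Y = Y * \<sigma> w" using assms(2) by (auto simp: intertwines_def)
  have Yc: "Y *\<^sub>v u \<in> carrier_vec n" if "u \<in> carrier_vec n" for u using Y(1) that by simp
  show ?thesis
  proof (unfold_locales)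
    fix u :: "complex vec" assume u: "u \<in> carrier_vec n"
    show "t (Y *\<^sub>v u) \<in> carrier M" by (rule t_closed[OF Yc[OF u]])
    show "t (Y *\<^sub>v (c \<cdot>\<^sub>v u)) = sc c (t (Y *\<^sub>v u))" for c
      unfolding mult_mat_vec[OF Y(1) u] by (rule t_scalar[OF Yc[OF u]])
    show "T y \<odot>\<^bsub>M\<^esub> t (Y *\<^sub>v u) = \<zero>\<^bsub>M\<^esub>" for y by (rule t_dunkl[OF Yc[OF u]])
    show "euler_op \<odot>\<^bsub>M\<^esub> t (Y *\<^sub>v u) = sc \<mu> (t (Y *\<^sub>v u))" by (rule t_euler[OF Yc[OF u]])
    show "u = 0\<^sub>v n" if "t (Y *\<^sub>v u) = \<zero>\<^bsub>M\<^esub>"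
      using t_kernel[OF Yc[OF u] that] assms(3) u Y(1) by (auto simp: inj_mat_def)
    show "t (Y *\<^sub>v (u + v)) = t (Y *\<^sub>v u) \<oplus>\<^bsub>M\<^esub> t (Y *\<^sub>v v)" if v: "v \<in> carrier_vec n" for v
      unfolding mult_add_distrib_mat_vec[OF Y(1) u v] by (rule t_add[OF Yc[OF u] Yc[OF v]])
    show "t (Y *\<^sub>v (\<sigma> w *\<^sub>v u)) = weyl_op w \<odot>\<^bsub>M\<^esub> t (Y *\<^sub>v u)" if w: "w \<in> W" for w
    proof -
      note c = irreducible_weyl_repD(2)[OF rep w] irreducible_weyl_repD(2)[OF assms(1) w]
      have "Y *\<^sub>v (\<sigma> w *\<^sub>v u) = \<rho> w *\<^sub>v (Y *\<^sub>v u)"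
        using assoc_mult_mat_vec[OF Y(1) c(2) u] assoc_mult_mat_vec[OF c(1) Y(1) u] Y(2)[OF w] by simp
      then show ?thesis using t_weyl[OF w Yc[OF u]] by simp
    qed
  qed (rule assms(1))
qed

text \<open>\<open>rep_of_character\<close> returns an arbitrary representation with the right
  character. Equal characters force equal degree and an isomorphism, so the embedding can be
  rewritten for the chosen representation, the one from which the Verma module is built.\<close>

lemma character_rep:
  obtains \<sigma> t' where "rep_of_character R (weyl_character R n \<rho>) = (n, \<sigma>)" "embedded_rep R Rp k M n \<sigma> t' \<mu>"
proof -
  obtain n' \<sigma> where r: "rep_of_character R (weyl_character R n \<rho>) = (n', \<sigma>)" by fastforce
  have "\<exists>p. case p of (m, \<sigma>) \<Rightarrow> irreducible_weyl_rep R m \<sigma> \<and> weyl_character R m \<sigma> = weyl_character R n \<rho>"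
    using rep by (intro exI[of _ "(n, \<rho>)"]) simp
  from someI_ex[OF this] have \<sigma>: "irreducible_weyl_rep R n' \<sigma>" "weyl_character R n' \<sigma> = weyl_character R n \<rho>"
    using r unfolding rep_of_character_def by auto
  have n': "n' = n" using equal_characters_degree[OF rep \<sigma>(1) \<sigma>(2)[symmetric]] .
  note \<sigma> = \<sigma>[unfolded n']
  obtain Y where "intertwines R n \<rho> \<sigma> Y" "inj_mat n Y"
    using equal_characters_isomorphic[OF root_system rep \<sigma>(1) \<sigma>(2)[symmetric]] .
  from change_basis[OF \<sigma>(1) this] show thesis using that r n' by blast
qed

end


section \<open>The inflated representation\<close>

lemma ring_mat_ops:
  "carrier (ring_mat TYPE(complex) n b) = carrier_mat n n"
  "(\<otimes>\<^bsub>ring_mat TYPE(complex) n b\<^esub>) = (*)" "(\<oplus>\<^bsub>ring_mat TYPE(complex) n b\<^esub>) = (+)"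
  "\<one>\<^bsub>ring_mat TYPE(complex) n b\<^esub> = 1\<^sub>m n"
  by (simp_all add: ring_mat_def)

lemma scalar_mat_mult_vec:
  fixes u :: "complex vec"
  assumes "u \<in> carrier_vec n" shows "(c \<cdot>\<^sub>m 1\<^sub>m n) *\<^sub>v u = c \<cdot>\<^sub>v u"
proof (rule eq_vecI)
  fix i assume i: "i < dim_vec (c \<cdot>\<^sub>v u)"
  have "(unit_vec n i \<bullet> u) = u $ i" using assms i by (intro scalar_prod_left_unit) auto
  then show "((c \<cdot>\<^sub>m 1\<^sub>m n) *\<^sub>v u) $ i = (c \<cdot>\<^sub>v u) $ i"
    using assms i smult_scalar_prod_distrib[of "unit_vec n i" n u c] by simp
qed (use assms in simp)

lemma zero_mat_mult_vec:
  fixes u :: "complex vec"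
  assumes "u \<in> carrier_vec n" shows "0\<^sub>m n n *\<^sub>v u = 0\<^sub>v n"
  using assms by (intro eq_vecI) (auto simp: scalar_prod_def)

context dunkl_setup
begin

lemma dunkl_in_plus: "T y \<in> dunkl_plus R Rp k"
  using dunkl_plus.plus_word[of "[y]" R Rp k] E.r_one[OF dunkl_closed] by simp

end

section \<open>The homomorphism from the subalgebra \<open>B\<close> to matrices\<close>

context embedded_rep
begin

lemma rep_closed: "w \<in> W \<Longrightarrow> \<rho> w \<in> carrier_mat n n"
  by (rule irreducible_weyl_repD(2)[OF rep])

text \<open>The image of \<open>t\<close> is stable under \<open>B\<close>: scalars and group
  elements preserve it, Dunkl operators kill it, and sums and products of matrices follow suit.
  These matrices are the source of the extended representation.\<close>

lemma B_acts_by_matrix: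
  "b \<in> carrier B \<Longrightarrow> \<exists>X\<in>carrier_mat n n. \<forall>u\<in>carrier_vec n. t (X *\<^sub>v u) = b \<odot>\<^bsub>M\<^esub> t u"
proof (induction rule: B_induct)
  case (scalar c)
  have "t ((c \<cdot>\<^sub>m 1\<^sub>m n) *\<^sub>v u) = scalar_op c \<odot>\<^bsub>M\<^esub> t u" if "u \<in> carrier_vec n" for u
    unfolding scalar_mat_mult_vec[OF that] by (rule t_scalar[OF that])
  then show ?case by (intro bexI[of _ "c \<cdot>\<^sub>m 1\<^sub>m n"] ballI) simp_all
next
  case (dunkl y)
  have "t (0\<^sub>m n n *\<^sub>v u) = T y \<odot>\<^bsub>M\<^esub> t u" if "u \<in> carrier_vec n" for u
    unfolding zero_mat_mult_vec[OF that] t_zero by (rule t_dunkl[OF that, symmetric])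
  then show ?case by (intro bexI[of _ "0\<^sub>m n n"] ballI) simp_all
next
  case (weyl w)
  then show ?case by (intro bexI[of _ "\<rho> w"] ballI t_weyl rep_closed)
next
  case (add a b)
  then obtain X Y where X: "X \<in> carrier_mat n n" "\<And>u. u \<in> carrier_vec n \<Longrightarrow> t (X *\<^sub>v u) = a \<odot>\<^bsub>M\<^esub> t u"
    and Y: "Y \<in> carrier_mat n n" "\<And>u. u \<in> carrier_vec n \<Longrightarrow> t (Y *\<^sub>v u) = b \<odot>\<^bsub>M\<^esub> t u" by metis
  have ab: "a \<in> carrier H" "b \<in> carrier H" using add(1,2) B_subset_H by auto
  show ?case
  proof (intro bexI[of _ "X + Y"] ballI)
    fix u :: "complex vec" assume u: "u \<in> carrier_vec n"
    have "t ((X + Y) *\<^sub>v u) = t (X *\<^sub>v u) \<oplus>\<^bsub>M\<^esub> t (Y *\<^sub>v u)"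
      using add_mult_distrib_mat_vec[OF X(1) Y(1) u] X(1) Y(1) u by (simp add: t_add)
    then show "t ((X + Y) *\<^sub>v u) = (a \<oplus>\<^bsub>end_ring\<^esub> b) \<odot>\<^bsub>M\<^esub> t u"
      unfolding X(2)[OF u] Y(2)[OF u] act_add[OF ab t_closed[OF u]] .
  qed (use X Y in simp)
next
  case (mult a b)
  then obtain X Y where X: "X \<in> carrier_mat n n" "\<And>u. u \<in> carrier_vec n \<Longrightarrow> t (X *\<^sub>v u) = a \<odot>\<^bsub>M\<^esub> t u"
    and Y: "Y \<in> carrier_mat n n" "\<And>u. u \<in> carrier_vec n \<Longrightarrow> t (Y *\<^sub>v u) = b \<odot>\<^bsub>M\<^esub> t u" by metis
  have ab: "a \<in> carrier H" "b \<in> carrier H" using mult(1,2) B_subset_H by auto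
  show ?case
  proof (intro bexI[of _ "X * Y"] ballI)
    fix u :: "complex vec" assume u: "u \<in> carrier_vec n"
    have "Y *\<^sub>v u \<in> carrier_vec n" using Y(1) u by simp
    from X(2)[OF this] show "t (X * Y *\<^sub>v u) = (a \<otimes>\<^bsub>end_ring\<^esub> b) \<odot>\<^bsub>M\<^esub> t u"
      unfolding Y(2)[OF u] act_mult[OF ab t_closed[OF u]] using assoc_mult_mat_vec[OF X(1) Y(1) u] by simp
  qed (use X Y in simp)
qed

text \<open>The rightmost factor of a nonempty word meets \<open>t u\<close> first and kills
  it.\<close>

lemma dunkl_plus_kills:
  "s \<in> dunkl_plus R Rp k \<Longrightarrow> s \<in> carrier B \<and> (\<forall>u\<in>carrier_vec n. s \<odot>\<^bsub>M\<^esub> t u = \<zero>\<^bsub>M\<^esub>)"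
proof (induction rule: dunkl_plus.induct)
  case plus_zero
  then show ?case using subringE(2)[OF subring_B] L.smult_l_zero t_closed by auto
next
  case (plus_word ys)
  define F where "F ys = foldr (\<lambda>y F. T y \<otimes>\<^bsub>end_ring\<^esub> F) ys \<one>\<^bsub>end_ring\<^esub>" for ys
  have FB: "F ys \<in> carrier B" for ys
    by (induction ys) (auto simp: F_def intro!: subringE(3,6)[OF subring_B] generators_in_B)
  have "F (y # ys) \<odot>\<^bsub>M\<^esub> t u = \<zero>\<^bsub>M\<^esub>" if u: "u \<in> carrier_vec n" for y ys u
  proof (induction ys arbitrary: y)
    case Nil
    show ?case using t_dunkl[OF u] E.r_one[OF dunkl_closed] by (simp add: F_def)
  next
    case (Cons y' ys)
    have "F (y # y' # ys) = T y \<otimes>\<^bsub>end_ring\<^esub> F (y' # ys)" by (simp add: F_def)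
    then have "F (y # y' # ys) \<odot>\<^bsub>M\<^esub> t u = (T y \<otimes>\<^bsub>end_ring\<^esub> F (y' # ys)) \<odot>\<^bsub>M\<^esub> t u" by simp
    also have "\<dots> = T y \<odot>\<^bsub>M\<^esub> (F (y' # ys) \<odot>\<^bsub>M\<^esub> t u)"
      using FB B_subset_H by (intro act_mult generators_in_H t_closed u) blast
    also have "\<dots> = \<zero>\<^bsub>M\<^esub>" unfolding Cons.IH by (rule L.smult_r_zero[OF generators_in_H(4)])
    finally show ?case .
  qed
  then show ?case using FB[of ys] plus_word by (cases ys) (auto simp: F_def)
next
  case (plus_add F G)
  then have FG: "F \<in> carrier H" "G \<in> carrier H" using B_subset_H by auto
  then have "(F \<oplus>\<^bsub>end_ring\<^esub> G) \<odot>\<^bsub>M\<^esub> t u = \<zero>\<^bsub>M\<^esub>" if "u \<in> carrier_vec n" for u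
    using act_add[OF FG t_closed[OF that]] plus_add.IH that by simp
  then show ?case using plus_add subringE(7)[OF subring_B] by blast
next
  case (plus_scalar F c)
  then have F: "F \<in> carrier H" using B_subset_H by auto
  then have "(scalar_op c \<otimes>\<^bsub>end_ring\<^esub> F) \<odot>\<^bsub>M\<^esub> t u = \<zero>\<^bsub>M\<^esub>" if "u \<in> carrier_vec n" for u
    using act_mult[OF generators_in_H(1) F t_closed[OF that]] plus_scalar.IH that C.s_zero_right by simp
  then show ?case using plus_scalar subringE(6)[OF subring_B] generators_in_B(1) by blast
qed

text \<open>The condition inside the description of \<open>extended_rep\<close>, named so that
  existence and uniqueness can be proved separately.\<close>

definition is_extension :: "('a operator \<Rightarrow> complex mat) \<Rightarrow> bool" where
  "is_extension \<phi> \<longleftrightarrow>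
     \<phi> \<in> extensional (carrier B) \<and> \<phi> \<in> Ring.ring_hom B (ring_mat TYPE(complex) n ()) \<and>
     (\<forall>c. \<phi> (scalar_op c) = c \<cdot>\<^sub>m 1\<^sub>m n) \<and> (\<forall>w\<in>W. \<phi> (weyl_op w) = \<rho> w) \<and>
     (\<forall>s\<in>dunkl_plus R Rp k. \<phi> s = 0\<^sub>m n n)"

text \<open>The homomorphism is taken from the module: injectivity of \<open>t\<close> makes the
  matrix of each \<open>b\<close> unique, so choosing it respects sums and products and gives the
  prescribed values on scalars, group elements and \<open>dunkl_plus\<close>.\<close>

lemma extension_exists:
  obtains \<phi> where "is_extension \<phi>" "\<And>b. b \<in> carrier B \<Longrightarrow> \<phi> b \<in> carrier_mat n n"
    "\<And>b u. b \<in> carrier B \<Longrightarrow> u \<in> carrier_vec n \<Longrightarrow> t (\<phi> b *\<^sub>v u) = b \<odot>\<^bsub>M\<^esub> t u"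
proof -
  define \<phi> where "\<phi> = (\<lambda>b\<in>carrier B. SOME X. X \<in> carrier_mat n n \<and> (\<forall>u\<in>carrier_vec n. t (X *\<^sub>v u) = b \<odot>\<^bsub>M\<^esub> t u))"
  have \<phi>: "\<phi> b \<in> carrier_mat n n \<and> (\<forall>u\<in>carrier_vec n. t (\<phi> b *\<^sub>v u) = b \<odot>\<^bsub>M\<^esub> t u)" if "b \<in> carrier B" for b
  proof -
    have "\<exists>X. X \<in> carrier_mat n n \<and> (\<forall>u\<in>carrier_vec n. t (X *\<^sub>v u) = b \<odot>\<^bsub>M\<^esub> t u)"
      using B_acts_by_matrix[OF that] by blast
    from someI_ex[OF this] show ?thesis using that unfolding \<phi>_def by simp
  qed
  note \<phi>c = conjunct1[OF \<phi>] and \<phi>t = conjunct2[OF \<phi>, THEN bspec]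
  have eq: "\<phi> b = X" if "b \<in> carrier B" "X \<in> carrier_mat n n"
    "\<And>u. u \<in> carrier_vec n \<Longrightarrow> t (X *\<^sub>v u) = b \<odot>\<^bsub>M\<^esub> t u" for b X
    by (rule mat_eqI_t[OF \<phi>c[OF that(1)] that(2)]) (simp add: \<phi>t[OF that(1)] that(3))
  have "is_extension \<phi>" unfolding is_extension_def
  proof (intro conjI allI ballI)
    show "\<phi> \<in> extensional (carrier B)" by (simp add: \<phi>_def)
    show "\<phi> (scalar_op c) = c \<cdot>\<^sub>m 1\<^sub>m n" for c
    proof (rule eq[OF generators_in_B(1)])
      fix u :: "complex vec" assume u: "u \<in> carrier_vec n"
      show "t ((c \<cdot>\<^sub>m 1\<^sub>m n) *\<^sub>v u) = scalar_op c \<odot>\<^bsub>M\<^esub> t u"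
        using t_scalar[OF u] scalar_mat_mult_vec[OF u] by simp
    qed simp
    show "\<phi> (weyl_op w) = \<rho> w" if "w \<in> W" for w
      by (rule eq[OF generators_in_B(2)[OF that] rep_closed[OF that] t_weyl[OF that]])
    show "\<phi> s = 0\<^sub>m n n" if s: "s \<in> dunkl_plus R Rp k" for s
    proof (rule eq)
      show "s \<in> carrier B" using dunkl_plus_kills[OF s] by blast
      fix u :: "complex vec" assume u: "u \<in> carrier_vec n"
      show "t (0\<^sub>m n n *\<^sub>v u) = s \<odot>\<^bsub>M\<^esub> t u"
        using dunkl_plus_kills[OF s] u t_zero zero_mat_mult_vec[OF u] by simp
    qed simp
    show "\<phi> \<in> Ring.ring_hom B (ring_mat TYPE(complex) n ())"
    proof (rule ring_hom_memI)
      fix a assume a: "a \<in> carrier B"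
      show "\<phi> a \<in> carrier (ring_mat TYPE(complex) n ())" using \<phi>c[OF a] by (simp add: ring_mat_ops)
      fix b assume b: "b \<in> carrier B"
      have ab: "a \<in> carrier H" "b \<in> carrier H" using a b B_subset_H by auto
      have "\<phi> (a \<otimes>\<^bsub>end_ring\<^esub> b) = \<phi> a * \<phi> b"
      proof (rule eq[OF subringE(6)[OF subring_B a b]])
        fix u :: "complex vec" assume u: "u \<in> carrier_vec n"
        have bu: "\<phi> b *\<^sub>v u \<in> carrier_vec n" using \<phi>c[OF b] u by simp
        have "\<phi> a * \<phi> b *\<^sub>v u = \<phi> a *\<^sub>v (\<phi> b *\<^sub>v u)" by (rule assoc_mult_mat_vec[OF \<phi>c[OF a] \<phi>c[OF b] u])
        then show "t (\<phi> a * \<phi> b *\<^sub>v u) = (a \<otimes>\<^bsub>end_ring\<^esub> b) \<odot>\<^bsub>M\<^esub> t u"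
          unfolding act_mult[OF ab t_closed[OF u]] using \<phi>t[OF a bu] \<phi>t[OF b u] by simp
      qed (use \<phi>c[OF a] \<phi>c[OF b] in simp)
      then show "\<phi> (a \<otimes>\<^bsub>B\<^esub> b) = \<phi> a \<otimes>\<^bsub>ring_mat TYPE(complex) n ()\<^esub> \<phi> b" by (simp add: ring_mat_ops)
      have "\<phi> (a \<oplus>\<^bsub>end_ring\<^esub> b) = \<phi> a + \<phi> b"
      proof (rule eq[OF subringE(7)[OF subring_B a b]])
        fix u :: "complex vec" assume u: "u \<in> carrier_vec n"
        have au: "\<phi> a *\<^sub>v u \<in> carrier_vec n" and bu: "\<phi> b *\<^sub>v u \<in> carrier_vec n" using \<phi>c[OF a] \<phi>c[OF b] u by auto
        have "(\<phi> a + \<phi> b) *\<^sub>v u = \<phi> a *\<^sub>v u + \<phi> b *\<^sub>v u" by (rule add_mult_distrib_mat_vec[OF \<phi>c[OF a] \<phi>c[OF b] u])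
        then show "t ((\<phi> a + \<phi> b) *\<^sub>v u) = (a \<oplus>\<^bsub>end_ring\<^esub> b) \<odot>\<^bsub>M\<^esub> t u"
          unfolding act_add[OF ab t_closed[OF u]] using \<phi>t[OF a u] \<phi>t[OF b u] t_add[OF au bu] by simp
      qed (use \<phi>c[OF a] \<phi>c[OF b] in simp)
      then show "\<phi> (a \<oplus>\<^bsub>B\<^esub> b) = \<phi> a \<oplus>\<^bsub>ring_mat TYPE(complex) n ()\<^esub> \<phi> b" by (simp add: ring_mat_ops)
    next
      have "\<phi> \<one>\<^bsub>end_ring\<^esub> = 1\<^sub>m n"
        by (rule eq[OF subringE(3)[OF subring_B]]) (auto simp: act_one t_closed)
      then show "\<phi> \<one>\<^bsub>B\<^esub> = \<one>\<^bsub>ring_mat TYPE(complex) n ()\<^esub>" by (simp add: ring_mat_ops)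
    qed
  qed
  then show thesis using that \<phi>c \<phi>t by metis
qed

text \<open>The values on all generators are prescribed, \<open>T y\<close> being a word of length
  one in \<open>dunkl_plus\<close>; outside \<open>carrier B\<close> extensionality decides.\<close>

lemma extension_unique:
  assumes "is_extension \<phi>" "is_extension \<phi>'" shows "\<phi> = \<phi>'"
proof (rule extensionalityI)
  show "\<phi> \<in> extensional (carrier B)" "\<phi>' \<in> extensional (carrier B)" using assms by (simp_all add: is_extension_def)
  fix b assume "b \<in> carrier B"
  then show "\<phi> b = \<phi>' b"
  proof (induction rule: B_induct)
    case (scalar c)
    then show ?case using assms by (simp add: is_extension_def)
  next
    case (dunkl y)
    then show ?case using assms dunkl_in_plus by (simp add: is_extension_def)
  next
    case (weyl w)
    then show ?case using assms by (simp add: is_extension_def)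
  next
    case (add a b)
    have "\<psi> (a \<oplus>\<^bsub>end_ring\<^esub> b) = \<psi> a + \<psi> b" if "is_extension \<psi>" for \<psi>
      using that add(1,2) ring_hom_add[of \<psi> B "ring_mat TYPE(complex) n ()" a b]
      by (simp add: is_extension_def ring_mat_ops)
    from this[OF assms(1)] this[OF assms(2)] show ?case by (simp only: add(3,4))
  next
    case (mult a b)
    have "\<psi> (a \<otimes>\<^bsub>end_ring\<^esub> b) = \<psi> a * \<psi> b" if "is_extension \<psi>" for \<psi>
      using that mult(1,2) ring_hom_mult[of \<psi> B "ring_mat TYPE(complex) n ()" a b]
      by (simp add: is_extension_def ring_mat_ops)
    from this[OF assms(1)] this[OF assms(2)] show ?case by (simp only: mult(3,4))
  qed
qed

abbreviation "ext \<equiv> extended_rep R Rp k n \<rho>"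

lemma extended_rep_acts:
  assumes "b \<in> carrier B"
  shows "ext b \<in> carrier_mat n n" "u \<in> carrier_vec n \<Longrightarrow> t (ext b *\<^sub>v u) = b \<odot>\<^bsub>M\<^esub> t u"
proof -
  obtain \<phi> where \<phi>: "is_extension \<phi>" "\<And>b. b \<in> carrier B \<Longrightarrow> \<phi> b \<in> carrier_mat n n"
    "\<And>b u. b \<in> carrier B \<Longrightarrow> u \<in> carrier_vec n \<Longrightarrow> t (\<phi> b *\<^sub>v u) = b \<odot>\<^bsub>M\<^esub> t u"
    by (rule extension_exists) (rule that, assumption, simp, simp)
  have "ext = (THE \<phi>. is_extension \<phi>)" unfolding extended_rep_def is_extension_def ..
  also have "\<dots> = \<phi>" using \<phi>(1) extension_unique by (intro the_equality) auto
  finally have "ext = \<phi>" .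
  then show "ext b \<in> carrier_mat n n" "u \<in> carrier_vec n \<Longrightarrow> t (ext b *\<^sub>v u) = b \<odot>\<^bsub>M\<^esub> t u"
    using \<phi>(2,3)[OF assms] by auto
qed

text \<open>Injectivity of \<open>t\<close> reads the matrix action off from the action in
  \<open>M\<close>; this is how identities in \<open>M\<close> are carried over to the Verma
  module.\<close>

lemma extended_rep_eqI:
  assumes "b \<in> carrier B" "u \<in> carrier_vec n" "v \<in> carrier_vec n" "b \<odot>\<^bsub>M\<^esub> t u = t v"
  shows "ext b *\<^sub>v u = v"
  using extended_rep_acts[OF assms(1)] assms by (intro t_inj) auto

end

section \<open>The Verma module\<close>

context H_module
begin

text \<open>In each summand the Dunkl operator acts first. The sum is handled through the
  annihilator of \<open>x\<close>, which is closed under zero and addition.\<close>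

lemma dunkl_sum_kills:
  assumes "x \<in> carrier M" "\<And>y. T y \<odot>\<^bsub>M\<^esub> x = \<zero>\<^bsub>M\<^esub>" shows "dunkl_sum \<odot>\<^bsub>M\<^esub> x = \<zero>\<^bsub>M\<^esub>"
proof -
  define K where "K = {a \<in> carrier H. a \<odot>\<^bsub>M\<^esub> x = \<zero>\<^bsub>M\<^esub>}"
  have "dunkl_sum \<in> K" unfolding dunkl_sum_def
  proof (rule op_sum_closed)
    show "\<zero>\<^bsub>end_ring\<^esub> \<in> K" using subringE(2)[OF subring_H] L.smult_l_zero[OF assms(1)] by (simp add: K_def)
    show "F \<oplus>\<^bsub>end_ring\<^esub> G \<in> K" if "F \<in> K" "G \<in> K" for F G
      using that subringE(7)[OF subring_H] act_add[OF _ _ assms(1)] by (simp add: K_def)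
    fix b :: 'a
    show "mult_op (coord b) \<otimes>\<^bsub>end_ring\<^esub> T (b, 0) \<in> K"
      using subringE(6)[OF subring_H generators_in_H(3)[OF linear_coord] generators_in_H(4)]
        act_mult[OF generators_in_H(3)[OF linear_coord] generators_in_H(4) assms(1)]
        L.smult_r_zero[OF generators_in_H(3)[OF linear_coord]] assms(2)
      by (simp add: K_def)
  qed simp
  then show ?thesis by (simp add: K_def)
qed

lemma euler_on_singular:
  assumes "x \<in> carrier M" "\<And>y. T y \<odot>\<^bsub>M\<^esub> x = \<zero>\<^bsub>M\<^esub>"
  shows "euler_op \<odot>\<^bsub>M\<^esub> x \<oplus>\<^bsub>M\<^esub> reflection_sum \<odot>\<^bsub>M\<^esub> x = \<zero>\<^bsub>M\<^esub>"
proof -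
  have r: "reflection_sum \<in> carrier H" using reflection_sum_group_algebra group_algebra_subset_H by blast
  show ?thesis
    using dunkl_sum_kills[OF assms] act_add[OF euler_op_H r assms(1)] by (simp add: euler_plus_reflection_sum)
qed

text \<open>On such a vector the Euler field plus the reflection sum is zero, so their eigenvalues
  determine each other. As the reflection sum lies in \<open>B\<close>, this makes the Euler
  eigenvalue transferable between modules that contain the same representation.\<close>

lemma euler_scalar_iff:
  assumes "x \<in> carrier M" "\<And>y. T y \<odot>\<^bsub>M\<^esub> x = \<zero>\<^bsub>M\<^esub>"
  shows "euler_op \<odot>\<^bsub>M\<^esub> x = sc c x \<longleftrightarrow> reflection_sum \<odot>\<^bsub>M\<^esub> x = sc (- c) x"
proof -
  have r: "reflection_sum \<in> carrier H" using reflection_sum_group_algebra group_algebra_subset_H by blast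
  have cl: "euler_op \<odot>\<^bsub>M\<^esub> x \<in> carrier M" "reflection_sum \<odot>\<^bsub>M\<^esub> x \<in> carrier M"
    "sc c x \<in> carrier M" "sc (- c) x \<in> carrier M"
    using L.smult_closed euler_op_H r C.s_closed assms(1) by auto
  have e: "euler_op \<odot>\<^bsub>M\<^esub> x \<oplus>\<^bsub>M\<^esub> reflection_sum \<odot>\<^bsub>M\<^esub> x = \<zero>\<^bsub>M\<^esub>" by (rule euler_on_singular[OF assms])
  have z: "sc c x \<oplus>\<^bsub>M\<^esub> sc (- c) x = \<zero>\<^bsub>M\<^esub>"
    using C.s_add_left[OF assms(1), of c "- c"] C.s_zero_left[OF assms(1)] by simp
  show ?thesis
  proof
    assume "euler_op \<odot>\<^bsub>M\<^esub> x = sc c x"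
    with e z have "sc c x \<oplus>\<^bsub>M\<^esub> reflection_sum \<odot>\<^bsub>M\<^esub> x = sc c x \<oplus>\<^bsub>M\<^esub> sc (- c) x" by simp
    then have "reflection_sum \<odot>\<^bsub>M\<^esub> x \<oplus>\<^bsub>M\<^esub> sc c x = sc (- c) x \<oplus>\<^bsub>M\<^esub> sc c x"
      unfolding L.M.a_comm[OF cl(2,3)] L.M.a_comm[OF cl(4,3)] .
    then show "reflection_sum \<odot>\<^bsub>M\<^esub> x = sc (- c) x" using cl by (simp add: L.M.add.right_cancel)
  next
    assume "reflection_sum \<odot>\<^bsub>M\<^esub> x = sc (- c) x"
    with e z have "euler_op \<odot>\<^bsub>M\<^esub> x \<oplus>\<^bsub>M\<^esub> sc (- c) x = sc c x \<oplus>\<^bsub>M\<^esub> sc (- c) x" by simp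
    then show "euler_op \<odot>\<^bsub>M\<^esub> x = sc c x" using cl by (simp add: L.M.add.right_cancel)
  qed
qed

end

section \<open>Identification of the simple module with the quotient of the Verma module\<close>

context embedded_rep
begin

text \<open>The Verma module satisfies \<open>lowest_weight\<close> with the same
  \<open>\<rho>\<close> and \<mu> as \<open>M\<close>, and the universal property supplies the map
  to \<open>M\<close>. Its injectivity on the lowest weight space, required by
  \<open>unique_maximal_submodule\<close>, is that of \<open>t\<close>.\<close>

lemma simple_quotient_isomorphic:
  assumes irr: "irreducible_module H M" and ch: "rep_of_character R ch = (n, \<rho>)"
  shows "module_isomorphic H M (simple_quotient R Rp k ch)"
proof -
  define U where "U = inflated_module R Rp k n \<rho>"
  have U: "carrier U = carrier_vec n" "(\<oplus>\<^bsub>U\<^esub>) = (+)" "\<And>b u. b \<odot>\<^bsub>U\<^esub> u = ext b *\<^sub>v u"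
    by (simp_all add: U_def inflated_module_def)
  interpret I: induced H B U
  proof (intro induced.intro induced_axioms.intro)
    show "ring H" by (rule ring_H)
    show "carrier B \<subseteq> carrier H" by (rule B_subset_H)
    show "b \<odot>\<^bsub>U\<^esub> u \<in> carrier U" if "b \<in> carrier B" "u \<in> carrier U" for b u
      using extended_rep_acts(1)[OF that(1)] that(2) by (simp add: U)
  qed (simp add: U)
  let ?V = "induced_module H B U"
  have V: "verma_module R Rp k ch = ?V" by (simp add: verma_module_def ch U_def)
  interpret V: H_module R Rp k ?V
    by (intro H_module.intro dunkl_setup_axioms I.left_module_M)
  have tV: "I.t u \<in> carrier ?V" if "u \<in> carrier_vec n" for u using I.t_closed that by (simp add: U)
  \<comment> \<open>An identity \<open>b (t u) = t v\<close> in \<open>M\<close> forces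
    \<open>ext b\<close> to send \<open>u\<close> to \<open>v\<close>, and \<open>b\<close> crosses
    the tensor sign; hence the same identity holds for 1 \<otimes> u and 1 \<otimes> v.\<close>
  have tV_smult: "b \<odot>\<^bsub>?V\<^esub> I.t u = I.t v"
    if "b \<in> carrier B" "u \<in> carrier_vec n" "v \<in> carrier_vec n" "b \<odot>\<^bsub>M\<^esub> t u = t v" for b u v
    using I.t_smult[of b u] extended_rep_eqI[OF that] that(1,2) by (simp add: U)
  have tV_add: "I.t (u + v) = I.t u \<oplus>\<^bsub>?V\<^esub> I.t v" if "u \<in> carrier_vec n" "v \<in> carrier_vec n" for u v
    using I.t_add[of u v] that by (simp add: U)
  have tV_scalar: "I.t (c \<cdot>\<^sub>v u) = scalar_op c \<odot>\<^bsub>?V\<^esub> I.t u" if "u \<in> carrier_vec n" for c u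
    by (rule tV_smult[symmetric]) (use that generators_in_B t_scalar in auto)
  have tV_zero: "I.t (0\<^sub>v n) = \<zero>\<^bsub>?V\<^esub>"
  proof -
    have "0 \<cdot>\<^sub>v 0\<^sub>v n = (0\<^sub>v n :: complex vec)" by (intro eq_vecI) auto
    then have "I.t (0\<^sub>v n) = V.sc 0 (I.t (0\<^sub>v n))" using tV_scalar[of "0\<^sub>v n" 0] by simp
    then show ?thesis using V.C.s_zero_left[OF tV[of "0\<^sub>v n"]] by simp
  qed
  have tV_dunkl: "T y \<odot>\<^bsub>?V\<^esub> I.t u = \<zero>\<^bsub>?V\<^esub>" if "u \<in> carrier_vec n" for y u
    using tV_smult[OF generators_in_B(3) that zero_carrier_vec] t_dunkl[OF that] t_zero tV_zero by simp
  have "lowest_weight R Rp k ?V n \<rho> I.t \<mu>"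
  proof (unfold_locales)
    show "irreducible_weyl_rep R n \<rho>" by (rule rep)
    fix u :: "complex vec" assume u: "u \<in> carrier_vec n"
    show "I.t u \<in> carrier ?V" by (rule tV[OF u])
    show "I.t (u + v) = I.t u \<oplus>\<^bsub>?V\<^esub> I.t v" if "v \<in> carrier_vec n" for v by (rule tV_add[OF u that])
    show "I.t (c \<cdot>\<^sub>v u) = V.sc c (I.t u)" for c by (rule tV_scalar[OF u])
    show "I.t (\<rho> w *\<^sub>v u) = weyl_op w \<odot>\<^bsub>?V\<^esub> I.t u" if w: "w \<in> W" for w
      by (rule tV_smult[symmetric]) (use u rep_closed[OF w] generators_in_B(2)[OF w] t_weyl[OF w u] in auto)
    show "T y \<odot>\<^bsub>?V\<^esub> I.t u = \<zero>\<^bsub>?V\<^esub>" for y by (rule tV_dunkl[OF u])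
    \<comment> \<open>\<open>tV_smult\<close> applies to elements of \<open>B\<close>, so the Euler
      eigenvalue is converted into one of the reflection sum, moved across, and converted
      back.\<close>
    have "reflection_sum \<odot>\<^bsub>M\<^esub> t u = sc (- \<mu>) (t u)"
      by (rule iffD1[OF euler_scalar_iff[OF t_closed[OF u] t_dunkl[OF u]] t_euler[OF u]])
    moreover have "reflection_sum \<in> carrier B" using reflection_sum_group_algebra group_algebra_subset_B by blast
    ultimately have "reflection_sum \<odot>\<^bsub>?V\<^esub> I.t u = I.t ((- \<mu>) \<cdot>\<^sub>v u)"
      using u by (intro tV_smult) (simp_all only: t_scalar smult_carrier_vec)
    then show "euler_op \<odot>\<^bsub>?V\<^esub> I.t u = V.sc \<mu> (I.t u)"
      unfolding V.euler_scalar_iff[OF tV[OF u] tV_dunkl[OF u]] tV_scalar[OF u] .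
  next
    fix N assume "Module.submodule N H ?V" "I.t ` carrier_vec n \<subseteq> N"
    then show "N = carrier ?V" using I.M_generated[of N] by (simp add: U)
  qed
  then interpret LW: lowest_weight R Rp k ?V n \<rho> I.t \<mu> .
  obtain h where h: "\<And>x. x \<in> carrier ?V \<Longrightarrow> h x \<in> carrier M"
      "\<And>x y. x \<in> carrier ?V \<Longrightarrow> y \<in> carrier ?V \<Longrightarrow> h (x \<oplus>\<^bsub>?V\<^esub> y) = h x \<oplus>\<^bsub>M\<^esub> h y"
      "\<And>a x. a \<in> carrier H \<Longrightarrow> x \<in> carrier ?V \<Longrightarrow> h (a \<odot>\<^bsub>?V\<^esub> x) = a \<odot>\<^bsub>M\<^esub> h x"
      "\<And>u. u \<in> carrier U \<Longrightarrow> h (I.t u) = t u"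
  proof (rule I.M_universal[OF L.left_module_axioms, of t])
    show "t u \<in> carrier M" if "u \<in> carrier U" for u using t_closed that by (simp add: U)
    show "t (u \<oplus>\<^bsub>U\<^esub> v) = t u \<oplus>\<^bsub>M\<^esub> t v" if "u \<in> carrier U" "v \<in> carrier U" for u v
      using t_add that by (simp add: U)
    show "t (b \<odot>\<^bsub>U\<^esub> u) = b \<odot>\<^bsub>M\<^esub> t u" if "b \<in> carrier B" "u \<in> carrier U" for b u
      using extended_rep_acts(2)[OF that(1)] that(2) by (simp add: U)
  qed (rule that)
  have "module_isomorphic H M (quotient_module ?V (THE N. maximal_submodule H ?V N))"
    by (rule LW.unique_maximal_submodule[OF irr h(1-3)]) (auto simp: h(4) U intro: t_kernel)
  then show ?thesis by (simp add: simple_quotient_def V)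
qed

end

theorem mainTheorem1:
  fixes R Rp :: "('a::euclidean_space \<Rightarrow> real) set"
    and k :: "('a \<Rightarrow> real) \<Rightarrow> complex"
    and V :: "('a operator, 'v) module"
  assumes "reduced_root_system R"
    and "positive_system R Rp"
    and "weyl_invariant R k"
    and "irreducible_module (cherednik_algebra R Rp k) V"
    and "finite_dim_module V"
  shows "\<exists>ch\<in>irreducible_characters R.
           module_isomorphic (cherednik_algebra R Rp k) V (simple_quotient R Rp k ch)"
proof -
  interpret dunkl_setup R Rp k
    using assms(1,2) by unfold_locales (auto simp: reduced_root_system_def positive_system_def)
  interpret V: H_module R Rp k V
    by (intro H_module.intro dunkl_setup_axioms) (use assms(4) in \<open>simp add: irreducible_module_def\<close>)
  obtain n \<rho> t \<mu> where "embedded_rep R Rp k V n \<rho> t \<mu>" using V.embedded_rep_exists[OF assms(4,5)] by blast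
  then interpret S: embedded_rep R Rp k V n \<rho> t \<mu> .
  \<comment> \<open>The Verma module of this character is built on the chosen
    \<open>\<sigma>\<close> rather than on \<open>\<rho>\<close>, so the embedding is exchanged
    before the comparison.\<close>
  obtain \<sigma> t' where \<sigma>: "rep_of_character R (weyl_character R n \<rho>) = (n, \<sigma>)" "embedded_rep R Rp k V n \<sigma> t' \<mu>"
    by (rule S.character_rep)
  have "weyl_character R n \<rho> \<in> irreducible_characters R"
    using S.rep by (auto simp: irreducible_characters_def)
  then show ?thesis
    using embedded_rep.simple_quotient_isomorphic[OF \<sigma>(2) assms(4) \<sigma>(1)] by blast
qed

end
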